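(* Let $F$ be a computable field of characteristic $0$ and $R=F[x_1,\dots,x_n]$ with a fixed ranking, the variables being numbered so that $x_1<\dots<x_n$. Fix a pseudo remainder algorithm $\mathrm{prem}$ with pseudo quotient $\mathrm{pquo}$, and a selection strategy $\mathrm{Select}$, as described in the context. The following explicit procedure **Decompose** (using the subalgorithms Reduce, InitSplit, ResSplitGCD, ResSplitDivide, ResSplitSquareFree and InsertEquation given in the context) is correct and terminates: *Input:* an algebraic system $S'$ over $R$, given as a pair $(S'_T,S'_Q)$ with $S'_T=\emptyset$. *Output:* a Thomas decomposition of $S'$, i.e. a finite family $(S_i)_{i=1}^m$ of simple systems with $\mathfrak{Sol}(S')=\bigcup_{i=1}^m\mathfrak{Sol}(S_i)$ and $\mathfrak{Sol}(S_i)\cap\mathfrak{Sol}(S_j)=\emptyset$ for $i\ne j$. *Procedure Decompose:* Put $P\leftarrow\{S'\}$ and $\mathit{Result}\leftarrow\emptyset$. While $P\neq\emptyset$: choose some $S\in P$ and remove it from $P$. If $S_Q=\emptyset$, add $S$ to $\mathit{Result}$. Otherwise do the following. (a) Let $q\leftarrow\mathrm{Select}(S_Q)$ and remove $q$ from $S_Q$; replace $q$ by $\mathrm{Reduce}(S,q)$ (keeping its type as equation or inequation); let $x\leftarrow\mathrm{ld}(q)$. (b) If $q$ is $0_{\neq}$ or $c_=$ with $c\in F\setminus\{0\}$, discard $S$ (nothing is put back into $P$ in this iteration). Otherwise carry out (c) if $x\ne1$ (and nothing if $x=1$), and then add the current $S$ to $P$. (c) Case 1: $q$ is an equation and $(S_T)_x$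 is an equation. If $\mathrm{Reduce}(S,\mathrm{res}_0((S_T)_x,q,x))=0$, then $(S,S_1,p)\leftarrow\mathrm{ResSplitGCD}(S,q)$, add $S_1$ to $P$, and $S\leftarrow\mathrm{InsertEquation}(S,p_=)$. Otherwise $S_Q\leftarrow S_Q\cup\{q_=,\ \mathrm{res}_0((S_T)_x,q,x)_=\}$. Case 2: $q$ is an equation and $(S_T)_x$ is not an equation. If $(S_T)_x$ is an inequation, move it from $S_T$ to $S_Q$. Then $(S,S_2)\leftarrow\mathrm{InitSplit}(S,q)$ and add $S_2$ to $P$; $(S,S_3,p)\leftarrow\mathrm{ResSplitSquareFree}(S,q)$ and add $S_3$ to $P$; $S\leftarrow\mathrm{InsertEquation}(S,p_=)$. Case 3: $q$ is an inequation and $(S_T)_x$ is an equation. Then $(S,S_4,p)\leftarrow\mathrm{ResSplitDivide}(S,(S_T)_x,q)$, add $S_4$ to $P$, and $S\leftarrow\mathrm{InsertEquation}(S,p_=)$. Case 4: $q$ is an inequation and $(S_T)_x$ is not an equation. Then $(S,S_5)\leftarrow\mathrm{InitSplit}(S,q)$ and add $S_5$ to $P$; $(S,S_6,p)\leftarrow\mathrm{ResSplitSquareFree}(S,q)$ and add $S_6$ to $P$. If $(S_T)_x$ is an inequation, then $(S,S_7,r)\leftarrow\mathrm{ResSplitDivide}(S,(S_T)_x,p_{\neq})$, add $S_7$ to $P$, and replace $(S_T)_x$ by $(r\cdot p)_{\neq}$. If $(S_T)_x$ is empty, set $(S_T)_x\leftarrow p_{\neq}$. When $P=\emptyset$, return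 $\mathit{Result}$.
   Context: **Basic notions.** $\overline F$ is the algebraic closure of $F$. A ranking is a total order $<$ on $\{1,x_1,\dots,x_n\}$ with $1<x_i$ for all $i$. The leader $\mathrm{ld}(p)$ of $p\in R\setminus F$ is the $<$-largest variable occurring in $p$; $\mathrm{ld}(p)=1$ for $p\in F$. The main degree $\mathrm{mdeg}(p)$ is the degree of $p$ in $\mathrm{ld}(p)$, and the initial $\mathrm{init}(p)$ is the coefficient of $\mathrm{ld}(p)^{\mathrm{mdeg}(p)}$ in $p$. For $\mathbf a\in\overline F^n$, $\phi_{\mathbf a}:R\to\overline F$ is the evaluation $x_i\mapsto a_i$, and $\phi_{<x_k,\mathbf a}:R\to\overline F[x_k,\dots,x_n]$ maps $x_i\mapsto a_i$ for $i<k$ and $x_i\mapsto x_i$ for $i\ge k$. For $p\in R$, $p_=$ and $p_{\neq}$ denote the equation $p=0$ and the inequation $p\ne0$; they are identified with the polynomial $p$ when convenient. An (algebraic) system over $R$ is a finite set $S$ of equations and inequations; $\mathfrak{Sol}(S)$ is the set of $\mathbf a\in\overline F^n$ with $\phi_{\mathbf a}(p)=0$ for all $p_=\in S$ and $\phi_{\mathbf a}(p)\neq0$ for all $p_{\neq}\in S$. $S_x=\{p\in S\mid\mathrm{ld}(p)=x\}$, $S_{<x}=\{p\in S\mid\mathrm{ld}(p)<x\}$. A system $S$ is simple if (1) it is triangular: $|S_{x_i}|\le1$ for all $i$ and $S$ contains no $c_=$ or $c_{\neq}$ with $c\in F$; (2) it has non-vanishing initials: $\phi_{\mathbf a}(\mathrm{init}(p))\ne0$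 for all $i$, $p\in S_{x_i}$, $\mathbf a\in\mathfrak{Sol}(S_{<x_i})$; (3) it is square-free: $\phi_{<x_i,\mathbf a}(p)\in\overline F[x_i]$ is square-free for all $i$, $p\in S_{x_i}$, $\mathbf a\in\mathfrak{Sol}(S_{<x_i})$. **Data structure.** In the procedure a system $S$ is a pair $(S_T,S_Q)$ and stands for $S_T\cup S_Q$; $S_T$ (the candidate simple system) is triangular, $S_Q$ is the queue. $(S_T)_x$ denotes the unique element of $S_T$ of leader $x$, if there is one (otherwise it is empty, neither equation nor inequation). **Pseudo division.** For $p,q$ with $\mathrm{ld}(p)=\mathrm{ld}(q)=x$: $m\cdot p=\mathrm{pquo}(p,q,x)\cdot q+\mathrm{prem}(p,q,x)$ with $\deg_x(q)>\deg_x(\mathrm{prem}(p,q,x))$, $\mathrm{ld}(m)<x$ and $m\mid\mathrm{init}(q)^k$ for some $k\ge0$. **Selection strategy.** $\mathrm{Select}$ maps a non-empty finite set $Q$ of equations and inequations to an element of $Q$ such that: if $\mathrm{Select}(Q)=q_=$, then $Q$ contains no equation of leader $<\mathrm{ld}(q)$; if $\mathrm{Select}(Q)=q_{\neq}$, then $Q$ contains no equation of leader $\le\mathrm{ld}(q)$. **Subresultants.** Let $\mathrm{ld}(p)=x$ and $d_p=\deg_x(p)>d_q=\deg_x(q)$. For $0\le i<d_q$, $\mathrm{PRS}_i(p,q,x)$ is the $i$-th subresultant of $p$ and $q$ with respect to $x$ if it is regular, i.e. has degree exactly $i$ in $x$, and $0$ otherwise. Moreover $\mathrm{PRS}_{d_p}(p,q,x)=p$,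 $\mathrm{PRS}_{d_q}(p,q,x)=q$, and $\mathrm{PRS}_i(p,q,x)=0$ for $d_q<i<d_p$. Put $\mathrm{res}_i(p,q,x)=\mathrm{init}(\mathrm{PRS}_i(p,q,x))$ for $0<i<d_p$, $\mathrm{res}_{d_p}(p,q,x)=1$, and $\mathrm{res}_0(p,q,x)=\mathrm{PRS}_0(p,q,x)$ (the usual resultant). If $q=0$, then $\mathrm{PRS}_i(p,q,x)=0$ and $\mathrm{res}_i(p,q,x)=0$ for all $i<d_p$. **Subalgorithms.** $\mathrm{Reduce}(S,p)$: set $q\leftarrow p$, $x\leftarrow\mathrm{ld}(p)$. While $x>1$, $(S_T)_x$ is an equation and $\mathrm{mdeg}(q)\ge\mathrm{mdeg}((S_T)_x)$: $q\leftarrow\mathrm{prem}(q,(S_T)_x,x)$, $x\leftarrow\mathrm{ld}(q)$. Then, if $x>1$ and $\mathrm{Reduce}(S,\mathrm{init}(q))=0$, return $\mathrm{Reduce}(S,\,q-\mathrm{init}(q)x^{\mathrm{mdeg}(q)})$; otherwise return $q$. $\mathrm{Split}(S,p)$: return the pair $\big((S_T,S_Q\cup\{p_{\neq}\}),\,(S_T,S_Q\cup\{p_=\})\big)$. $\mathrm{InitSplit}(S,q)$: $(S_1,S_2)\leftarrow\mathrm{Split}(S,\mathrm{init}(q))$; add $q$ to $(S_2)_Q$; return $(S_1,S_2)$. $\mathrm{ResSplit}(S,p,q)$, with $\mathrm{ld}(p)=x$ and $\deg_x(p)>\deg_x(q)$: let $i$ be the least integer $\ge0$ with $\mathrm{Reduce}(S,\mathrm{res}_j(p,q,x))=0$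 for all $j<i$ and $\mathrm{Reduce}(S,\mathrm{res}_i(p,q,x))\ne0$; return $(i,S_1,S_2)$ with $(S_1,S_2)=\mathrm{Split}(S,\mathrm{res}_i(p,q,x))$. $\mathrm{ResSplitGCD}(S,q)$, with $\mathrm{ld}(q)=x$: $(i,S_1,S_2)\leftarrow\mathrm{ResSplit}(S,(S_T)_x,q)$; add $q$ to $(S_2)_Q$; return $(S_1,S_2,\mathrm{PRS}_i((S_T)_x,q,x)_=)$. $\mathrm{ResSplitDivide}(S,p,q)$, with $\mathrm{ld}(p)=\mathrm{ld}(q)=x$: let $q'=q$ if $\mathrm{mdeg}(p)>\mathrm{mdeg}(q)$ and $q'=\mathrm{prem}(q,p,x)$ otherwise; $(i,S_1,S_2)\leftarrow\mathrm{ResSplit}(S,p,q')$; if $i>0$ let $\widetilde p=\mathrm{pquo}(p,\mathrm{PRS}_i(p,q',x),x)$, otherwise $\widetilde p=p$; add $q$ to $(S_2)_Q$; return $(S_1,S_2,\widetilde p)$. $\mathrm{ResSplitSquareFree}(S,p)$, with $\mathrm{ld}(p)=x$: $(i,S_1,S_2)\leftarrow\mathrm{ResSplit}(S,p,\frac{\partial}{\partial x}p)$; if $i>0$ let $r=\mathrm{pquo}(p,\mathrm{PRS}_i(p,\frac{\partial}{\partial x}p,x),x)$, otherwise $r=p$; add $p$ (as the equation or inequation it was given as) to $(S_2)_Q$; return $(S_1,S_2,r)$. $\mathrm{InsertEquation}(S,r_=)$, with $\mathrm{ld}(r)=x$: remove $(S_T)_x$ from $S_T$ if it is not empty, add $r_=$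 to $S_T$, and return $S$.
   Formalization: Added assumption: for nonzero c in F, prem(c·p,q,x) is a nonzero constant multiple of prem(p,q,x), as for all customary pseudo remainder algorithms; with multipliers m depending arbitrarily on p, the output can fail to be disjoint. *)

theory Defs
  imports
    "HOL-Library.Poly_Mapping"
    "HOL-Library.FuncSet"
    "HOL-Library.Disjoint_Sets"
    "HOL-Library.Monad_Syntax"
    "HOL-Library.While_Combinator"
    "HOL-Computational_Algebra.Squarefree"
    "HOL-Algebra.Algebraic_Closure_Type"
    "Subresultants.Subresultant"
begin

subsection \<open>Polynomials, leaders, initials\<close>

text \<open>
  A polynomial maps exponent vectors to coefficients.  The variables are
  \<open>x\<^sub>1, \<dots>, x\<^sub>n\<close>, so that \<open>F[x\<^sub>1, \<dots>, x\<^sub>n]\<close> is the subring \<open>poly_ring n\<close> of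
  the type \<open>'f mpoly\<close>, which has a variable for every natural number.  The index 0 is never
  used for a variable; it stands for the least element 1 of the ranking
  \<open>1 < x\<^sub>1 < \<dots> < x\<^sub>n\<close>, which thereby becomes the order of the natural numbers.
\<close>

type_synonym 'f mpoly = "(nat \<Rightarrow>\<^sub>0 nat) \<Rightarrow>\<^sub>0 'f"

definition var :: "nat \<Rightarrow> 'f::field mpoly" where
  "var x = Poly_Mapping.single (Poly_Mapping.single x 1) 1"

definition indets :: "'f::zero mpoly \<Rightarrow> nat set" where
  "indets p = (\<Union>m\<in>Poly_Mapping.keys p. Poly_Mapping.keys m)"

definition poly_ring :: "nat \<Rightarrow> 'f::zero mpoly set" where
  "poly_ring n = {p. indets p \<subseteq> {1..n}}"

definition ld :: "'f::zero mpoly \<Rightarrow> nat" where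
  "ld p = Max (insert 0 (indets p))"

text \<open>
  \<open>upoly x p\<close> is \<open>p\<close> as a univariate polynomial in \<open>x\<close>, whose coefficients are polynomials
  in the other variables; the inverse is evaluation at \<open>var x\<close>.
\<close>

definition upoly :: "nat \<Rightarrow> 'f::field mpoly \<Rightarrow> 'f mpoly poly" where
  "upoly x p = (\<Sum>m\<in>Poly_Mapping.keys p.
     Polynomial.monom
       (Poly_Mapping.single (Poly_Mapping.update x 0 m) (Poly_Mapping.lookup p m))
       (Poly_Mapping.lookup m x))"

definition deg_in :: "nat \<Rightarrow> 'f::field mpoly \<Rightarrow> nat" where
  "deg_in x p = Polynomial.degree (upoly x p)"

definition mdeg :: "'f::field mpoly \<Rightarrow> nat" where
  "mdeg p = deg_in (ld p) p"

definition init :: "'f::field mpoly \<Rightarrow> 'f mpoly" where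
  "init p = Polynomial.lead_coeff (upoly (ld p) p)"

definition partial_deriv :: "nat \<Rightarrow> 'f::field mpoly \<Rightarrow> 'f mpoly" where
  "partial_deriv x p = Polynomial.poly (pderiv (upoly x p)) (var x)"

definition phi :: "(nat \<Rightarrow> 'f alg_closure) \<Rightarrow> 'f::field mpoly \<Rightarrow> 'f alg_closure" where
  "phi a p = (\<Sum>m\<in>Poly_Mapping.keys p.
     to_ac (Poly_Mapping.lookup p m) *
     (\<Prod>i\<in>Poly_Mapping.keys m. a i ^ Poly_Mapping.lookup m i))"

text \<open>
  The substitution of \<open>a\<^sub>i\<close> for \<open>x\<^sub>i\<close>, \<open>i < k\<close>.  It is only applied to polynomials of
  leader \<open>x\<^sub>k\<close>; then the coefficients of \<open>upoly k p\<close> involve only \<open>x\<^sub>1, \<dots>, x\<^bsub>k-1\<^esub>\<close>, and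
  the result lies in the univariate polynomial ring in \<open>x\<^sub>k\<close>.
\<close>

definition phi_below :: "nat \<Rightarrow> (nat \<Rightarrow> 'f alg_closure) \<Rightarrow> 'f::field mpoly \<Rightarrow> 'f alg_closure poly"
  where "phi_below k a p = map_poly (phi a) (upoly k p)"


subsection \<open>Systems, simple systems, Thomas decompositions\<close>

datatype 'p constr = Equation (pol: 'p) | Inequation (pol: 'p)

type_synonym 'f system = "'f mpoly constr set"

definition algebraic_system :: "nat \<Rightarrow> 'f::field system \<Rightarrow> bool" where
  "algebraic_system n S \<longleftrightarrow> finite S \<and> pol ` S \<subseteq> poly_ring n"

fun satisfies :: "(nat \<Rightarrow> 'f alg_closure) \<Rightarrow> 'f::field mpoly constr \<Rightarrow> bool" where
  "satisfies a (Equation p) \<longleftrightarrow> phi a p = 0"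
| "satisfies a (Inequation p) \<longleftrightarrow> phi a p \<noteq> 0"

definition Sol :: "nat \<Rightarrow> 'f::field system \<Rightarrow> (nat \<Rightarrow> 'f alg_closure) set" where
  "Sol n S = {a \<in> {1..n} \<rightarrow>\<^sub>E UNIV. \<forall>c\<in>S. satisfies a c}"

definition sys_at :: "'f::zero system \<Rightarrow> nat \<Rightarrow> 'f system" where
  "sys_at S x = {c \<in> S. ld (pol c) = x}"

definition sys_below :: "'f::zero system \<Rightarrow> nat \<Rightarrow> 'f system" where
  "sys_below S x = {c \<in> S. ld (pol c) < x}"

definition triangular :: "nat \<Rightarrow> 'f::zero system \<Rightarrow> bool" where
  "triangular n S \<longleftrightarrow> (\<forall>i\<in>{1..n}. card (sys_at S i) \<le> 1) \<and> sys_at S 0 = {}"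

definition nonvanishing_initials :: "nat \<Rightarrow> 'f::field system \<Rightarrow> bool" where
  "nonvanishing_initials n S \<longleftrightarrow>
     (\<forall>i\<in>{1..n}. \<forall>c\<in>sys_at S i. \<forall>a\<in>Sol n (sys_below S i). phi a (init (pol c)) \<noteq> 0)"

definition squarefree_system :: "nat \<Rightarrow> 'f::field system \<Rightarrow> bool" where
  "squarefree_system n S \<longleftrightarrow>
     (\<forall>i\<in>{1..n}. \<forall>c\<in>sys_at S i. \<forall>a\<in>Sol n (sys_below S i). squarefree (phi_below i a (pol c)))"

definition simple_system :: "nat \<Rightarrow> 'f::field system \<Rightarrow> bool" where
  "simple_system n S \<longleftrightarrow> algebraic_system n S \<and>
     triangular n S \<and> nonvanishing_initials n S \<and> squarefree_system n S"

definition thomas_decomposition ::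
    "nat \<Rightarrow> 'f::field system \<Rightarrow> 'i set \<Rightarrow> ('i \<Rightarrow> 'f system) \<Rightarrow> bool" where
  "thomas_decomposition n S I D \<longleftrightarrow> finite I \<and>
     (\<forall>i\<in>I. simple_system n (D i)) \<and>
     Sol n S = (\<Union>i\<in>I. Sol n (D i)) \<and>
     disjoint_family_on (\<lambda>i. Sol n (D i)) I"


subsection \<open>Pseudo division, selection strategies, subresultants\<close>

type_synonym 'f pdiv = "'f mpoly \<Rightarrow> 'f mpoly \<Rightarrow> nat \<Rightarrow> 'f mpoly"

definition pseudo_division :: "nat \<Rightarrow> 'f::field pdiv \<Rightarrow> 'f pdiv \<Rightarrow> bool" where
  "pseudo_division n prem pquo \<longleftrightarrow>
     (\<forall>p\<in>poly_ring n. \<forall>q\<in>poly_ring n. \<forall>x\<in>{1..n}. ld p = x \<longrightarrow> ld q = x \<longrightarrow>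
        prem p q x \<in> poly_ring n \<and> pquo p q x \<in> poly_ring n \<and>
        deg_in x q > deg_in x (prem p q x) \<and>
        (\<exists>m\<in>poly_ring n. m * p = pquo p q x * q + prem p q x \<and>
           ld m < x \<and> (\<exists>k. m dvd init q ^ k)))"

text \<open>
  The multiplier \<open>m\<close> of a pseudo division by \<open>q\<close> is not determined by \<open>pseudo_division\<close>; the
  next condition says that the choice does not react to a rescaling of the dividend by a nonzero
  constant, as is the case for the customary pseudo remainder algorithms.  The procedure relies
  on it: for \<open>d = mdeg p \<ge> 2\<close> the initials of \<open>p\<close> and of its derivative differ by the factor
  \<open>d\<close>, and if \<open>Reduce\<close> sent \<open>d \<cdot> init p\<close> to 0 but not \<open>init p\<close>, then \<open>ResSplitSquareFree\<close>
  would return a polynomial whose leader is smaller than \<open>ld p\<close>.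
\<close>

definition scaling_compatible :: "nat \<Rightarrow> 'f::field pdiv \<Rightarrow> bool" where
  "scaling_compatible n prem \<longleftrightarrow>
     (\<forall>p\<in>poly_ring n. \<forall>q\<in>poly_ring n. \<forall>x\<in>{1..n}. ld p = x \<longrightarrow> ld q = x \<longrightarrow>
        (\<forall>c. c \<noteq> 0 \<longrightarrow> (\<exists>u. u \<noteq> 0 \<and>
           prem (Poly_Mapping.single 0 c * p) q x = Poly_Mapping.single 0 u * prem p q x)))"

definition selection_strategy :: "nat \<Rightarrow> ('f::field system \<Rightarrow> 'f mpoly constr) \<Rightarrow> bool" where
  "selection_strategy n sel \<longleftrightarrow>
     (\<forall>Q. algebraic_system n Q \<longrightarrow> Q \<noteq> {} \<longrightarrow> sel Q \<in> Q \<and>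
        (\<forall>q. sel Q = Equation q \<longrightarrow> \<not> (\<exists>p. Equation p \<in> Q \<and> ld p < ld q)) \<and>
        (\<forall>q. sel Q = Inequation q \<longrightarrow> \<not> (\<exists>p. Equation p \<in> Q \<and> ld p \<le> ld q)))"

text \<open>
  \<open>PRS\<close> and \<open>res\<close> are meant for \<open>ld p = x\<close>, \<open>deg_in x p > deg_in x q\<close> and \<open>i \<le> deg_in x p\<close>.
  The zero polynomial has degree 0 here, so for \<open>q = 0\<close> the second case of \<open>PRS\<close> yields
  \<open>PRS p 0 x 0 = 0\<close>.
\<close>

definition PRS :: "'f::field mpoly \<Rightarrow> 'f mpoly \<Rightarrow> nat \<Rightarrow> nat \<Rightarrow> 'f mpoly" where
  "PRS p q x i =
     (if i = deg_in x p then p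
      else if i = deg_in x q then q
      else if i < deg_in x q then
        (let s = subresultant i (upoly x p) (upoly x q)
         in if Polynomial.degree s = i then Polynomial.poly s (var x) else 0)
      else 0)"

definition res :: "'f::field mpoly \<Rightarrow> 'f mpoly \<Rightarrow> nat \<Rightarrow> nat \<Rightarrow> 'f mpoly" where
  "res p q x i =
     (if i = deg_in x p then 1
      else if i = 0 then PRS p q x 0
      else init (PRS p q x i))"


subsection \<open>The subalgorithms\<close>

text \<open>
  A pair \<open>(S\<^sub>T, S\<^sub>Q)\<close> of candidate simple system and queue.  Subalgorithms that depend
  on \<open>Reduce\<close> return an option, where \<open>None\<close> means that the computation does not
  terminate.
\<close>

type_synonym 'f psys = "'f system \<times> 'f system"

definition system_of :: "'f::field psys \<Rightarrow> 'f system" where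
  "system_of S = fst S \<union> snd S"

definition elem_at :: "'f::field psys \<Rightarrow> nat \<Rightarrow> 'f mpoly constr option" where
  "elem_at S x = (if \<exists>!c. c \<in> sys_at (fst S) x then Some (THE c. c \<in> sys_at (fst S) x) else None)"

definition reduce_loop :: "'f::field pdiv \<Rightarrow> 'f psys \<Rightarrow> 'f mpoly \<Rightarrow> 'f mpoly option" where
  "reduce_loop prem S =
     while_option
       (\<lambda>q. ld q > 0 \<and> (\<exists>t. elem_at S (ld q) = Some (Equation t) \<and> mdeg q \<ge> mdeg t))
       (\<lambda>q. prem q (pol (the (elem_at S (ld q)))) (ld q))"

partial_function (option) reduce ::
    "'f::field pdiv \<Rightarrow> 'f psys \<Rightarrow> 'f mpoly \<Rightarrow> 'f mpoly option" where
  "reduce prem S p = do {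
     q \<leftarrow> reduce_loop prem S p;
     if ld q > 0 then do {
       r \<leftarrow> reduce prem S (init q);
       if r = 0 then reduce prem S (q - init q * var (ld q) ^ mdeg q) else Some q
     } else Some q }"

fun enqueue :: "'f::field mpoly constr \<Rightarrow> 'f psys \<Rightarrow> 'f psys" where
  "enqueue c (T, Q) = (T, insert c Q)"

definition split :: "'f::field psys \<Rightarrow> 'f mpoly \<Rightarrow> 'f psys \<times> 'f psys" where
  "split S p = (enqueue (Inequation p) S, enqueue (Equation p) S)"

definition init_split :: "'f::field psys \<Rightarrow> 'f mpoly constr \<Rightarrow> 'f psys \<times> 'f psys" where
  "init_split S c = (let (S1, S2) = split S (init (pol c)) in (S1, enqueue c S2))"

definition res_split ::
    "'f::field pdiv \<Rightarrow> 'f psys \<Rightarrow> 'f mpoly \<Rightarrow> 'f mpoly \<Rightarrow> (nat \<times> 'f psys \<times> 'f psys) option" where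
  "res_split prem S p q =
     (let x = ld p;
          i = (LEAST i. reduce prem S (res p q x i) \<noteq> Some 0)
      in do {
        _ \<leftarrow> reduce prem S (res p q x i);
        Some (i, split S (res p q x i)) })"

definition res_split_gcd ::
    "'f::field pdiv \<Rightarrow> 'f psys \<Rightarrow> 'f mpoly constr \<Rightarrow> ('f psys \<times> 'f psys \<times> 'f mpoly) option" where
  "res_split_gcd prem S c =
     (let q = pol c; x = ld q; t = pol (the (elem_at S x))
      in do {
        (i, S1, S2) \<leftarrow> res_split prem S t q;
        Some (S1, enqueue c S2, PRS t q x i) })"

definition res_split_divide ::
    "'f::field pdiv \<Rightarrow> 'f pdiv \<Rightarrow> 'f psys \<Rightarrow> 'f mpoly \<Rightarrow> 'f mpoly constr \<Rightarrow>
     ('f psys \<times> 'f psys \<times> 'f mpoly) option" where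
  "res_split_divide prem pquo S p c =
     (let q = pol c; x = ld p;
          q' = (if mdeg p > mdeg q then q else prem q p x)
      in do {
        (i, S1, S2) \<leftarrow> res_split prem S p q';
        Some (S1, enqueue c S2, if i > 0 then pquo p (PRS p q' x i) x else p) })"

definition res_split_squarefree ::
    "'f::field pdiv \<Rightarrow> 'f pdiv \<Rightarrow> 'f psys \<Rightarrow> 'f mpoly constr \<Rightarrow>
     ('f psys \<times> 'f psys \<times> 'f mpoly) option" where
  "res_split_squarefree prem pquo S c =
     (let p = pol c; x = ld p; p' = partial_deriv x p
      in do {
        (i, S1, S2) \<leftarrow> res_split prem S p p';
        Some (S1, enqueue c S2, if i > 0 then pquo p (PRS p p' x i) x else p) })"

definition remove_at :: "'f::field psys \<Rightarrow> nat \<Rightarrow> 'f psys" where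
  "remove_at S x = (fst S - set_option (elem_at S x), snd S)"

definition insert_elem :: "'f::field mpoly constr \<Rightarrow> 'f psys \<Rightarrow> 'f psys" where
  "insert_elem c S = (insert c (fst S), snd S)"

definition insert_equation :: "'f::field psys \<Rightarrow> 'f mpoly \<Rightarrow> 'f psys" where
  "insert_equation S r = insert_elem (Equation r) (remove_at S (ld r))"


subsection \<open>The procedure Decompose\<close>

text \<open>The four cases of step (c) return the set of all systems that are put into \<open>P\<close>.\<close>

definition case1 ::
    "'f::field pdiv \<Rightarrow> 'f psys \<Rightarrow> 'f mpoly \<Rightarrow> 'f psys set option" where
  "case1 prem S q =
     (let x = ld q; r0 = res (pol (the (elem_at S x))) q x 0
      in do {
        r \<leftarrow> reduce prem S r0;
        if r = 0 then do {
          (S, S1, p) \<leftarrow> res_split_gcd prem S (Equation q);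
          Some {insert_equation S p, S1}
        } else Some {enqueue (Equation q) (enqueue (Equation r0) S)} })"

definition case2 ::
    "'f::field pdiv \<Rightarrow> 'f pdiv \<Rightarrow> 'f psys \<Rightarrow> 'f mpoly \<Rightarrow> 'f psys set option" where
  "case2 prem pquo S q =
     (let x = ld q;
          S = (case elem_at S x of
                 Some (Inequation t) \<Rightarrow> enqueue (Inequation t) (remove_at S x)
               | _ \<Rightarrow> S);
          (S, S2) = init_split S (Equation q)
      in do {
        (S, S3, p) \<leftarrow> res_split_squarefree prem pquo S (Equation q);
        Some {insert_equation S p, S2, S3} })"

definition case3 ::
    "'f::field pdiv \<Rightarrow> 'f pdiv \<Rightarrow> 'f psys \<Rightarrow> 'f mpoly \<Rightarrow> 'f psys set option" where
  "case3 prem pquo S q = do {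
     (S, S4, p) \<leftarrow> res_split_divide prem pquo S (pol (the (elem_at S (ld q)))) (Inequation q);
     Some {insert_equation S p, S4} }"

definition case4 ::
    "'f::field pdiv \<Rightarrow> 'f pdiv \<Rightarrow> 'f psys \<Rightarrow> 'f mpoly \<Rightarrow> 'f psys set option" where
  "case4 prem pquo S q =
     (let x = ld q;
          (S, S5) = init_split S (Inequation q)
      in do {
        (S, S6, p) \<leftarrow> res_split_squarefree prem pquo S (Inequation q);
        case elem_at S x of
          Some t \<Rightarrow> do {
            (S, S7, r) \<leftarrow> res_split_divide prem pquo S (pol t) (Inequation p);
            Some {insert_elem (Inequation (r * p)) (remove_at S x), S5, S6, S7} }
        | None \<Rightarrow> Some {insert_elem (Inequation p) S, S5, S6} })"

text \<open>
  One pass through the loop body for a system \<open>S\<close> with non-empty queue; the result is the set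
  of systems that this pass puts into \<open>P\<close>.
\<close>

definition process ::
    "'f::field pdiv \<Rightarrow> 'f pdiv \<Rightarrow> ('f system \<Rightarrow> 'f mpoly constr) \<Rightarrow> 'f psys \<Rightarrow> 'f psys set option"
  where
  "process prem pquo sel S =
     (let c = sel (snd S); S = (fst S, snd S - {c})
      in do {
        q \<leftarrow> reduce prem S (pol c);
        let x = ld q;
        (case map_constr (\<lambda>_. q) c of
           Equation q \<Rightarrow>
             if x = 0 then Some (if q \<noteq> 0 then {} else {S})
             else (case elem_at S x of
                     Some (Equation t) \<Rightarrow> case1 prem S q
                   | _ \<Rightarrow> case2 prem pquo S q)
         | Inequation q \<Rightarrow>
             if x = 0 then Some (if q = 0 then {} else {S})
             else (case elem_at S x of
                     Some (Equation t) \<Rightarrow> case3 prem pquo S q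
                   | _ \<Rightarrow> case4 prem pquo S q)) })"

text \<open>
  A state is a pair \<open>(P, Result)\<close>.  The step relation leaves the choice of \<open>S \<in> P\<close> open.
\<close>

type_synonym 'f state = "'f psys set \<times> 'f psys set"

inductive decompose_step ::
    "'f::field pdiv \<Rightarrow> 'f pdiv \<Rightarrow> ('f system \<Rightarrow> 'f mpoly constr) \<Rightarrow> 'f state \<Rightarrow> 'f state \<Rightarrow> bool"
  for prem pquo sel where
  finished: "S \<in> P \<Longrightarrow> snd S = {} \<Longrightarrow>
     decompose_step prem pquo sel (P, Result) (P - {S}, insert S Result)"
| processed: "S \<in> P \<Longrightarrow> snd S \<noteq> {} \<Longrightarrow> process prem pquo sel S = Some N \<Longrightarrow>
     decompose_step prem pquo sel (P, Result) ((P - {S}) \<union> N, Result)"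

definition decompose_start :: "'f::field system \<Rightarrow> 'f state" where
  "decompose_start S' = ({({}, S')}, {})"

text \<open>
  Termination: the main loop has no infinite run, and in no reachable state is there a choice
  of \<open>S \<in> P\<close> for which the loop body fails to return.
\<close>

definition decompose_terminates ::
    "'f::field pdiv \<Rightarrow> 'f pdiv \<Rightarrow> ('f system \<Rightarrow> 'f mpoly constr) \<Rightarrow> 'f system \<Rightarrow> bool" where
  "decompose_terminates prem pquo sel S' \<longleftrightarrow>
     \<not> (\<exists>\<sigma>. \<sigma> 0 = decompose_start S' \<and> (\<forall>k. decompose_step prem pquo sel (\<sigma> k) (\<sigma> (Suc k)))) \<and>
     (\<forall>P Result S. (decompose_step prem pquo sel)\<^sup>*\<^sup>* (decompose_start S') (P, Result) \<longrightarrow>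
        S \<in> P \<longrightarrow> snd S \<noteq> {} \<longrightarrow> process prem pquo sel S \<noteq> None)"

definition decompose_correct ::
    "nat \<Rightarrow> 'f::field pdiv \<Rightarrow> 'f pdiv \<Rightarrow> ('f system \<Rightarrow> 'f mpoly constr) \<Rightarrow> 'f system \<Rightarrow> bool" where
  "decompose_correct n prem pquo sel S' \<longleftrightarrow>
     (\<forall>Result. (decompose_step prem pquo sel)\<^sup>*\<^sup>* (decompose_start S') ({}, Result) \<longrightarrow>
        thomas_decomposition n S' Result system_of)"

end

theory Submission
  imports Defs "HOL-Library.Extended_Nat"
begin

text \<open>
  Correctness.  The invariant of a pair \<open>(T, Q)\<close> is that every element of \<open>T\<close> of leader \<open>x\<close> has
  a nonvanishing initial and is square-free on the solutions of the elements of \<open>T \<union> Q\<close> with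
  leader below \<open>x\<close>; once \<open>Q\<close> is empty this says that \<open>T\<close> is simple.  At such solutions a
  polynomial vanishes iff its reduction does.  So after \<open>res\<^sub>i \<noteq> 0\<close> has been added, \<open>i\<close> is the
  degree of the gcd of the specialised polynomials and \<open>PRS\<^sub>i\<close> specialises to that gcd:
  the matrix of the \<open>i\<close>-th principal subresultant coefficient is singular iff there is a
  nontrivial combination \<open>U F + V G\<close> of degree below \<open>i\<close>, with degree bounds on \<open>U\<close> and \<open>V\<close>
  under which it has to be a syzygy.

  Termination.  Every system put back into \<open>P\<close> is smaller than the one taken out in the
  lexicographic combination of the degrees of the equations in \<open>T\<close> (infinite where there is
  none), the least leader of an equation in \<open>Q\<close> that does not reduce to 0, and the multiset of
  the leaders in \<open>Q\<close>.
\<close>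

subsection \<open>Polynomials as univariate polynomials\<close>

abbreviation lookup where "lookup \<equiv> Poly_Mapping.lookup"
abbreviation keys where "keys \<equiv> Poly_Mapping.keys"
abbreviation single where "single \<equiv> Poly_Mapping.single"

lemma poly_mapping_single_induct [case_names zero add]:
  assumes "P 0" and "\<And>m c p. P p \<Longrightarrow> P (single m c + p)"
  shows "P (p :: 'a \<Rightarrow>\<^sub>0 'b::comm_monoid_add)"
proof (induction p rule: update_induct)
  case (update f a b)
  have "Poly_Mapping.update a b f = single a b + f"
    using update(1) by (intro poly_mapping_eqI)
      (auto simp: lookup_update lookup_add lookup_single in_keys_iff when_def)
  with assms(2) update show ?case by metis
qed (fact assms(1))

lemma sum_keys_mult:
  fixes g :: "'a::monoid_add \<Rightarrow> 'b::semiring_0 \<Rightarrow> 'c::semiring_0"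
  assumes zero: "\<And>m. g m 0 = 0"
    and add: "\<And>m b c. g m (b + c) = g m b + g m c"
    and mult: "\<And>m n b c. g (m + n) (b * c) = g m b * g n c"
  defines "h \<equiv> \<lambda>p. \<Sum>m\<in>keys p. g m (lookup p m)"
  shows "h (p * q) = h p * h q"
proof -
  have h0: "h 0 = 0" by (simp add: h_def)
  have h_add: "h (p + q) = h p + h q" for p q
    unfolding h_def by (rule setsum_keys_plus_distrib) (simp_all add: zero add)
  have h_single: "h (single m c) = g m c" for m c
    by (cases "c = 0") (simp_all add: h_def zero)
  have *: "h (single m c * q) = g m c * h q" for m c
  proof (induction q rule: poly_mapping_single_induct)
    case (add n d q)
    then show ?case
      by (simp add: distrib_left h_add mult_single h_single mult)
  qed (simp add: h0)
  show ?thesis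
  proof (induction p rule: poly_mapping_single_induct)
    case (add n d q)
    then show ?case
      by (simp add: distrib_right h_add * h_single)
  qed (simp add: h0)
qed

lemma phi_single [simp]: "phi a (single m c) = to_ac c * (\<Prod>i\<in>keys m. a i ^ lookup m i)"
  by (cases "c = 0") (simp_all add: phi_def)

lemma phi_0 [simp]: "phi a 0 = 0"
  by (simp add: phi_def)

lemma phi_1 [simp]: "phi a 1 = 1"
  by (simp flip: single_one)

lemma phi_add [simp]: "phi a (p + q) = phi a p + phi a q"
  unfolding phi_def by (rule setsum_keys_plus_distrib) (simp_all add: distrib_right)

lemma monomial_value_add:
  fixes a :: "nat \<Rightarrow> 'a::comm_monoid_mult"
  shows "(\<Prod>i\<in>keys (m + n). a i ^ lookup (m + n) i) =
    (\<Prod>i\<in>keys m. a i ^ lookup m i) * (\<Prod>i\<in>keys n. a i ^ lookup n i)"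
proof -
  let ?A = "keys m \<union> keys n"
  have *: "(\<Prod>i\<in>keys k. a i ^ lookup k i) = (\<Prod>i\<in>?A. a i ^ lookup k i)"
    if "keys k \<subseteq> ?A" for k
    using that by (intro prod.mono_neutral_left) (auto simp: in_keys_iff)
  show ?thesis
    unfolding *[OF keys_add] *[OF Un_upper1] *[OF Un_upper2]
    by (simp add: lookup_add power_add prod.distrib)
qed

lemma phi_mult [simp]: "phi a (p * q) = phi a p * phi a q"
  unfolding phi_def
  by (rule sum_keys_mult) (simp_all add: monomial_value_add algebra_simps)

interpretation phi: comm_ring_hom "phi a" for a
  by unfold_locales simp_all

interpretation map_poly_phi: map_poly_comm_ring_hom "phi a" for a ..

lemma phi_var [simp]: "phi a (var x) = a x"
  by (simp add: var_def)

definition upoly_monom :: "nat \<Rightarrow> (nat \<Rightarrow>\<^sub>0 nat) \<Rightarrow> 'f::field \<Rightarrow> 'f mpoly poly" where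
  "upoly_monom x m c = monom (single (Poly_Mapping.update x 0 m) c) (lookup m x)"

lemma upoly_alt: "upoly x p = (\<Sum>m\<in>keys p. upoly_monom x m (lookup p m))"
  by (simp add: upoly_def upoly_monom_def)

lemma upoly_monom_mult: "upoly_monom x (m + n) (b * c) = upoly_monom x m b * upoly_monom x n c"
proof -
  have "Poly_Mapping.update x 0 (m + n) = Poly_Mapping.update x 0 m + Poly_Mapping.update x 0 n"
    by (intro poly_mapping_eqI) (simp add: lookup_update lookup_add)
  then show ?thesis
    by (simp add: upoly_monom_def mult_monom mult_single lookup_add)
qed

lemma upoly_monom_add: "upoly_monom x m (b + c) = upoly_monom x m b + upoly_monom x m c"
  by (simp add: upoly_monom_def single_add add_monom)

lemma upoly_monom_0: "upoly_monom x m 0 = 0"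
  by (simp add: upoly_monom_def)

lemma upoly_single: "upoly x (single m c) = upoly_monom x m c"
  by (cases "c = 0") (simp_all add: upoly_alt upoly_monom_0)

lemma upoly_0 [simp]: "upoly x 0 = 0"
  by (simp add: upoly_def)

lemma update_0_0: "Poly_Mapping.update x 0 (0 :: 'a \<Rightarrow>\<^sub>0 'b::zero) = 0"
  by (intro poly_mapping_eqI) (simp add: lookup_update)

lemma upoly_const: "upoly x (single 0 c) = [:single 0 c:]"
  by (simp add: upoly_single upoly_monom_def update_0_0 monom_0)

lemma upoly_1 [simp]: "upoly x 1 = 1"
  using upoly_const[of x 1] by (simp only: single_one pCons_one)

lemma upoly_add [simp]: "upoly x (p + q) = upoly x p + upoly x q"
  unfolding upoly_alt
  by (rule setsum_keys_plus_distrib) (simp_all add: upoly_monom_0 upoly_monom_add)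

lemma upoly_mult [simp]: "upoly x (p * q) = upoly x p * upoly x q"
  unfolding upoly_alt
  by (rule sum_keys_mult) (simp_all add: upoly_monom_0 upoly_monom_add upoly_monom_mult)

interpretation upoly: comm_ring_hom "upoly x" for x
  by unfold_locales simp_all

lemma upoly_var: "upoly x (var x) = [:0, 1:]"
proof -
  have "Poly_Mapping.update x 0 (single x (Suc 0)) = 0"
    by (intro poly_mapping_eqI) (simp add: lookup_update lookup_single when_def)
  then show ?thesis
    by (simp add: var_def upoly_single upoly_monom_def monom_altdef)
qed

lemma single_power: "single m (c::'b::comm_semiring_1) ^ k =
    (single ((\<Sum>i<k. m) :: 'a::comm_monoid_add) (c ^ k))"
  by (induction k) (simp_all add: mult_single add.commute)

lemma var_power: "var x ^ k = single (single x k) 1"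
proof -
  have "(\<Sum>i<k. single x (Suc 0)) = single x k"
  proof (induction k)
    case (Suc k)
    then show ?case using single_add[of x k "Suc 0"] by (simp del: sum_constant)
  qed simp
  then show ?thesis by (simp add: var_def single_power del: sum_constant)
qed

lemma poly_upoly_var [simp]: "poly (upoly x p) (var x) = p"
proof (induction p rule: poly_mapping_single_induct)
  case (add m c p)
  have "Poly_Mapping.update x 0 m + single x (lookup m x) = m"
    by (intro poly_mapping_eqI) (simp add: lookup_update lookup_add lookup_single when_def)
  then show ?case
    using add by (simp add: upoly_single upoly_monom_def poly_monom var_power mult_single)
qed simp

lemma upoly_eq_iff: "upoly x p = upoly x q \<longleftrightarrow> p = q"
  by (metis poly_upoly_var)

lemma upoly_eq_0_iff [simp]: "upoly x p = 0 \<longleftrightarrow> p = 0"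
  using upoly_eq_iff[of x p 0] by simp

subsection \<open>Occurring variables and leaders\<close>

lemma finite_indets [simp]: "finite (indets p)"
  by (simp add: indets_def)

lemma indets_0 [simp]: "indets 0 = {}"
  by (simp add: indets_def)

lemma indets_const [simp]: "indets (single 0 c) = {}"
  by (auto simp: indets_def)

lemma indets_1 [simp]: "indets 1 = {}"
  by (simp add: indets_def)

lemma indets_var [simp]: "indets (var x :: 'f::field mpoly) = {x}"
  by (simp add: indets_def var_def)

lemma indets_uminus [simp]: "indets (- p) = indets (p :: 'f::field mpoly)"
  by (simp add: indets_def keys_def)

lemma indets_add: "indets (p + q) \<subseteq> indets p \<union> indets q"
  using keys_add[of p q] by (fastforce simp: indets_def)

lemma indets_diff: "indets (p - q :: 'f::field mpoly) \<subseteq> indets p \<union> indets q"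
  using indets_add[of p "- q"] by simp

lemma indets_mult: "indets (p * q) \<subseteq> indets p \<union> indets (q :: 'f::field mpoly)"
proof
  fix i assume "i \<in> indets (p * q)"
  then obtain m where "m \<in> keys (p * q)" "i \<in> keys m" by (auto simp: indets_def)
  then obtain b c where "m = b + c" "b \<in> keys p" "c \<in> keys q" using keys_mult by blast
  with \<open>i \<in> keys m\<close> keys_add[of b c] show "i \<in> indets p \<union> indets q"
    by (auto simp: indets_def)
qed

lemma poly_ring_0 [simp]: "0 \<in> poly_ring k"
  and poly_ring_1 [simp]: "1 \<in> poly_ring k"
  and poly_ring_const [simp]: "single 0 c \<in> poly_ring k"
  by (simp_all add: poly_ring_def)

lemma poly_ring_add: "p \<in> poly_ring k \<Longrightarrow> q \<in> poly_ring k \<Longrightarrow> p + q \<in> poly_ring k"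
  unfolding poly_ring_def using indets_add[of p q] by auto

lemma poly_ring_uminus: "p \<in> poly_ring k \<Longrightarrow> - p \<in> poly_ring k"
  for p :: "'f::field mpoly"
  by (simp add: poly_ring_def)

lemma poly_ring_diff: "p \<in> poly_ring k \<Longrightarrow> q \<in> poly_ring k \<Longrightarrow> p - q \<in> poly_ring k"
  for p :: "'f::field mpoly"
  unfolding poly_ring_def using indets_diff[of p q] by auto

lemma poly_ring_mult: "p \<in> poly_ring k \<Longrightarrow> q \<in> poly_ring k \<Longrightarrow> p * q \<in> poly_ring k"
  for p :: "'f::field mpoly"
  unfolding poly_ring_def using indets_mult[of p q] by auto

lemma poly_ring_power: "p \<in> poly_ring k \<Longrightarrow> p ^ j \<in> poly_ring k"
  for p :: "'f::field mpoly"
  by (induction j) (auto intro: poly_ring_mult)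

lemma poly_ring_var: "1 \<le> x \<Longrightarrow> x \<le> k \<Longrightarrow> var x \<in> poly_ring k"
  by (simp add: poly_ring_def)

lemma poly_ring_sum: "(\<And>i. i \<in> A \<Longrightarrow> f i \<in> poly_ring k) \<Longrightarrow> sum f A \<in> poly_ring k"
  for f :: "_ \<Rightarrow> 'f::field mpoly"
  by (induction A rule: infinite_finite_induct) (auto intro: poly_ring_add)

lemma poly_ring_prod: "(\<And>i. i \<in> A \<Longrightarrow> f i \<in> poly_ring k) \<Longrightarrow> prod f A \<in> poly_ring k"
  for f :: "_ \<Rightarrow> 'f::field mpoly"
  by (induction A rule: infinite_finite_induct) (auto intro: poly_ring_mult)

lemma poly_ring_mono: "p \<in> poly_ring j \<Longrightarrow> j \<le> k \<Longrightarrow> p \<in> poly_ring k"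
  by (auto simp: poly_ring_def)

lemma ld_le_iff: "ld p \<le> k \<longleftrightarrow> indets p \<subseteq> {..k}"
  by (auto simp: ld_def)

lemma ld_le: "p \<in> poly_ring k \<Longrightarrow> ld p \<le> k"
  by (auto simp: ld_le_iff poly_ring_def)

lemma poly_ring_ld: "p \<in> poly_ring n \<Longrightarrow> p \<in> poly_ring (ld p)"
  using ld_le_iff[of p "ld p"] by (fastforce simp: poly_ring_def)

lemma poly_ring_iff_ld: "p \<in> poly_ring n \<Longrightarrow> p \<in> poly_ring k \<longleftrightarrow> ld p \<le> k"
  using poly_ring_ld poly_ring_mono ld_le by metis

lemma ld_in_indets: "ld p \<noteq> 0 \<Longrightarrow> ld p \<in> indets p"
  unfolding ld_def using Max_in[of "insert 0 (indets p)"] by auto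

lemma ld_const [simp]: "ld (single 0 c) = 0"
  and ld_0 [simp]: "ld 0 = 0"
  and ld_1 [simp]: "ld 1 = 0"
  by (simp_all add: ld_def)

lemma ld_0_const:
  assumes "p \<in> poly_ring n" "ld p = 0"
  shows "p = single 0 (lookup p 0)"
proof (intro poly_mapping_eqI)
  fix m
  have "indets p = {}"
    using poly_ring_ld[OF assms(1)] assms(2) by (simp add: poly_ring_def)
  then have "keys m = {}" if "m \<in> keys p"
    using that by (auto simp: indets_def)
  moreover have "keys m \<noteq> {}" if "m \<noteq> 0"
    using that by (metis empty_iff in_keys_iff lookup_zero poly_mapping_eqI)
  ultimately have "m \<notin> keys p" if "m \<noteq> 0"
    using that by blast
  then show "lookup p m = lookup (single 0 (lookup p 0)) m"
    by (auto simp: lookup_single when_def in_keys_iff)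
qed

lemma indets_coeff_upoly: "indets (coeff (upoly x p) j) \<subseteq> indets p - {x}"
proof -
  have *: "indets (coeff (upoly_monom x m (lookup p m)) j) \<subseteq> indets p - {x}" if "m \<in> keys p" for m
    using that by (auto simp: upoly_monom_def indets_def keys_update split: if_splits)
  have "indets (\<Sum>m\<in>A. coeff (upoly_monom x m (lookup p m)) j) \<subseteq> indets p - {x}"
    if "finite A" "A \<subseteq> keys p" for A
    using that
  proof (induction A rule: finite_induct)
    case (insert m A)
    show ?case
      using insert * indets_add[of "coeff (upoly_monom x m (lookup p m)) j"
          "\<Sum>m\<in>A. coeff (upoly_monom x m (lookup p m)) j"] by auto
  qed simp
  from this[OF _ order_refl] show ?thesis
    by (simp add: upoly_alt coeff_sum)
qed

lemma upoly_free:
  assumes "x \<notin> indets p"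
  shows "upoly x p = [:p:]"
proof -
  have "degree (upoly x p) = 0"
    unfolding upoly_alt
  proof (rule degree_sum_le[of _ _ 0, simplified])
    fix m assume "m \<in> keys p"
    with assms have "lookup m x = 0" by (auto simp: indets_def in_keys_iff)
    then show "degree (upoly_monom x m (lookup p m)) = 0" by (simp add: upoly_monom_def monom_0)
  qed simp
  then obtain c where "upoly x p = [:c:]" by (rule degree_eq_zeroE)
  with poly_upoly_var[of x p] show ?thesis by simp
qed

lemma upoly_poly_var:
  assumes "\<And>j. x \<notin> indets (coeff s j)"
  shows "upoly x (poly s (var x)) = s"
  using assms
proof (induction s)
  case (pCons c s)
  have "x \<notin> indets c" "\<And>j. x \<notin> indets (coeff s j)"
    using pCons.prems[of 0] pCons.prems[of "Suc _"] by simp_all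
  with pCons show ?case by (simp add: upoly_var upoly_free)
qed simp

lemma coeff_upoly_poly_ring:
  assumes "p \<in> poly_ring x"
  shows "coeff (upoly x p) j \<in> poly_ring (x - 1)"
  using assms indets_coeff_upoly[of x p j] by (fastforce simp: poly_ring_def)

lemma coeff_upoly_poly_ring':
  assumes "p \<in> poly_ring n"
  shows "coeff (upoly x p) j \<in> poly_ring n"
  using assms indets_coeff_upoly[of x p j] by (fastforce simp: poly_ring_def)

lemma poly_var_poly_ring:
  assumes "\<And>j. coeff s j \<in> poly_ring (x - 1)" "x > 0"
  shows "poly s (var x) \<in> poly_ring x" "upoly x (poly s (var x)) = s"
proof -
  show "poly s (var x) \<in> poly_ring x"
    unfolding poly_altdef using assms
    by (intro poly_ring_sum poly_ring_mult poly_ring_power poly_ring_var)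
      (auto intro: poly_ring_mono[of _ "x - 1"])
  show "upoly x (poly s (var x)) = s"
    using assms by (intro upoly_poly_var) (force simp: poly_ring_def)
qed

lemma deg_in_pos_iff: "deg_in x p > 0 \<longleftrightarrow> x \<in> indets p"
proof
  assume "x \<in> indets p"
  show "deg_in x p > 0"
  proof (rule ccontr)
    assume "\<not> deg_in x p > 0"
    then obtain c where "upoly x p = [:c:]" by (metis deg_in_def degree_eq_zeroE not_gr_zero)
    with poly_upoly_var[of x p] indets_coeff_upoly[of x p 0] \<open>x \<in> indets p\<close> show False by auto
  qed
qed (use upoly_free[of x p] in \<open>force simp: deg_in_def\<close>)

lemma mdeg_pos_iff: "p \<in> poly_ring n \<Longrightarrow> mdeg p > 0 \<longleftrightarrow> ld p > 0"
  unfolding mdeg_def deg_in_pos_iff using ld_in_indets[of p] by (cases "ld p = 0") (auto simp: poly_ring_def)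

lemma ld_eq_iff: "p \<in> poly_ring x \<Longrightarrow> x > 0 \<Longrightarrow> ld p = x \<longleftrightarrow> deg_in x p > 0"
  unfolding deg_in_pos_iff
  by (metis finite_indets finite_insert insertCI ld_def ld_in_indets ld_le Max_ge le_antisym not_gr_zero)

lemma ld_less: "p \<in> poly_ring (x - 1) \<Longrightarrow> x > 0 \<Longrightarrow> ld p < x"
  using ld_le[of p "x - 1"] by simp

lemma upoly_poly_ring_pred: "p \<in> poly_ring (x - 1) \<Longrightarrow> x > 0 \<Longrightarrow> upoly x p = [:p:]"
  by (intro upoly_free) (auto simp: poly_ring_def)

lemma init_alt: "ld p = x \<Longrightarrow> init p = lead_coeff (upoly x p)"
  by (simp add: init_def)

lemma init_poly_ring: "p \<in> poly_ring n \<Longrightarrow> init p \<in> poly_ring (ld p - 1)"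
  unfolding init_def by (intro coeff_upoly_poly_ring) (rule poly_ring_ld)

lemma init_poly_ring': "p \<in> poly_ring n \<Longrightarrow> init p \<in> poly_ring n"
  unfolding init_def by (rule coeff_upoly_poly_ring')

lemma init_eq_0_iff [simp]: "init p = 0 \<longleftrightarrow> p = 0"
  by (simp add: init_def)

lemma ld_init: "p \<in> poly_ring n \<Longrightarrow> ld p > 0 \<Longrightarrow> ld (init p) < ld p"
  using init_poly_ring ld_less by blast

lemma init_0 [simp]: "init 0 = 0" by simp

lemma phi_eq_poly: "phi a p = poly (phi_below x a p) (a x)"
proof -
  have "phi a p = phi a (poly (upoly x p) (var x))" by simp
  also have "\<dots> = poly (phi_below x a p) (a x)"
    unfolding phi_below_def using phi.poly_map_poly[of a "upoly x p" "var x"] by simp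
  finally show ?thesis .
qed

subsection \<open>Specialisation of subresultants\<close>

definition bezout_left :: "nat \<Rightarrow> 'k::comm_ring_1 vec \<Rightarrow> 'k poly" where
  "bezout_left s v = (\<Sum>j<s. monom (v $ j) (s - 1 - j))"

definition bezout_right :: "nat \<Rightarrow> nat \<Rightarrow> 'k::comm_ring_1 vec \<Rightarrow> 'k poly" where
  "bezout_right s r v = (\<Sum>j<r. monom (v $ (s + j)) (r - 1 - j))"

text \<open>
  The columns are the coefficient vectors, in the degrees \<open>J + r + s - 1, \<dots>, J\<close>, of
  \<open>X\<^bsup>s-1\<^esup> F, \<dots>, F, X\<^bsup>r-1\<^esup> G, \<dots>, G\<close>.  The degrees of \<open>F\<close> and \<open>G\<close> do not enter, so that
  the matrix is compatible with specialisations under which the degree of \<open>G\<close> drops.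
\<close>

definition bezout_mat :: "nat \<Rightarrow> nat \<Rightarrow> nat \<Rightarrow> 'k::comm_ring_1 poly \<Rightarrow> 'k poly \<Rightarrow> 'k mat" where
  "bezout_mat J s r F G = mat (s + r) (s + r) (\<lambda>(i, j).
     if j < s then coeff_int F (int (J + r + s - 1 - i) - int (s - 1 - j))
     else coeff_int G (int (J + r + s - 1 - i) - int (r - 1 - (j - s))))"

lemma bezout_mat_carrier [simp]: "bezout_mat J s r F G \<in> carrier_mat (s + r) (s + r)"
  by (simp add: bezout_mat_def)

lemma coeff_int_monom_mult:
  "coeff_int p (int D - int m) * c = coeff (monom c m * p) D"
  using mult.commute[of "coeff p (D - m)" c]
  by (auto simp: coeff_int_def coeff_monom_mult nat_diff_distrib)

lemma sum_lessThan_add: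
  fixes f :: "nat \<Rightarrow> 'a::comm_monoid_add"
  shows "sum f {..<s + r} = sum f {..<s} + (\<Sum>j<r. f (s + j))"
  by (induction r) (simp_all add: add.assoc)

lemma bezout_mat_mult_vec:
  assumes v: "v \<in> carrier_vec (s + r)" and i: "i < s + r"
  shows "(bezout_mat J s r F G *\<^sub>v v) $ i =
    coeff (bezout_left s v * F + bezout_right s r v * G) (J + r + s - 1 - i)" (is "_ = coeff _ ?D")
proof -
  have "(bezout_mat J s r F G *\<^sub>v v) $ i =
      (\<Sum>j<s + r. bezout_mat J s r F G $$ (i, j) * v $ j)"
    using v i by (simp add: bezout_mat_def scalar_prod_def atLeast0LessThan)
  also have "\<dots> = (\<Sum>j<s. bezout_mat J s r F G $$ (i, j) * v $ j) +
      (\<Sum>j<r. bezout_mat J s r F G $$ (i, s + j) * v $ (s + j))"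
    by (rule sum_lessThan_add)
  also have "(\<Sum>j<s. bezout_mat J s r F G $$ (i, j) * v $ j) =
      (\<Sum>j<s. coeff (monom (v $ j) (s - 1 - j) * F) ?D)"
  proof (intro sum.cong refl)
    fix j assume "j \<in> {..<s}"
    then have "bezout_mat J s r F G $$ (i, j) = coeff_int F (int ?D - int (s - 1 - j))"
      using i by (simp add: bezout_mat_def)
    then show "bezout_mat J s r F G $$ (i, j) * v $ j = coeff (monom (v $ j) (s - 1 - j) * F) ?D"
      by (simp only: coeff_int_monom_mult)
  qed
  also have "(\<Sum>j<r. bezout_mat J s r F G $$ (i, s + j) * v $ (s + j)) =
      (\<Sum>j<r. coeff (monom (v $ (s + j)) (r - 1 - j) * G) ?D)"
  proof (intro sum.cong refl)
    fix j assume "j \<in> {..<r}"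
    then have "bezout_mat J s r F G $$ (i, s + j) = coeff_int G (int ?D - int (r - 1 - j))"
      using i by (simp add: bezout_mat_def)
    then show "bezout_mat J s r F G $$ (i, s + j) * v $ (s + j) =
        coeff (monom (v $ (s + j)) (r - 1 - j) * G) ?D"
      by (simp only: coeff_int_monom_mult)
  qed
  finally show ?thesis
    by (simp only: bezout_left_def bezout_right_def sum_distrib_right coeff_sum coeff_add)
qed

lemma coeff_bezout_left: "coeff (bezout_left s v) k = (if k < s then v $ (s - 1 - k) else 0)"
proof -
  have "coeff (bezout_left s v) k = (\<Sum>j<s. if s - 1 - j = k then v $ j else 0)"
    by (simp add: bezout_left_def coeff_sum)
  also have "\<dots> = (\<Sum>j<s. if j = s - 1 - k \<and> k < s then v $ (s - 1 - k) else 0)"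
    by (intro sum.cong) auto
  also have "\<dots> = (if k < s then v $ (s - 1 - k) else 0)"
    by (cases "k < s") (simp_all add: sum.delta)
  finally show ?thesis .
qed

lemma coeff_bezout_right:
  "coeff (bezout_right s r v) k = (if k < r then v $ (s + (r - 1 - k)) else 0)"
proof -
  have "coeff (bezout_right s r v) k = (\<Sum>j<r. if r - 1 - j = k then v $ (s + j) else 0)"
    by (simp add: bezout_right_def coeff_sum)
  also have "\<dots> = (\<Sum>j<r. if j = r - 1 - k \<and> k < r then v $ (s + (r - 1 - k)) else 0)"
    by (intro sum.cong) auto
  also have "\<dots> = (if k < r then v $ (s + (r - 1 - k)) else 0)"
    by (cases "k < r") (simp_all add: sum.delta)
  finally show ?thesis .
qed

lemma det_bezout_mat_eq_0_iff:
  fixes F G :: "'k::field poly"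
  shows "det (bezout_mat J s r F G) = 0 \<longleftrightarrow>
    (\<exists>U V. (U \<noteq> 0 \<or> V \<noteq> 0) \<and> (\<forall>k\<ge>s. coeff U k = 0) \<and> (\<forall>k\<ge>r. coeff V k = 0) \<and>
      (\<forall>k\<ge>J. k < J + r + s \<longrightarrow> coeff (U * F + V * G) k = 0))"
  unfolding det_0_iff_vec_prod_zero[OF bezout_mat_carrier]
proof (intro iffI; elim exE conjE)
  fix v assume v: "v \<in> carrier_vec (s + r)" "v \<noteq> 0\<^sub>v (s + r)"
    and 0: "bezout_mat J s r F G *\<^sub>v v = 0\<^sub>v (s + r)"
  let ?U = "bezout_left s v" and ?V = "bezout_right s r v"
  have "?U \<noteq> 0 \<or> ?V \<noteq> 0"
  proof (rule ccontr)
    assume "\<not> (?U \<noteq> 0 \<or> ?V \<noteq> 0)"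
    then have U: "coeff ?U k = 0" and V: "coeff ?V k = 0" for k by simp_all
    have "v $ i = 0" if "i < s + r" for i
    proof (cases "i < s")
      case True
      then show ?thesis using U[of "s - 1 - i"] by (simp add: coeff_bezout_left)
    next
      case False
      with that have "s + (r - 1 - (r - 1 - (i - s))) = i" "r - 1 - (i - s) < r" by auto
      then show ?thesis using V[of "r - 1 - (i - s)"] by (simp only: coeff_bezout_right if_True)
    qed
    with v show False by auto
  qed
  moreover have "coeff (?U * F + ?V * G) k = 0" if "J \<le> k" "k < J + r + s" for k
  proof -
    have "J + r + s - 1 - (J + r + s - 1 - k) = k" "J + r + s - 1 - k < s + r"
      using that by auto
    then show ?thesis
      using bezout_mat_mult_vec[OF v(1), of "J + r + s - 1 - k" J F G] 0 by simp
  qed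
  ultimately show "\<exists>U V. (U \<noteq> 0 \<or> V \<noteq> 0) \<and> (\<forall>k\<ge>s. coeff U k = 0) \<and> (\<forall>k\<ge>r. coeff V k = 0) \<and>
      (\<forall>k\<ge>J. k < J + r + s \<longrightarrow> coeff (U * F + V * G) k = 0)"
    by (intro exI[of _ ?U] exI[of _ ?V]) (simp add: coeff_bezout_left coeff_bezout_right)
next
  fix U V
  assume UV: "U \<noteq> 0 \<or> V \<noteq> 0" "\<forall>k\<ge>s. coeff U k = 0" "\<forall>k\<ge>r. coeff V k = 0"
    and 0: "\<forall>k\<ge>J. k < J + r + s \<longrightarrow> coeff (U * F + V * G) k = 0"
  define v where "v = vec (s + r) (\<lambda>i. if i < s then coeff U (s - 1 - i) else coeff V (r - 1 - (i - s)))"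
  have v: "v \<in> carrier_vec (s + r)" by (simp add: v_def)
  have U: "bezout_left s v = U"
    using UV by (intro poly_eqI) (auto simp: coeff_bezout_left v_def not_less)
  have V: "bezout_right s r v = V"
    using UV by (intro poly_eqI) (auto simp: coeff_bezout_right v_def not_less)
  have "v \<noteq> 0\<^sub>v (s + r)"
  proof
    assume "v = 0\<^sub>v (s + r)"
    then have "U = 0" "V = 0"
      by (intro poly_eqI; simp add: U[symmetric] V[symmetric] coeff_bezout_left coeff_bezout_right)+
    with UV show False by blast
  qed
  moreover have "bezout_mat J s r F G *\<^sub>v v = 0\<^sub>v (s + r)"
  proof (intro eq_vecI)
    fix i assume "i < dim_vec (0\<^sub>v (s + r) :: 'k vec)"
    then have "i < s + r" by simp
    then show "(bezout_mat J s r F G *\<^sub>v v) $ i = 0\<^sub>v (s + r) $ i"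
      using bezout_mat_mult_vec[OF v, of i J F G] 0 by (simp add: U V)
  qed (simp add: bezout_mat_def)
  ultimately show "\<exists>v. v \<in> carrier_vec (s + r) \<and> v \<noteq> 0\<^sub>v (s + r) \<and>
      bezout_mat J s r F G *\<^sub>v v = 0\<^sub>v (s + r)"
    using v by blast
qed

lemma det_bezout_mat_eq_0:
  fixes F G h :: "'k::field poly"
  assumes "h dvd F" "h dvd G" "F \<noteq> 0" "degree G \<le> J + s" "degree F \<le> J + r" "degree h > J"
  shows "det (bezout_mat J s r F G) = 0"
proof -
  from assms obtain f g where F: "F = h * f" and G: "G = h * g" by (auto elim!: dvdE)
  have f: "f \<noteq> 0" "h \<noteq> 0" using \<open>F \<noteq> 0\<close> F by auto
  have "coeff g k = 0" if "k \<ge> s" for k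
    using assms that f by (cases "g = 0") (auto intro!: coeff_eq_0 simp: G degree_mult_eq)
  moreover have "coeff f k = 0" if "k \<ge> r" for k
    using assms that f by (auto intro!: coeff_eq_0 simp: F degree_mult_eq)
  moreover have "g * F + (- f) * G = 0" by (simp add: F G)
  ultimately show ?thesis
    unfolding det_bezout_mat_eq_0_iff using f
    by (intro exI[of _ g] exI[of _ "- f"]) simp
qed

lemma coprime_syzygy_eq_0:
  fixes f g h U V :: "'k::{field,field_gcd} poly"
  assumes "coprime f g" "U * (f * h) = - (V * (g * h))" "h \<noteq> 0" "f \<noteq> 0"
    "V = 0 \<or> degree V < degree f"
  shows "U = 0 \<and> V = 0"
proof -
  have "h * (U * f) = h * (- (V * g))" using assms(2) by (simp add: mult_ac)
  then have eq: "U * f = - (V * g)" using assms(3) mult_left_cancel by blast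
  then have "V * g = f * (- U)" by (simp add: mult.commute)
  then have "f dvd V * g" by (rule dvdI)
  with assms(1) have "f dvd V" using coprime_dvd_mult_left_iff by blast
  then have "V = 0" using assms(5) by (meson dvd_imp_degree_le not_le)
  with eq \<open>f \<noteq> 0\<close> show ?thesis by simp
qed

lemma det_bezout_mat_neq_0:
  fixes F G :: "'k::{field,field_gcd} poly"
  assumes "F \<noteq> 0" "degree G \<le> J + s" "degree F = J + r" "degree (gcd F G) = J"
  shows "det (bezout_mat J s r F G) \<noteq> 0"
proof
  let ?h = "gcd F G"
  assume "det (bezout_mat J s r F G) = 0"
  then obtain U V where UV: "U \<noteq> 0 \<or> V \<noteq> 0" "\<forall>k\<ge>s. coeff U k = 0" "\<forall>k\<ge>r. coeff V k = 0"
    and 0: "\<forall>k\<ge>J. k < J + r + s \<longrightarrow> coeff (U * F + V * G) k = 0"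
    by (auto simp: det_bezout_mat_eq_0_iff)
  have "coeff (U * F + V * G) k = 0" if "k \<ge> J + r + s" for k
  proof -
    have "coeff (U * F) k = 0"
    proof (cases "U = 0")
      case False
      then have "degree U < s" using UV(2) by (meson leading_coeff_0_iff not_le)
      then show ?thesis using that assms degree_mult_le[of U F] by (intro coeff_eq_0) linarith
    qed simp
    moreover have "coeff (V * G) k = 0"
    proof (cases "V = 0")
      case False
      then have "degree V < r" using UV(3) by (meson leading_coeff_0_iff not_le)
      then show ?thesis using that assms degree_mult_le[of V G] by (intro coeff_eq_0) linarith
    qed simp
    ultimately show ?thesis by simp
  qed
  with 0 have coeff_0: "coeff (U * F + V * G) k = 0" if "k \<ge> J" for k
    using that by (cases "k < J + r + s") auto
  have "U * F + V * G = 0"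
  proof (rule ccontr)
    assume *: "U * F + V * G \<noteq> 0"
    moreover have "?h dvd U * F + V * G" by simp
    ultimately have "J \<le> degree (U * F + V * G)"
      using dvd_imp_degree_le assms(4) by metis
    with coeff_0 * show False by (meson leading_coeff_0_iff)
  qed
  then have eq: "U * F = - (V * G)" by (simp add: eq_neg_iff_add_eq_0)
  obtain f g where F: "F = f * ?h" and G: "G = g * ?h" and "coprime f g"
    using gcd_coprime_exists[of F G] \<open>F \<noteq> 0\<close> by auto
  obtain h where h: "h = ?h" by blast
  have "U = 0 \<and> V = 0"
    using \<open>coprime f g\<close>
  proof (rule coprime_syzygy_eq_0)
    show "U * (f * h) = - (V * (g * h))" using eq unfolding h F[symmetric] G[symmetric] .
    show "h \<noteq> 0" "f \<noteq> 0" using \<open>F \<noteq> 0\<close> F unfolding h by (simp, metis mult_zero_left)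
    have "degree (f * h) = degree f + degree h"
      using \<open>h \<noteq> 0\<close> \<open>f \<noteq> 0\<close> by (simp add: degree_mult_eq)
    then have "degree f = r" using assms(3,4) unfolding h F[symmetric] by simp
    with UV(3) show "V = 0 \<or> degree V < degree f" by (meson leading_coeff_0_iff not_le)
  qed
  with UV show False by blast
qed

lemma map_subresultant'_mat:
  assumes "comm_ring_hom h" "J < degree Q" "degree Q < degree P"
  shows "map_mat h (subresultant'_mat J J P Q) =
    bezout_mat J (degree Q - J) (degree P - J) (map_poly h P) (map_poly h Q)"
proof -
  interpret comm_ring_hom h by fact
  have [simp]: "h (coeff_int p k) = coeff_int (map_poly h p) k" for p k
    by (simp add: coeff_int_def coeff_map_poly)
  show ?thesis
  proof (rule eq_matI, goal_cases)
    case (1 i j)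
    define s r where "s = degree Q - J" and "r = degree P - J"
    have deg: "degree Q = J + s" "degree P = J + r" "s > 0" "r > 0"
      using assms by (auto simp: s_def r_def)
    from 1 have ij: "i < s + r" "j < s + r" by (simp_all add: bezout_mat_def s_def r_def)
    have *: "int (J + r + s - 1 - i) - int (s - 1 - j) = int (J + r) - int i + int j" if "j < s"
      using ij that by linarith
    have **: "int (J + r + s - 1 - i) - int (r - 1 - (j - s)) = int (J + s) - int i + int (j - s)"
      if "\<not> j < s" using ij that by linarith
    have ***: "i = r + s - 1 \<Longrightarrow> int J - int (s - 1) + int j = int (J + r) - int i + int j"
      "i = r + s - 1 \<Longrightarrow> int J - int (r - 1) + int (j - s) = int (J + s) - int i + int (j - s)"
      using deg by linarith+
    show ?case
      using ij * ** ***
      by (auto simp: bezout_mat_def subresultant'_mat_def Let_def deg add.commute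
          intro!: arg_cong[where f = "coeff_int _"])
  qed (simp_all add: bezout_mat_def subresultant'_mat_def Let_def add.commute)
qed

lemma map_coeff_subresultant:
  assumes "comm_ring_hom h" "J < degree Q" "degree Q < degree P"
  shows "h (coeff (subresultant J P Q) J) =
    det (bezout_mat J (degree Q - J) (degree P - J) (map_poly h P) (map_poly h Q))"
proof -
  interpret comm_ring_hom h by fact
  show ?thesis
    using assms by (simp add: coeff_subresultant map_subresultant'_mat[symmetric])
qed

lemma degree_subresultant_le:
  assumes "J < degree Q" "J < degree P"
  shows "degree (subresultant J P Q) \<le> J"
proof (intro degree_le allI impI)
  fix k assume "J < k"
  with assms show "coeff (subresultant J P Q) k = 0"
    by (cases "k < degree P + (degree Q - J)")
      (auto intro: subresultant_zero_lt subresultant_zero_ge)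
qed

lemma dvd_map_subresultant:
  fixes h :: "'r::comm_ring_1 \<Rightarrow> 'k::comm_ring_1"
  assumes "comm_ring_hom h" "J < degree Q" "J < degree P"
    and dvd: "d dvd map_poly h P" "d dvd map_poly h Q"
  shows "d dvd map_poly h (subresultant J P Q)"
proof -
  interpret comm_ring_hom h by fact
  interpret map_poly: map_poly_comm_ring_hom h ..
  let ?n = "(degree P - J) + (degree Q - J)"
  let ?A = "map_mat (map_poly h) (subresultant_mat J P Q)"
  have A: "?A \<in> carrier_mat ?n ?n" by (auto simp: subresultant_mat_def Let_def)
  have n: "?n - 1 < ?n" using assms by simp
  have "map_poly h (subresultant J P Q) = det ?A"
    by (simp add: subresultant_def)
  also have "\<dots> = (\<Sum>j<?n. ?A $$ (?n - 1, j) * cofactor ?A (?n - 1) j)"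
    by (rule laplace_expansion_row[OF A n])
  also have "d dvd \<dots>"
  proof (intro dvd_sum dvd_mult2)
    fix j assume "j \<in> {..<?n}"
    then have j: "j < ?n" by simp
    have "?A $$ (?n - 1, j) = map_poly h (subresultant_mat J P Q $$ (?n - 1, j))"
      using j n by simp
    also have "d dvd \<dots>"
      unfolding subresultant_index_mat[OF n j] using dvd
      by (simp add: map_poly.hom_mult dvd_mult Let_def)
    finally show "d dvd ?A $$ (?n - 1, j)" .
  qed
  finally show ?thesis .
qed

definition regular_subres :: "'r::comm_ring_1 poly \<Rightarrow> 'r poly \<Rightarrow> nat \<Rightarrow> 'r poly" where
  "regular_subres P Q i = (if i = degree P then P else if i = degree Q then Q
     else if i < degree Q \<and> degree (subresultant i P Q) = i then subresultant i P Q else 0)"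

definition subres_coeff :: "'r::comm_ring_1 poly \<Rightarrow> 'r poly \<Rightarrow> nat \<Rightarrow> 'r" where
  "subres_coeff P Q i = (if i = degree P then 1 else coeff (regular_subres P Q i) i)"

lemma subres_coeff_less:
  "i < degree Q \<Longrightarrow> degree Q < degree P \<Longrightarrow> subres_coeff P Q i = coeff (subresultant i P Q) i"
  using degree_subresultant_le[of i Q P]
  by (auto simp: subres_coeff_def regular_subres_def intro: coeff_eq_0)

lemma subres_coeff_gap:
  "degree Q < i \<Longrightarrow> i < degree P \<Longrightarrow> subres_coeff P Q i = 0"
  by (auto simp: subres_coeff_def regular_subres_def)

theorem regular_subres_gcd:
  fixes h :: "'r::comm_ring_1 \<Rightarrow> 'k::{field,field_gcd}"
  assumes hom: "comm_ring_hom h"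
    and deg: "degree Q < degree P" and lc: "h (lead_coeff P) \<noteq> 0"
    and i: "i \<le> degree P" "h (subres_coeff P Q i) \<noteq> 0"
    and less: "\<And>j. j < i \<Longrightarrow> h (subres_coeff P Q j) = 0"
  defines "H \<equiv> map_poly h (regular_subres P Q i)"
  shows "degree H = i" "H dvd map_poly h P" "H dvd map_poly h Q"
    "\<And>d. d dvd map_poly h P \<Longrightarrow> d dvd map_poly h Q \<Longrightarrow> d dvd H"
proof -
  interpret comm_ring_hom h by fact
  interpret map_poly: map_poly_comm_ring_hom h ..
  define F G where "F = map_poly h P" and "G = map_poly h Q"
  have degF: "degree F = degree P" unfolding F_def using lc by (intro map_poly_degree_eq) auto
  have F0: "F \<noteq> 0" using degF deg by auto
  have degG: "degree G \<le> degree Q" unfolding G_def by (rule degree_map_poly_le)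
  have det: "h (subres_coeff P Q j) = det (bezout_mat j (degree Q - j) (degree P - j) F G)"
    if "j < degree Q" for j
    using map_coeff_subresultant[OF hom that deg] subres_coeff_less[OF that deg]
    by (simp add: F_def G_def)
  let ?g = "gcd F G"
  have psc_0: "h (subres_coeff P Q j) = 0" if "j < degree Q" "j < degree ?g" for j
    using that F0 degF degG deg by (subst det) (auto intro!: det_bezout_mat_eq_0[where h = ?g])
  have psc_g: "h (subres_coeff P Q (degree ?g)) \<noteq> 0" if "degree ?g < degree Q"
    unfolding det[OF that] using that F0 degF degG deg
    by (intro det_bezout_mat_neq_0) auto
  have g_le: "degree ?g \<le> degree G" if "G \<noteq> 0" using that by (simp add: dvd_imp_degree_le)
  have g_i: "degree ?g \<ge> degree Q" if "\<And>j. j < degree Q \<Longrightarrow> h (subres_coeff P Q j) = 0"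
    using psc_g that by (meson not_le)
  have sub: "(\<forall>d. d dvd F \<longrightarrow> d dvd G \<longrightarrow> d dvd H) \<and> degree H = i \<and> degree ?g = i"
  proof -
    consider "i < degree Q" | "i = degree Q" | "i = degree P"
      using i(2) subres_coeff_gap[of Q i P] i(1) by fastforce
    then show ?thesis
    proof cases
      case 1
      have "degree ?g = i"
      proof (rule antisym)
        show "degree ?g \<le> i" using psc_0[OF 1] i(2) by (meson not_le)
        show "i \<le> degree ?g" using psc_g less 1 by (meson not_le less_trans)
      qed
      moreover have coeff: "h (coeff (subresultant i P Q) i) \<noteq> 0"
        using i(2) subres_coeff_less[OF 1 deg] by simp
      then have "degree (subresultant i P Q) \<ge> i" by (intro le_degree) auto
      with 1 deg have "degree (subresultant i P Q) = i"
        using degree_subresultant_le[of i Q P] by simp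
      then have H: "H = map_poly h (subresultant i P Q)"
        using 1 deg by (simp add: H_def regular_subres_def)
      moreover have "degree H = i"
        unfolding H using coeff \<open>degree (subresultant i P Q) = i\<close>
        by (subst map_poly_degree_eq) auto
      ultimately show ?thesis
        using dvd_map_subresultant[OF hom 1] 1 deg by (simp add: F_def G_def)
    next
      case 2
      then have H: "H = G" using deg by (simp add: H_def G_def regular_subres_def)
      have "h (coeff Q (degree Q)) \<noteq> 0"
        using 2 i(2) deg by (simp add: subres_coeff_def regular_subres_def)
      then have degG: "degree G = degree Q" unfolding G_def by (intro map_poly_degree_eq) auto
      have "degree ?g = degree G"
      proof (cases "G = 0")
        case True
        then show ?thesis using \<open>h (coeff Q (degree Q)) \<noteq> 0\<close>
          by (metis G_def coeff_0 coeff_map_poly hom_zero)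
      next
        case False
        then show ?thesis using g_le g_i less 2 degG by (intro antisym) auto
      qed
      with 2 H degG show ?thesis by simp
    next
      case 3
      then have H: "H = F" by (simp add: H_def F_def regular_subres_def)
      have "G = 0"
      proof (rule ccontr)
        assume G0: "G \<noteq> 0"
        then have "degree G = degree Q" using g_le g_i less 3 deg degG by fastforce
        then have "h (coeff Q (degree Q)) \<noteq> 0"
          using G0 by (metis G_def coeff_map_poly hom_zero leading_coeff_0_iff)
        then have "h (subres_coeff P Q (degree Q)) \<noteq> 0"
          using deg by (simp add: subres_coeff_def regular_subres_def)
        with less 3 deg show False by simp
      qed
      then have "degree ?g = degree F"
        using F0 dvd_imp_degree_le[of ?g F] dvd_imp_degree_le[of F ?g] by simp
      with 3 H degF \<open>G = 0\<close> show ?thesis by simp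
    qed
  qed
  show "degree H = i" using sub by simp
  have "?g dvd H" using sub by simp
  have "H dvd ?g"
  proof -
    from \<open>?g dvd H\<close> obtain c where c: "H = ?g * c" by (rule dvdE)
    have "H \<noteq> 0"
    proof
      assume "H = 0"
      then have "i = 0" using sub by simp
      have "h (coeff (regular_subres P Q i) i) = 0"
        using \<open>H = 0\<close> unfolding H_def by (metis coeff_0 coeff_map_poly hom_zero)
      with i(2) \<open>i = 0\<close> deg show False by (simp add: subres_coeff_def)
    qed
    then have "c \<noteq> 0" "?g \<noteq> 0" using c by auto
    then have "degree c = 0" using c sub by (simp add: degree_mult_eq)
    then have "is_unit c" using \<open>c \<noteq> 0\<close> by (simp add: is_unit_iff_degree)
    with c show ?thesis by (simp add: mult_unit_dvd_iff)
  qed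
  then show "H dvd map_poly h P" "H dvd map_poly h Q"
    unfolding F_def[symmetric] G_def[symmetric]
    by (rule dvd_trans[OF _ gcd_dvd1], rule dvd_trans[OF _ gcd_dvd2])
  show "d dvd H" if "d dvd map_poly h P" "d dvd map_poly h Q" for d
    using sub that by (simp add: F_def G_def)
qed

subsection \<open>Pseudo division and reduction\<close>

lemma lookup_coeff_upoly:
  "lookup (coeff (upoly x p) j) m =
    (if lookup m x = 0 then lookup p (Poly_Mapping.update x j m) else 0)"
proof (induction p rule: poly_mapping_single_induct)
  case (add m' c p)
  have "(lookup m' x = j \<and> Poly_Mapping.update x 0 m' = m) \<longleftrightarrow>
      (lookup m x = 0 \<and> m' = Poly_Mapping.update x j m)"
    by (auto simp: poly_mapping_eq_iff fun_eq_iff lookup_update split: if_splits)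
  then have "lookup (coeff (upoly_monom x m' c) j) m =
      (if lookup m x = 0 then lookup (single m' c) (Poly_Mapping.update x j m) else 0)"
    by (auto simp: upoly_monom_def lookup_single when_def)
  with add show ?case by (simp add: upoly_single lookup_add)
qed simp

lemma deg_in_le_iff: "deg_in x p \<le> d \<longleftrightarrow> (\<forall>m\<in>keys p. lookup m x \<le> d)"
proof
  assume *: "deg_in x p \<le> d"
  show "\<forall>m\<in>keys p. lookup m x \<le> d"
  proof
    fix m assume "m \<in> keys p"
    have "Poly_Mapping.update x (lookup m x) (Poly_Mapping.update x 0 m) = m"
      by (intro poly_mapping_eqI) (simp add: lookup_update)
    then have "lookup (coeff (upoly x p) (lookup m x)) (Poly_Mapping.update x 0 m) \<noteq> 0"
      using \<open>m \<in> keys p\<close> by (simp add: lookup_coeff_upoly lookup_update in_keys_iff)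
    then have "coeff (upoly x p) (lookup m x) \<noteq> 0" by auto
    then show "lookup m x \<le> d" using * le_degree unfolding deg_in_def by (metis le_trans)
  qed
next
  assume *: "\<forall>m\<in>keys p. lookup m x \<le> d"
  have "coeff (upoly x p) j = 0" if "j > d" for j
  proof (intro poly_mapping_eqI)
    fix m
    have "Poly_Mapping.update x j m \<notin> keys p" using * that by (force simp: lookup_update)
    then show "lookup (coeff (upoly x p) j) m = lookup 0 m"
      by (simp add: lookup_coeff_upoly in_keys_iff)
  qed
  then show "deg_in x p \<le> d" unfolding deg_in_def by (intro degree_le) auto
qed

lemma deg_in_coeff_upoly_le: "deg_in x (coeff (upoly y p) k) \<le> deg_in x p"
proof (cases "x = y")
  case True
  then have "x \<notin> indets (coeff (upoly y p) k)" using indets_coeff_upoly by blast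
  then show ?thesis using deg_in_pos_iff[of x "coeff (upoly y p) k"] by simp
next
  case False
  show ?thesis
    unfolding deg_in_le_iff
  proof
    fix m assume "m \<in> keys (coeff (upoly y p) k)"
    then have "Poly_Mapping.update y k m \<in> keys p"
      by (simp add: in_keys_iff lookup_coeff_upoly split: if_splits)
    then have "lookup (Poly_Mapping.update y k m) x \<le> deg_in x p"
      using deg_in_le_iff by blast
    then show "lookup m x \<le> deg_in x p" using False by (simp add: lookup_update)
  qed
qed

lemma deg_in_mult: "p \<noteq> 0 \<Longrightarrow> q \<noteq> 0 \<Longrightarrow> deg_in x (p * q) = deg_in x p + deg_in x q"
  by (simp add: deg_in_def degree_mult_eq)

lemma deg_in_uminus [simp]: "deg_in x (- p) = deg_in x p"
proof -
  have "upoly x (- p) = - upoly x p" by (rule upoly.hom_uminus)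
  then show ?thesis by (simp add: deg_in_def)
qed

lemma division_unique:
  assumes "q * b + r = (0 :: 'f::field mpoly)" "deg_in x r < deg_in x b"
  shows "q = 0" "r = 0"
proof -
  have b: "b \<noteq> 0" using assms(2) by (auto simp: deg_in_def)
  show "q = 0"
  proof (rule ccontr)
    assume "q \<noteq> 0"
    have "r = - (q * b)" using assms(1) by (simp add: eq_neg_iff_add_eq_0 add.commute)
    with assms(2) deg_in_mult[OF \<open>q \<noteq> 0\<close> b] show False by simp
  qed
  with assms(1) show "r = 0" by simp
qed

lemma indets_coeff_upoly_exists:
  assumes "y \<in> indets p"
  shows "\<exists>k>0. coeff (upoly y p) k \<noteq> 0"
  using assms unfolding deg_in_pos_iff[symmetric] deg_in_def
  by (metis coeff_0 leading_coeff_0_iff degree_0 less_irrefl)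

text \<open>
  \<open>pseudo_division\<close> does not bound the leaders of quotient and remainder; the uniqueness of
  division with remainder does.
\<close>

lemma division_indets:
  assumes eq: "a = q * b + (r :: 'f::field mpoly)" and deg: "deg_in x r < deg_in x b"
    and y: "y \<notin> indets a" "y \<notin> indets b"
  shows "y \<notin> indets q" "y \<notin> indets r"
proof -
  have *: "coeff (upoly y q) k = 0 \<and> coeff (upoly y r) k = 0" if "k > 0" for k
  proof -
    have "coeff (upoly y a) k = coeff (upoly y q * upoly y b + upoly y r) k" using eq by simp
    then have "coeff (upoly y q) k * b + coeff (upoly y r) k = 0"
      using that by (simp add: upoly_free y coeff_pCons mult.commute split: nat.splits)
    then show ?thesis
      using division_unique deg_in_coeff_upoly_le[of x y r k] deg by (metis le_less_trans)
  qed
  then show "y \<notin> indets q" "y \<notin> indets r"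
    using indets_coeff_upoly_exists by blast+
qed

definition initial_tail :: "'f::field mpoly \<Rightarrow> 'f mpoly" where
  "initial_tail p = p - init p * var (ld p) ^ mdeg p"

lemma upoly_init: "p \<in> poly_ring n \<Longrightarrow> ld p > 0 \<Longrightarrow> upoly (ld p) (init p) = [:init p:]"
  by (intro upoly_poly_ring_pred init_poly_ring)

lemma upoly_var_power: "upoly x (var x ^ k) = monom 1 k"
  by (simp add: upoly.hom_power upoly_var monom_altdef)

lemma initial_tail:
  assumes p: "p \<in> poly_ring n" "ld p > 0"
  shows "initial_tail p \<in> poly_ring (ld p)" "deg_in (ld p) (initial_tail p) < mdeg p"
proof -
  show "initial_tail p \<in> poly_ring (ld p)"
    unfolding initial_tail_def using p init_poly_ring[OF p(1)]
    by (intro poly_ring_diff poly_ring_mult poly_ring_power poly_ring_var poly_ring_ld[OF p(1)])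
      (auto intro: poly_ring_mono)
  have mdeg: "mdeg p > 0" using mdeg_pos_iff p by blast
  have "upoly (ld p) (initial_tail p) =
      upoly (ld p) p - monom (init p) (mdeg p)"
    unfolding initial_tail_def upoly.hom_minus by (simp add: upoly_init[OF p] upoly_var_power smult_monom)
  moreover have "degree \<dots> < mdeg p"
  proof (intro degree_lessI)
    show "\<forall>k\<ge>mdeg p. coeff (upoly (ld p) p - monom (init p) (mdeg p)) k = 0"
      by (auto simp: init_def mdeg_def deg_in_def coeff_eq_0 le_less)
  qed (use mdeg in simp)
  ultimately show "deg_in (ld p) (initial_tail p) < mdeg p" by (simp add: deg_in_def)
qed

lemma elem_atD: "elem_at S x = Some c \<Longrightarrow> c \<in> fst S \<and> ld (pol c) = x"
  unfolding elem_at_def by (auto split: if_splits simp: sys_at_def dest!: theI')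

definition reducible :: "'f::field psys \<Rightarrow> 'f mpoly \<Rightarrow> bool" where
  "reducible S q \<longleftrightarrow> ld q > 0 \<and> (\<exists>t. elem_at S (ld q) = Some (Equation t) \<and> mdeg q \<ge> mdeg t)"

lemma reduce_loop_unfold:
  "reduce_loop prem S q = (if reducible S q
     then reduce_loop prem S (prem q (pol (the (elem_at S (ld q)))) (ld q)) else Some q)"
  unfolding reduce_loop_def reducible_def by (subst while_option_unfold) simp

lemma reduce_reducible:
  assumes "ld q > 0" "elem_at S (ld q) = Some (Equation t)" "mdeg t \<le> mdeg q"
  shows "reduce prem S q = reduce prem S (prem q t (ld q))"
proof -
  have "reducible S q" using assms by (auto simp: reducible_def)
  then have "reduce_loop prem S q = reduce_loop prem S (prem q t (ld q))"
    using assms(2) by (subst reduce_loop_unfold) simp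
  then show ?thesis by (subst (1 2) reduce.simps) simp
qed

lemma reduce_const:
  assumes "ld q = 0"
  shows "reduce prem S q = Some q"
proof -
  have "reduce_loop prem S q = Some q"
    using assms by (subst reduce_loop_unfold) (simp add: reducible_def)
  then show ?thesis using assms by (subst reduce.simps) simp
qed

lemma reduce_0 [simp]: "reduce prem S 0 = Some 0"
  and reduce_1 [simp]: "reduce prem S 1 = Some 1"
  by (simp_all add: reduce_const)

lemma reduce_irreducible:
  assumes "ld q > 0" "\<not> reducible S q"
  shows "reduce prem S q = Option.bind (reduce prem S (init q))
    (\<lambda>r. if r = 0 then reduce prem S (initial_tail q) else Some q)"
proof -
  have "reduce_loop prem S q = Some q"
    using assms by (subst reduce_loop_unfold) simp
  then show ?thesis
    unfolding initial_tail_def using assms by (subst reduce.simps) simp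
qed

definition reduced :: "'f::field pdiv \<Rightarrow> 'f psys \<Rightarrow> 'f mpoly \<Rightarrow> bool" where
  "reduced prem S q \<longleftrightarrow>
     (ld q > 0 \<longrightarrow> \<not> reducible S q \<and> reduce prem S (init q) \<noteq> Some 0)"

lemma indets_scale:
  assumes "c \<noteq> 0"
  shows "indets (single 0 c * p :: 'f::field mpoly) = indets p"
proof
  show "indets (single 0 c * p) \<subseteq> indets p" using indets_mult[of "single 0 c" p] by simp
  have "single 0 (inverse c) * single 0 c = (1 :: 'f mpoly)"
    using assms by (simp add: mult_single)
  then have "indets p = indets (single 0 (inverse c) * (single 0 c * p))"
    by (simp flip: mult.assoc)
  also have "\<dots> \<subseteq> indets (single 0 c * p)"
    using indets_mult[of "single 0 (inverse c)" "single 0 c * p"] by simp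
  finally show "indets p \<subseteq> indets (single 0 c * p)" .
qed

lemma ld_scale: "c \<noteq> 0 \<Longrightarrow> ld (single 0 c * p :: 'f::field mpoly) = ld p"
  by (simp add: ld_def indets_scale)

lemma upoly_scale: "upoly x (single 0 c * p) = smult (single 0 c) (upoly x p)"
  by (simp add: upoly_const)

lemma single_0_eq_0_iff [simp]: "single k c = 0 \<longleftrightarrow> c = 0"
  by (metis lookup_single_eq lookup_zero single_zero)

lemma mdeg_scale: "c \<noteq> 0 \<Longrightarrow> mdeg (single 0 c * p) = mdeg p"
  by (simp add: mdeg_def deg_in_def ld_scale upoly_scale del: upoly_mult)

lemma init_scale: "c \<noteq> 0 \<Longrightarrow> init (single 0 c * p) = single 0 c * init p"
  by (simp add: init_def ld_scale upoly_scale del: upoly_mult)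

lemma initial_tail_scale:
  "c \<noteq> 0 \<Longrightarrow> initial_tail (single 0 c * p) = single 0 c * initial_tail p"
  by (simp add: initial_tail_def init_scale ld_scale mdeg_scale right_diff_distrib mult.assoc)

locale pdiv_ring =
  fixes n :: nat and prem pquo :: "'f::field_char_0 pdiv"
  assumes pseudo_division: "pseudo_division n prem pquo"
    and scaling: "scaling_compatible n prem"
begin

lemma pseudo_divisionE:
  assumes "p \<in> poly_ring n" "q \<in> poly_ring n" "ld p = x" "ld q = x" "x > 0"
  obtains m k where "prem p q x \<in> poly_ring x" "pquo p q x \<in> poly_ring x"
    "deg_in x (prem p q x) < deg_in x q" "m \<in> poly_ring (x - 1)"
    "m * p = pquo p q x * q + prem p q x" "m dvd init q ^ k"
proof -
  have "x \<le> n" using assms ld_le by blast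
  with assms pseudo_division obtain m k where
    *: "prem p q x \<in> poly_ring n" "pquo p q x \<in> poly_ring n"
    "deg_in x (prem p q x) < deg_in x q" "m \<in> poly_ring n"
    "m * p = pquo p q x * q + prem p q x" "ld m < x" "m dvd init q ^ k"
    unfolding pseudo_division_def by fastforce
  have m: "m \<in> poly_ring (x - 1)" using * poly_ring_iff_ld[of m n "x - 1"] by simp
  have pq: "p \<in> poly_ring x" "q \<in> poly_ring x"
    using poly_ring_ld[OF assms(1)] poly_ring_ld[OF assms(2)] assms(3,4) by simp_all
  have mp: "m * p \<in> poly_ring x"
    using m pq(1) by (intro poly_ring_mult) (auto intro: poly_ring_mono[of _ "x - 1"])
  have "y \<notin> indets (pquo p q x)" "y \<notin> indets (prem p q x)" if "y > x" for y
  proof -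
    have "y \<notin> indets (m * p)" "y \<notin> indets q"
      using mp pq(2) that unfolding poly_ring_def by fastforce+
    then show "y \<notin> indets (pquo p q x)" "y \<notin> indets (prem p q x)"
      using division_indets[OF *(5,3)] by blast+
  qed
  then have "prem p q x \<in> poly_ring x" "pquo p q x \<in> poly_ring x"
    using *(1,2) unfolding poly_ring_def by (auto simp: subset_iff) (meson not_le)+
  with * m that show thesis by blast
qed

lemma prem_poly_ring:
  assumes "p \<in> poly_ring n" "q \<in> poly_ring n" "ld p = x" "ld q = x" "x > 0"
  shows "prem p q x \<in> poly_ring x" "pquo p q x \<in> poly_ring x" "deg_in x (prem p q x) < deg_in x q"
  using pseudo_divisionE[OF assms] by metis+

lemma reduce_measure:
  assumes "p \<in> poly_ring n" "ld p = x" "x > 0" "r \<in> poly_ring x" "deg_in x r < mdeg p"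
  shows "((ld r, mdeg r), (x, mdeg p)) \<in> less_than <*lex*> less_than"
  using assms ld_le[of r x] by (auto simp: mdeg_def)

lemma reduce_induct [consumes 2, case_names const reducible tail]:
  assumes S: "pol ` fst S \<subseteq> poly_ring n" and p: "p \<in> poly_ring n"
    and const: "\<And>p. p \<in> poly_ring n \<Longrightarrow> ld p = 0 \<Longrightarrow> P p"
    and red: "\<And>p t. p \<in> poly_ring n \<Longrightarrow> ld p > 0 \<Longrightarrow> elem_at S (ld p) = Some (Equation t) \<Longrightarrow>
      t \<in> poly_ring n \<Longrightarrow> ld t = ld p \<Longrightarrow> mdeg t \<le> mdeg p \<Longrightarrow>
      prem p t (ld p) \<in> poly_ring (ld p) \<Longrightarrow> P (prem p t (ld p)) \<Longrightarrow> P p"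
    and tail: "\<And>p. p \<in> poly_ring n \<Longrightarrow> ld p > 0 \<Longrightarrow> \<not> reducible S p \<Longrightarrow>
      P (init p) \<Longrightarrow> P (initial_tail p) \<Longrightarrow> P p"
  shows "P p"
  using p
proof (induction p rule: wf_induct[of "inv_image (less_than <*lex*> less_than) (\<lambda>p. (ld p, mdeg p))"])
  case (2 p)
  have IH: "P r" if "r \<in> poly_ring n" "((ld r, mdeg r), (ld p, mdeg p)) \<in> less_than <*lex*> less_than" for r
    using 2 that by auto
  have le: "ld p \<le> n" using 2 ld_le by blast
  consider "ld p = 0" | "ld p > 0" "\<not> reducible S p" | "ld p > 0" "reducible S p" by blast
  then show ?case
  proof cases
    case 1
    with 2 const show ?thesis by blast
  next
    case 2
    have "P (init p)"
    proof (rule IH)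
      show "init p \<in> poly_ring n" using \<open>p \<in> poly_ring n\<close> by (rule init_poly_ring')
    qed (use ld_init[OF \<open>p \<in> poly_ring n\<close>] 2 in simp)
    moreover have "P (initial_tail p)"
      using initial_tail[OF \<open>p \<in> poly_ring n\<close>] 2 reduce_measure[OF \<open>p \<in> poly_ring n\<close>] le
      by (intro IH) (auto intro: poly_ring_mono)
    ultimately show ?thesis using 2 tail \<open>p \<in> poly_ring n\<close> by blast
  next
    case 3
    then obtain t where t: "elem_at S (ld p) = Some (Equation t)" "mdeg t \<le> mdeg p"
      by (auto simp: reducible_def)
    then have t': "t \<in> poly_ring n" "ld t = ld p" using elem_atD[OF t(1)] S by force+
    note * = prem_poly_ring[OF \<open>p \<in> poly_ring n\<close> t'(1) refl t'(2) 3(1)]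
    have "deg_in (ld p) (prem p t (ld p)) < mdeg p"
      using *(3) t(2) t'(2) by (simp add: mdeg_def)
    then have "P (prem p t (ld p))"
      using reduce_measure[OF \<open>p \<in> poly_ring n\<close> refl 3(1) *(1)] * le
      by (intro IH) (auto intro: poly_ring_mono)
    with red 3 t t' * \<open>p \<in> poly_ring n\<close> show ?thesis by blast
  qed
qed (intro wf_inv_image wf_lex_prod wf_less_than)

lemma reduce_total:
  assumes "pol ` fst S \<subseteq> poly_ring n" "p \<in> poly_ring n"
  shows "\<exists>q. reduce prem S p = Some q \<and> q \<in> poly_ring n \<and> ld q \<le> ld p \<and> reduced prem S q"
  using assms
proof (induction rule: reduce_induct)
  case (const p)
  then show ?case by (simp add: reduce_const reduced_def)
next
  case (reducible p t)
  then show ?case using ld_le by (fastforce simp: reduce_reducible)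
next
  case (tail p)
  then obtain r where r: "reduce prem S (init p) = Some r" by blast
  show ?case
  proof (cases "r = 0")
    case True
    moreover have "ld (initial_tail p) \<le> ld p" using initial_tail(1) tail ld_le by blast
    ultimately show ?thesis
      using tail r by (fastforce simp: reduce_irreducible)
  next
    case False
    with tail r show ?thesis by (simp add: reduce_irreducible reduced_def)
  qed
qed

lemma reduceE:
  assumes "pol ` fst S \<subseteq> poly_ring n" "p \<in> poly_ring n"
  obtains q where "reduce prem S p = Some q" "q \<in> poly_ring n" "ld q \<le> ld p" "reduced prem S q"
  using reduce_total[OF assms] by blast

lemma phi_prem_eq_0_iff:
  assumes "p \<in> poly_ring n" "q \<in> poly_ring n" "ld p = x" "ld q = x" "x > 0"
    and "phi a q = 0" "phi a (init q) \<noteq> 0"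
  shows "phi a (prem p q x) = 0 \<longleftrightarrow> phi a p = 0"
proof -
  from pseudo_divisionE[OF assms(1-5)] obtain m k where
    m: "m * p = pquo p q x * q + prem p q x" "m dvd init q ^ k" by metis
  from m(2) obtain c where "init q ^ k = m * c" by (rule dvdE)
  then have "phi a (init q) ^ k = phi a m * phi a c" by (metis phi.hom_power phi_mult)
  with assms(7) have "phi a m \<noteq> 0" by auto
  moreover have "phi a m * phi a p = phi a (pquo p q x) * phi a q + phi a (prem p q x)"
    using m(1) by (metis phi_add phi_mult)
  then have "phi a (prem p q x) = phi a m * phi a p" using assms(6) by simp
  ultimately show ?thesis by simp
qed

lemma phi_reduce_eq_0_iff:
  assumes "pol ` fst S \<subseteq> poly_ring n" "p \<in> poly_ring n"
    and "reduce prem S p = Some q"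
    and "\<And>y t. y \<le> ld p \<Longrightarrow> elem_at S y = Some (Equation t) \<Longrightarrow> phi a t = 0 \<and> phi a (init t) \<noteq> 0"
  shows "phi a q = 0 \<longleftrightarrow> phi a p = 0"
  using assms
proof (induction arbitrary: q rule: reduce_induct)
  case (const p)
  then show ?case by (simp add: reduce_const)
next
  case (reducible p t)
  have "ld (prem p t (ld p)) \<le> ld p" using ld_le reducible by blast
  then have "phi a t' = 0 \<and> phi a (init t') \<noteq> 0"
    if "y \<le> ld (prem p t (ld p))" "elem_at S y = Some (Equation t')" for y t'
    using reducible.prems(2)[of y t'] that by simp
  moreover have "reduce prem S (prem p t (ld p)) = Some q"
    using reducible.hyps reducible.prems(1) by (simp add: reduce_reducible)
  ultimately have "phi a q = 0 \<longleftrightarrow> phi a (prem p t (ld p)) = 0"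
    by (rule reducible.IH[rotated])
  also have "\<dots> \<longleftrightarrow> phi a p = 0"
    using reducible.hyps reducible.prems(2)[OF order_refl]
    by (intro phi_prem_eq_0_iff) simp_all
  finally show ?case .
next
  case (tail p)
  obtain r where r: "reduce prem S (init p) = Some r"
    using reduce_total[OF assms(1) init_poly_ring'] tail.hyps by blast
  have reduce: "reduce prem S p = (if r = 0 then reduce prem S (initial_tail p) else Some p)"
    using tail.hyps r by (simp add: reduce_irreducible)
  have ld: "ld (init p) \<le> ld p" "ld (initial_tail p) \<le> ld p"
    using ld_init tail.hyps initial_tail(1) ld_le by (blast intro: less_imp_le)+
  show ?case
  proof (cases "r = 0")
    case True
    have "phi a q = 0 \<longleftrightarrow> phi a (initial_tail p) = 0"
    proof (rule tail.IH(2))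
      show "reduce prem S (initial_tail p) = Some q" using reduce True tail.prems(1) by simp
      show "phi a t = 0 \<and> phi a (init t) \<noteq> 0"
        if "y \<le> ld (initial_tail p)" "elem_at S y = Some (Equation t)" for y t
        using tail.prems(2)[of y t] that ld(2) by simp
    qed
    moreover have "phi a r = 0 \<longleftrightarrow> phi a (init p) = 0"
    proof (rule tail.IH(1))
      show "phi a t = 0 \<and> phi a (init t) \<noteq> 0"
        if "y \<le> ld (init p)" "elem_at S y = Some (Equation t)" for y t
        using tail.prems(2)[of y t] that ld(1) by simp
    qed (fact r)
    then have "phi a (initial_tail p) = phi a p"
      using True by (simp add: initial_tail_def phi.hom_minus)
    ultimately show ?thesis by simp
  next
    case False
    with reduce tail.prems(1) show ?thesis by simp
  qed
qed

lemma reduce_cong: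
  assumes "pol ` fst S \<subseteq> poly_ring n" "p \<in> poly_ring n"
    and eq: "\<And>x t. elem_at S x = Some (Equation t) \<longleftrightarrow> elem_at S' x = Some (Equation t)"
  shows "reduce prem S p = reduce prem S' p"
  using assms(1,2)
proof (induction rule: reduce_induct)
  case (tail p)
  then have "\<not> reducible S' p" by (simp add: reducible_def eq)
  with tail show ?case by (simp add: reduce_irreducible cong: if_cong)
qed (simp_all add: reduce_const reduce_reducible eq)

lemma reduce_scale:
  assumes "pol ` fst S \<subseteq> poly_ring n" "p \<in> poly_ring n" and "c \<noteq> 0"
  shows "\<exists>q u. u \<noteq> 0 \<and> reduce prem S p = Some q \<and>
    reduce prem S (single 0 c * p) = Some (single 0 u * q)"
  using assms
proof (induction arbitrary: c rule: reduce_induct)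
  case (const p)
  then show ?case by (auto simp: reduce_const ld_scale)
next
  case (reducible p t)
  have "ld p \<le> n" using reducible ld_le by blast
  then obtain u where "u \<noteq> 0"
    "prem (single 0 c * p) t (ld p) = single 0 u * prem p t (ld p)"
    using scaling[unfolded scaling_compatible_def, rule_format, of p t "ld p" c]
      reducible.hyps reducible.prems by auto
  moreover have "reduce prem S (single 0 c * p) = reduce prem S (prem (single 0 c * p) t (ld p))"
    using reducible by (subst reduce_reducible) (simp_all add: ld_scale mdeg_scale)
  ultimately show ?case using reducible by (simp add: reduce_reducible)
next
  case (tail p)
  obtain r u where ru: "u \<noteq> 0" "reduce prem S (init p) = Some r"
    "reduce prem S (single 0 c * init p) = Some (single 0 u * r)" using tail by blast
  have "\<not> reducible S (single 0 c * p)"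
    using tail by (simp add: reducible_def ld_scale mdeg_scale)
  then have *: "reduce prem S (single 0 c * p) =
      (if r = 0 then reduce prem S (single 0 c * initial_tail p) else Some (single 0 c * p))"
    using tail.hyps tail.prems ru
    by (subst reduce_irreducible) (simp_all add: ld_scale init_scale initial_tail_scale)
  have "reduce prem S p = (if r = 0 then reduce prem S (initial_tail p) else Some p)"
    using tail.hyps tail.prems ru by (subst reduce_irreducible) simp_all
  with * tail.IH(2)[OF tail.prems] tail.prems show ?case by auto
qed

lemma reduce_scale_eq_0_iff:
  assumes "pol ` fst S \<subseteq> poly_ring n" "p \<in> poly_ring n" and "c \<noteq> 0"
  shows "reduce prem S (single 0 c * p) = Some 0 \<longleftrightarrow> reduce prem S p = Some 0"
  using reduce_scale[OF assms] by auto

end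

instance alg_closure :: (field) field_gcd ..

subsection \<open>Square-free polynomials over an algebraically closed field\<close>

lemma squarefree_iff_order:
  fixes f :: "'k::{alg_closed_field,field_gcd} poly"
  assumes "f \<noteq> 0"
  shows "squarefree f \<longleftrightarrow> (\<forall>b. order b f \<le> 1)"
proof
  assume f: "squarefree f"
  show "\<forall>b. order b f \<le> 1"
  proof (rule allI, rule ccontr)
    fix b assume "\<not> order b f \<le> 1"
    then have "[:- b, 1:] ^ 2 dvd f" unfolding order_divides by simp
    then have "[:- b, 1:] dvd 1" using f squarefreeD by blast
    then show False by (simp add: is_unit_iff_degree)
  qed
next
  assume *: "\<forall>b. order b f \<le> 1"
  show "squarefree f"
  proof (rule squarefreeI, rule ccontr)
    fix g assume g: "g\<^sup>2 dvd f" "\<not> g dvd 1"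
    then have "g \<noteq> 0" using assms by auto
    then have "degree g > 0" using g(2) by (simp add: is_unit_iff_degree)
    then obtain b where "poly g b = 0" using alg_closed_imp_poly_has_root by blast
    then have "[:- b, 1:] ^ 2 dvd g ^ 2" by (intro dvd_power_same) (simp add: poly_eq_0_iff_dvd)
    then have "[:- b, 1:] ^ 2 dvd f" using g(1) by (rule dvd_trans)
    then have "2 \<le> order b f" unfolding order_divides using assms by simp
    with * show False by (metis not_less_eq_eq numeral_2_eq_2 One_nat_def)
  qed
qed

lemma order_ge_1_iff: "f \<noteq> 0 \<Longrightarrow> order b f \<ge> 1 \<longleftrightarrow> poly f b = 0"
  by (simp add: order_root Suc_le_eq)

definition is_gcd :: "'k::comm_semiring_1 \<Rightarrow> 'k \<Rightarrow> 'k \<Rightarrow> bool" where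
  "is_gcd d f g \<longleftrightarrow> d dvd f \<and> d dvd g \<and> (\<forall>e. e dvd f \<longrightarrow> e dvd g \<longrightarrow> e dvd d)"

lemma is_gcd_root_iff:
  fixes f g d :: "'k::field poly"
  assumes "is_gcd d f g"
  shows "poly d b = 0 \<longleftrightarrow> poly f b = 0 \<and> poly g b = 0"
  using assms unfolding is_gcd_def poly_eq_0_iff_dvd by (meson dvd_trans)

lemma squarefree_part_pderiv:
  fixes f r d :: "'k::{alg_closed_field,field_gcd,field_char_0} poly"
  assumes "degree f > 0" "is_gcd d f (pderiv f)" "c \<noteq> 0" "smult c f = r * d"
  shows "squarefree r" "poly r b = 0 \<longleftrightarrow> poly f b = 0"
proof -
  let ?p = "smult c f"
  have "pderiv ?p \<noteq> 0" using assms(1,3) by (simp add: pderiv_smult pderiv_eq_0_iff)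
  moreover obtain e where "pderiv f = d * e" using assms(2) by (auto simp: is_gcd_def)
  then have "pderiv ?p = smult c e * d" by (simp add: pderiv_smult mult.commute)
  moreover have "\<exists>u v. d = u * ?p + v * pderiv ?p"
  proof -
    have "gcd f (pderiv f) dvd d" "d dvd gcd f (pderiv f)"
      using assms(2) by (simp_all add: is_gcd_def)
    then obtain k where k: "d = gcd f (pderiv f) * k" by auto
    obtain u v where uv: "u * f + v * pderiv f = gcd f (pderiv f)"
      using bezout_coefficients_fst_snd by blast
    have "d = smult (inverse c) (k * u) * ?p + smult (inverse c) (k * v) * pderiv ?p"
      using assms(3) by (simp add: k uv[symmetric] pderiv_smult algebra_simps)
    then show ?thesis by blast
  qed
  ultimately have *: "rsquarefree r \<and> (\<forall>a. (poly r a = 0) = (poly ?p a = 0))"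
    using assms(4) poly_squarefree_decomp[of ?p r d] by blast
  then show "poly r b = 0 \<longleftrightarrow> poly f b = 0" using assms(3) by simp
  have "r \<noteq> 0" using assms by auto
  then show "squarefree r"
    using * by (simp add: squarefree_iff_order rsquarefree_def) (metis le_0_eq le_refl zero_le_one One_nat_def)
qed

lemma squarefree_quotient:
  fixes f g r d :: "'k::{alg_closed_field,field_gcd} poly"
  assumes "squarefree f" "is_gcd d f g" "c \<noteq> 0" "smult c f = r * d"
  shows "squarefree r" "poly r b = 0 \<longleftrightarrow> poly f b = 0 \<and> poly g b \<noteq> 0"
proof -
  have f0: "f \<noteq> 0" using assms by auto
  then have rd: "r * d \<noteq> 0" using assms(3,4) by (metis smult_eq_0_iff)
  then have r0: "r \<noteq> 0" and d0: "d \<noteq> 0" by auto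
  have order: "order b r + order b d \<le> 1" for b
  proof -
    have "order b r + order b d = order b (smult c f)" using rd by (simp add: order_mult assms(4))
    also have "\<dots> = order b f" using assms(3) by (simp add: order_smult)
    finally show ?thesis using assms(1) f0 by (simp add: squarefree_iff_order)
  qed
  then show "squarefree r" using r0 by (simp add: squarefree_iff_order) (meson add_leD1)
  have eq: "c * poly f b = poly r b * poly d b" using assms(4) by (metis poly_mult poly_smult)
  have "\<not> (poly r b = 0 \<and> poly d b = 0)"
    using order[of b] order_ge_1_iff[OF r0, of b] order_ge_1_iff[OF d0, of b] by auto
  with eq is_gcd_root_iff[OF assms(2), of b] assms(3)
  show "poly r b = 0 \<longleftrightarrow> poly f b = 0 \<and> poly g b \<noteq> 0" by auto
qed

lemma squarefree_lcm:
  fixes f g r d :: "'k::{alg_closed_field,field_gcd} poly"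
  assumes "squarefree f" "squarefree g" "is_gcd d f g" "c \<noteq> 0" "smult c f = r * d"
  shows "squarefree (r * g)" "poly (r * g) b = 0 \<longleftrightarrow> poly f b = 0 \<or> poly g b = 0"
proof -
  note r = squarefree_quotient[OF assms(1,3,4,5)]
  show "poly (r * g) b = 0 \<longleftrightarrow> poly f b = 0 \<or> poly g b = 0" using r(2)[of b] by auto
  have r0: "r \<noteq> 0" and g0: "g \<noteq> 0" using r(1) assms(2) by auto
  have "order b (r * g) \<le> 1" for b
  proof -
    have "order b r \<le> 1" "order b g \<le> 1"
      using r(1) assms(2) r0 g0 by (simp_all add: squarefree_iff_order)
    moreover have "\<not> (order b r \<ge> 1 \<and> order b g \<ge> 1)"
      unfolding order_ge_1_iff[OF r0] order_ge_1_iff[OF g0] using r(2) by blast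
    moreover have "order b (r * g) = order b r + order b g" using r0 g0 by (simp add: order_mult)
    ultimately show ?thesis by linarith
  qed
  then show "squarefree (r * g)" using r0 g0 by (simp add: squarefree_iff_order)
qed

subsection \<open>The polynomial remainder sequence\<close>

lemma poly_ring_det:
  assumes "A \<in> carrier_mat k k" "\<And>i j. i < k \<Longrightarrow> j < k \<Longrightarrow> A $$ (i, j) \<in> poly_ring x"
  shows "det A \<in> (poly_ring x :: 'f::field mpoly set)"
proof -
  have sign: "(of_int (sign p) :: 'f mpoly) \<in> poly_ring x" for p :: "nat \<Rightarrow> nat"
    by (simp add: sign_def poly_ring_uminus)
  show ?thesis
    unfolding det_def'[OF assms(1)]
    by (intro poly_ring_sum poly_ring_mult poly_ring_prod sign assms(2))
      (auto dest: permutes_in_image)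
qed

lemma poly_ring_coeff_subresultant:
  fixes P Q :: "'f::field mpoly poly"
  assumes "\<And>k. coeff P k \<in> poly_ring x" "\<And>k. coeff Q k \<in> poly_ring x"
  shows "coeff (subresultant i P Q) k \<in> poly_ring x"
proof -
  have [simp]: "coeff_int P j \<in> poly_ring x" "coeff_int Q j \<in> poly_ring x" for j
    using assms by (auto simp: coeff_int_def)
  show ?thesis
    unfolding coeff_subresultant
    by (auto intro!: poly_ring_det[where k = "(degree P - i) + (degree Q - i)"]
        simp: subresultant'_mat_def Let_def)
qed

lemma regular_subres_degree: "regular_subres P Q i = 0 \<or> degree (regular_subres P Q i) = i"
  by (simp add: regular_subres_def)

lemma PRS_upoly:
  assumes "p \<in> poly_ring x" "q \<in> poly_ring x" "x > 0" "deg_in x q < deg_in x p"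
  shows "PRS p q x i \<in> poly_ring x"
    "upoly x (PRS p q x i) = regular_subres (upoly x p) (upoly x q) i"
proof -
  let ?s = "subresultant i (upoly x p) (upoly x q)"
  have s: "coeff ?s k \<in> poly_ring (x - 1)" for k
    using assms by (intro poly_ring_coeff_subresultant coeff_upoly_poly_ring)
  note s' = poly_var_poly_ring[of ?s, OF s assms(3)]
  show "PRS p q x i \<in> poly_ring x"
    using assms s' by (simp add: PRS_def Let_def)
  show "upoly x (PRS p q x i) = regular_subres (upoly x p) (upoly x q) i"
    using assms s' by (simp add: PRS_def Let_def regular_subres_def deg_in_def)
qed

lemma PRS_degree:
  assumes "p \<in> poly_ring x" "q \<in> poly_ring x" "x > 0" "deg_in x q < deg_in x p"
  shows "PRS p q x i = 0 \<or> deg_in x (PRS p q x i) = i"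
  using regular_subres_degree[of "upoly x p" "upoly x q" i] PRS_upoly(2)[OF assms, of i]
  unfolding deg_in_def by (metis upoly_eq_0_iff)

lemma res_upoly:
  assumes "p \<in> poly_ring x" "q \<in> poly_ring x" "x > 0" "deg_in x q < deg_in x p"
  shows "res p q x i = subres_coeff (upoly x p) (upoly x q) i"
proof -
  have coeff: "subres_coeff (upoly x p) (upoly x q) i = coeff (upoly x (PRS p q x i)) i"
    if "i \<noteq> deg_in x p"
    using that by (simp add: subres_coeff_def PRS_upoly(2)[OF assms] deg_in_def)
  consider "i = deg_in x p" | "i \<noteq> deg_in x p" "PRS p q x i = 0"
    | "i \<noteq> deg_in x p" "deg_in x (PRS p q x i) = i" "i = 0"
    | "i \<noteq> deg_in x p" "deg_in x (PRS p q x i) = i" "i > 0"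
    using PRS_degree[OF assms, of i] by (cases "i = 0") auto
  then show ?thesis
  proof cases
    case 1
    then show ?thesis by (simp add: res_def subres_coeff_def deg_in_def)
  next
    case 2
    then show ?thesis using coeff by (cases "i = 0") (simp_all add: res_def)
  next
    case 3
    then obtain c where "upoly x (PRS p q x 0) = [:c:]"
      by (metis deg_in_def degree_eq_zeroE)
    moreover from this poly_upoly_var[of x "PRS p q x 0"] have "c = PRS p q x 0" by simp
    ultimately show ?thesis using 3 coeff by (simp add: res_def)
  next
    case 4
    then have "ld (PRS p q x i) = x" using ld_eq_iff[OF PRS_upoly(1)[OF assms] assms(3)] by simp
    then show ?thesis using 4 coeff by (simp add: res_def init_alt deg_in_def)
  qed
qed

lemma res_poly_ring:
  assumes "p \<in> poly_ring x" "q \<in> poly_ring x" "x > 0" "deg_in x q < deg_in x p"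
  shows "res p q x i \<in> poly_ring (x - 1)"
proof (cases "i = deg_in x p")
  case False
  then have "res p q x i = coeff (upoly x (PRS p q x i)) i"
    by (simp add: res_upoly[OF assms] subres_coeff_def PRS_upoly(2)[OF assms] deg_in_def)
  then show ?thesis using coeff_upoly_poly_ring[OF PRS_upoly(1)[OF assms]] by simp
qed (simp add: res_def)

lemma PRS_regular:
  assumes "p \<in> poly_ring x" "q \<in> poly_ring x" "x > 0" "deg_in x q < deg_in x p"
    and "res p q x i \<noteq> 0" "i > 0"
  shows "ld (PRS p q x i) = x" "deg_in x (PRS p q x i) = i"
    "i \<noteq> deg_in x p \<Longrightarrow> init (PRS p q x i) = res p q x i"
proof -
  show *: "i \<noteq> deg_in x p \<Longrightarrow> init (PRS p q x i) = res p q x i"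
    using assms by (simp add: res_def)
  have "PRS p q x i \<noteq> 0"
  proof (cases "i = deg_in x p")
    case True
    then show ?thesis using assms(4) by (auto simp: PRS_def deg_in_def)
  next
    case False
    with * assms(5) show ?thesis by auto
  qed
  then show "deg_in x (PRS p q x i) = i" using PRS_degree[OF assms(1-4)] by blast
  with \<open>i > 0\<close> show "ld (PRS p q x i) = x"
    using ld_eq_iff[OF PRS_upoly(1)[OF assms(1-4)] assms(3)] by simp
qed

lemma phi_below_PRS:
  fixes a :: "nat \<Rightarrow> 'f::field alg_closure"
  assumes "p \<in> poly_ring x" "q \<in> poly_ring x" "x > 0" "deg_in x q < deg_in x p"
    and "ld p = x" "phi a (init p) \<noteq> 0" "i \<le> deg_in x p"
    and "phi a (res p q x i) \<noteq> 0" "\<And>j. j < i \<Longrightarrow> phi a (res p q x j) = 0"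
  shows "is_gcd (phi_below x a (PRS p q x i)) (phi_below x a p) (phi_below x a q)"
    "degree (phi_below x a (PRS p q x i)) = i"
proof -
  note g = regular_subres_gcd[OF phi.comm_ring_hom_axioms, where P = "upoly x p" and Q = "upoly x q"
      and i = i, unfolded res_upoly[OF assms(1-4), symmetric], of a]
  have "degree (upoly x q) < degree (upoly x p)" "phi a (lead_coeff (upoly x p)) \<noteq> 0"
    "i \<le> degree (upoly x p)"
    using assms by (simp_all add: deg_in_def init_alt)
  note g = g[OF this assms(8,9)]
  show "is_gcd (phi_below x a (PRS p q x i)) (phi_below x a p) (phi_below x a q)"
    "degree (phi_below x a (PRS p q x i)) = i"
    using g unfolding is_gcd_def phi_below_def PRS_upoly(2)[OF assms(1-4)] by blast+
qed

lemma phi_below_add: "phi_below x a (p + q) = phi_below x a p + phi_below x a q"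
  and phi_below_mult: "phi_below x a (p * q) = phi_below x a p * phi_below x a q"
  by (simp_all add: phi_below_def map_poly_phi.hom_add map_poly_phi.hom_mult)

lemma phi_below_coeff:
  assumes "m \<in> poly_ring (x - 1)" "x > 0"
  shows "phi_below x a m = [:phi a m:]"
  unfolding phi_below_def upoly_poly_ring_pred[OF assms]
  by (intro poly_eqI) (simp add: coeff_map_poly coeff_pCons split: nat.split)

lemma degree_phi_below:
  assumes "phi a (lead_coeff (upoly x p)) \<noteq> 0"
  shows "degree (phi_below x a p) = deg_in x p"
  unfolding phi_below_def deg_in_def using assms by (rule map_poly_degree_eq)

lemma degree_phi_below_le: "degree (phi_below x a p) \<le> deg_in x p"
  unfolding phi_below_def deg_in_def by (rule degree_map_poly_le)

lemma upoly_partial_deriv: "upoly x (partial_deriv x p) = pderiv (upoly x p)"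
  unfolding partial_deriv_def
proof (rule upoly_poly_var)
  fix j
  have "x \<notin> indets (of_nat k * coeff (upoly x p) (Suc j))" for k
    using indets_mult[of "of_nat k" "coeff (upoly x p) (Suc j)"]
      indets_coeff_upoly[of x p "Suc j"] by (auto simp flip: single_of_nat)
  then show "x \<notin> indets (coeff (pderiv (upoly x p)) j)" unfolding coeff_pderiv .
qed

lemma phi_below_partial_deriv:
  "phi_below x a (partial_deriv x p) = pderiv (phi_below x a p)"
  unfolding phi_below_def upoly_partial_deriv
  by (intro poly_eqI) (simp add: coeff_map_poly coeff_pderiv phi.hom_of_nat distrib_right)

lemma partial_deriv_poly_ring:
  assumes "p \<in> poly_ring x" "x > 0"
  shows "partial_deriv x p \<in> poly_ring x"
  unfolding partial_deriv_def
proof (rule poly_var_poly_ring)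
  fix j
  have "of_nat k * coeff (upoly x p) (Suc j) \<in> poly_ring (x - 1)" for k
    using assms by (intro poly_ring_mult coeff_upoly_poly_ring) (simp_all flip: single_of_nat)
  then show "coeff (pderiv (upoly x p)) j \<in> poly_ring (x - 1)" unfolding coeff_pderiv .
qed fact

lemma deg_in_partial_deriv:
  "deg_in x (partial_deriv x p) = deg_in x p - 1" for p :: "'f::field_char_0 mpoly"
  by (simp add: deg_in_def upoly_partial_deriv degree_pderiv)

subsection \<open>Specialised quotients\<close>

lemma res_initial:
  assumes "p \<in> poly_ring x" "q \<in> poly_ring x" "ld q = x" "x > 0" "deg_in x q < deg_in x p"
  shows "res p q x (deg_in x q) = init q"
proof -
  have "deg_in x q > 0" using ld_eq_iff[OF assms(2,4)] assms(3) by simp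
  then show ?thesis using assms(5) by (simp add: res_def PRS_def)
qed

lemma res_partial_deriv:
  fixes p :: "'f::field_char_0 mpoly"
  assumes "p \<in> poly_ring x" "ld p = x" "x > 0"
  shows "\<exists>c. c \<noteq> 0 \<and>
    res p (partial_deriv x p) x (deg_in x p - 1) = single 0 c * init p"
proof -
  let ?q = "partial_deriv x p"
  have d: "deg_in x p > 0" using ld_eq_iff assms by blast
  then have less: "deg_in x ?q < deg_in x p" by (simp add: deg_in_partial_deriv)
  have "res p ?q x (deg_in x p - 1) = coeff (upoly x ?q) (deg_in x p - 1)"
    using d by (simp add: res_upoly[OF assms(1) partial_deriv_poly_ring[OF assms(1,3)] assms(3) less]
        subres_coeff_def regular_subres_def deg_in_def[symmetric] deg_in_partial_deriv)
  also have "\<dots> = of_nat (deg_in x p) * init p"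
    using d assms(2) by (simp add: upoly_partial_deriv coeff_pderiv init_alt deg_in_def)
  also have "\<dots> = single 0 (of_nat (deg_in x p)) * init p" by simp
  finally show ?thesis using d by (intro exI[of _ "of_nat (deg_in x p)"]) simp
qed

context pdiv_ring
begin

lemma pquo_degree:
  assumes "p \<in> poly_ring n" "g \<in> poly_ring n" "ld p = x" "ld g = x" "x > 0"
    and "deg_in x g \<le> deg_in x p"
  obtains m k where "m \<in> poly_ring (x - 1)" "m dvd init g ^ k"
    "m * p = pquo p g x * g + prem p g x" "deg_in x (prem p g x) < deg_in x g"
    "deg_in x (pquo p g x) + deg_in x g = deg_in x p"
    "m * init p = lead_coeff (upoly x (pquo p g x)) * init g"
proof -
  from pseudo_divisionE[OF assms(1-5)] obtain m k where
    *: "deg_in x (prem p g x) < deg_in x g" "m \<in> poly_ring (x - 1)"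
    "m * p = pquo p g x * g + prem p g x" "m dvd init g ^ k" by metis
  define P G R E where "P = upoly x p" and "G = upoly x g"
    and "R = upoly x (pquo p g x)" and "E = upoly x (prem p g x)"
  have g0: "g \<noteq> 0" and p0: "p \<noteq> 0" using assms by auto
  then have "init g ^ k \<noteq> 0" by simp
  then have m0: "m \<noteq> 0" using *(4) by auto
  have "upoly x (m * p) = upoly x (pquo p g x * g + prem p g x)" using *(3) by simp
  then have eq: "smult m P = R * G + E"
    using upoly_poly_ring_pred[OF *(2) assms(5)] by (simp add: P_def G_def R_def E_def)
  have deg: "degree E < degree G" "degree G \<le> degree P"
    using * assms by (simp_all add: P_def G_def E_def deg_in_def)
  have RG: "R * G = smult m P - E" using eq by simp
  have "degree (smult m P + (- E)) = degree (smult m P)"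
    using m0 deg by (intro degree_add_eq_left) simp
  then have degRG: "degree (R * G) = degree P" using m0 by (simp add: RG)
  have "coeff (R * G) (degree P) = m * lead_coeff P"
    using deg by (simp add: RG coeff_eq_0)
  then have lc: "lead_coeff R * lead_coeff G = m * lead_coeff P"
    using degRG by (metis lead_coeff_mult)
  have "P \<noteq> 0" using p0 by (simp add: P_def)
  then have "lead_coeff R * lead_coeff G \<noteq> 0" using lc m0 by simp
  then have "R \<noteq> 0" "G \<noteq> 0" by auto
  then have "degree R + degree G = degree P" using degRG by (simp add: degree_mult_eq)
  with that[OF *(2,4,3,1)] lc assms(3,4) show thesis
    by (simp add: P_def G_def R_def deg_in_def init_alt)
qed

lemma phi_below_pquo:
  assumes "p \<in> poly_ring n" "g \<in> poly_ring n" "ld p = x" "ld g = x" "x > 0"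
    and "deg_in x g \<le> deg_in x p"
    and "phi a (init p) \<noteq> 0" "phi a (init g) \<noteq> 0" "phi_below x a g dvd phi_below x a p"
  shows "\<exists>c. c \<noteq> 0 \<and> smult c (phi_below x a p) = phi_below x a (pquo p g x) * phi_below x a g"
    "phi a (lead_coeff (upoly x (pquo p g x))) \<noteq> 0"
proof -
  from pquo_degree[OF assms(1-6)] obtain m k where
    *: "m \<in> poly_ring (x - 1)" "m dvd init g ^ k"
    "m * p = pquo p g x * g + prem p g x" "deg_in x (prem p g x) < deg_in x g"
    "m * init p = lead_coeff (upoly x (pquo p g x)) * init g" by metis
  obtain c where "init g ^ k = m * c" using *(2) by (rule dvdE)
  then have "phi a (init g) ^ k = phi a m * phi a c" by (metis phi.hom_power phi_mult)
  with assms(8) have m: "phi a m \<noteq> 0" by auto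
  have "phi a m * phi a (init p) = phi a (lead_coeff (upoly x (pquo p g x))) * phi a (init g)"
    using *(5) by (metis phi_mult)
  with m assms(7) show "phi a (lead_coeff (upoly x (pquo p g x))) \<noteq> 0" by auto
  let ?h = "phi_below x a"
  have "?h (m * p) = ?h (pquo p g x * g + prem p g x)" using *(3) by simp
  then have eq: "smult (phi a m) (?h p) = ?h (pquo p g x) * ?h g + ?h (prem p g x)"
    by (simp add: phi_below_mult phi_below_add phi_below_coeff[OF *(1) assms(5)])
  then have rem: "?h (prem p g x) = smult (phi a m) (?h p) - ?h (pquo p g x) * ?h g" by simp
  have "?h g dvd ?h (prem p g x)"
    unfolding rem using assms(9) by (intro dvd_diff dvd_smult) simp_all
  moreover have "degree (?h (prem p g x)) < degree (?h g)"
  proof -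
    have "degree (?h g) = deg_in x g"
      using assms(4,8) by (intro degree_phi_below) (simp add: init_alt)
    then show ?thesis using degree_phi_below_le[of x a "prem p g x"] *(4) by simp
  qed
  ultimately have "?h (prem p g x) = 0" by (meson dvd_imp_degree_le not_le)
  with eq m show "\<exists>c. c \<noteq> 0 \<and> smult c (?h p) = ?h (pquo p g x) * ?h g" by auto
qed

definition quotient :: "'f mpoly \<Rightarrow> 'f mpoly \<Rightarrow> nat \<Rightarrow> nat \<Rightarrow> 'f mpoly" where
  "quotient p q x i = (if i > 0 then pquo p (PRS p q x i) x else p)"

lemma quotient_poly_ring:
  assumes "p \<in> poly_ring n" "ld p = x" "q \<in> poly_ring x" "x > 0" "deg_in x q < deg_in x p"
    and "i \<le> deg_in x p" "res p q x i \<noteq> 0"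
  shows "quotient p q x i \<in> poly_ring x" "deg_in x (quotient p q x i) + i = deg_in x p"
proof -
  have p: "p \<in> poly_ring x" using poly_ring_ld[OF assms(1)] assms(2) by simp
  note g = PRS_regular[OF p assms(3,4,5,7)]
  have x: "x \<le> n" using ld_le assms by blast
  have G: "PRS p q x i \<in> poly_ring n"
    using PRS_upoly(1)[OF p assms(3,4,5)] x by (rule poly_ring_mono)
  have "quotient p q x i \<in> poly_ring x \<and> deg_in x (quotient p q x i) + i = deg_in x p"
  proof (cases "i > 0")
    case True
    then have "pquo p (PRS p q x i) x \<in> poly_ring x"
      using prem_poly_ring(2)[OF assms(1) G assms(2)] g assms(4) by blast
    moreover obtain m k where "deg_in x (pquo p (PRS p q x i) x) + deg_in x (PRS p q x i) = deg_in x p"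
      using pquo_degree[OF assms(1) G assms(2)] g True assms(4,6) by metis
    ultimately show ?thesis using True g by (simp add: quotient_def)
  qed (simp add: quotient_def p)
  then show "quotient p q x i \<in> poly_ring x" "deg_in x (quotient p q x i) + i = deg_in x p"
    by blast+
qed

lemma phi_below_quotient:
  assumes "p \<in> poly_ring n" "ld p = x" "q \<in> poly_ring x" "x > 0" "deg_in x q < deg_in x p"
    and "i \<le> deg_in x p" "phi a (init p) \<noteq> 0"
    and "phi a (res p q x i) \<noteq> 0" "\<And>j. j < i \<Longrightarrow> phi a (res p q x j) = 0"
  obtains d c where "is_gcd d (phi_below x a p) (phi_below x a q)" "c \<noteq> 0"
    "smult c (phi_below x a p) = phi_below x a (quotient p q x i) * d"
    "phi a (lead_coeff (upoly x (quotient p q x i))) \<noteq> 0"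
proof -
  have p: "p \<in> poly_ring x" using poly_ring_ld[OF assms(1)] assms(2) by simp
  have res: "res p q x i \<noteq> 0" using assms(8) by auto
  note g = PRS_regular[OF p assms(3,4,5) res]
  have x: "x \<le> n" using ld_le assms by blast
  have G: "PRS p q x i \<in> poly_ring n"
    using PRS_upoly(1)[OF p assms(3,4,5)] x by (rule poly_ring_mono)
  note gcd = phi_below_PRS[OF p assms(3,4,5,2,7,6,8,9)]
  show thesis
  proof (cases "i > 0")
    case True
    have "phi a (init (PRS p q x i)) \<noteq> 0"
    proof (cases "i = deg_in x p")
      case True
      then show ?thesis using assms(7) by (simp add: PRS_def)
    next
      case False
      then show ?thesis using g(3) True assms(8) by simp
    qed
    moreover have "phi_below x a (PRS p q x i) dvd phi_below x a p"
      using gcd(1) by (simp add: is_gcd_def)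
    ultimately show thesis
      using phi_below_pquo[OF assms(1) G assms(2) g(1)[OF True] assms(4) _ assms(7)]
        g(2)[OF True] assms(6) that[OF gcd(1)] True by (auto simp: quotient_def)
  next
    case False
    then obtain c where c: "phi_below x a (PRS p q x i) = [:c:]"
      using gcd(2) degree_eq_zeroE by blast
    have lc: "phi a (lead_coeff (upoly x p)) \<noteq> 0" using assms(2,7) by (simp add: init_alt)
    then have "phi_below x a p \<noteq> 0" using degree_phi_below[OF lc] assms(5) by auto
    then have "c \<noteq> 0" using gcd(1) c by (auto simp: is_gcd_def)
    moreover have "smult c (phi_below x a p) = phi_below x a p * phi_below x a (PRS p q x i)"
      by (simp add: c)
    ultimately show thesis
      using that[OF gcd(1)] False lc by (auto simp: quotient_def)
  qed
qed

lemma reduce_neq_None: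
  assumes "pol ` fst S \<subseteq> poly_ring n" "p \<in> poly_ring n"
  shows "reduce prem S p \<noteq> None"
  using reduce_total[OF assms] by auto

lemma res_splitE:
  assumes "pol ` fst S \<subseteq> poly_ring n" "p \<in> poly_ring n" "ld p = x" "q \<in> poly_ring x" "x > 0"
    and "deg_in x q < deg_in x p"
  obtains i where "res_split prem S p q = Some (i, split S (res p q x i))" "i \<le> deg_in x p"
    "reduce prem S (res p q x i) \<noteq> Some 0" "res p q x i \<noteq> 0" "res p q x i \<in> poly_ring (x - 1)"
    "\<And>j. j < i \<Longrightarrow> reduce prem S (res p q x j) = Some 0"
    "\<And>j. reduce prem S (res p q x j) \<noteq> Some 0 \<Longrightarrow> i \<le> j"
proof -
  have p: "p \<in> poly_ring x" using poly_ring_ld[OF assms(2)] assms(3) by simp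
  have x: "x \<le> n" using ld_le assms by blast
  define i where "i = (LEAST i. reduce prem S (res p q x i) \<noteq> Some 0)"
  have ex: "reduce prem S (res p q x (deg_in x p)) \<noteq> Some 0" by (simp add: res_def)
  have 1: "reduce prem S (res p q x i) \<noteq> Some 0" unfolding i_def using ex by (rule LeastI)
  have 2: "i \<le> j" if "reduce prem S (res p q x j) \<noteq> Some 0" for j
    unfolding i_def using that by (rule Least_le)
  have r: "res p q x i \<in> poly_ring (x - 1)" by (rule res_poly_ring[OF p assms(4,5,6)])
  then have "res p q x i \<in> poly_ring n" using x by (intro poly_ring_mono[OF r]) simp
  then obtain r' where "reduce prem S (res p q x i) = Some r'"
    using reduce_neq_None[OF assms(1)] by blast
  then have "res_split prem S p q = Some (i, split S (res p q x i))"
    unfolding res_split_def Let_def assms(3) i_def[symmetric] by simp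
  moreover have "res p q x i \<noteq> 0" using 1 by auto
  ultimately show thesis using that[of i] 1 2 ex r by (meson not_le)
qed

end

subsection \<open>The loop invariant\<close>

definition sat :: "(nat \<Rightarrow> 'f alg_closure) \<Rightarrow> 'f::field system \<Rightarrow> bool" where
  "sat a U \<longleftrightarrow> (\<forall>c\<in>U. satisfies a c)"

lemma Sol_iff_sat: "a \<in> Sol n U \<longleftrightarrow> a \<in> {1..n} \<rightarrow>\<^sub>E UNIV \<and> sat a U"
  by (simp add: Sol_def sat_def)

lemma sat_insert [simp]: "sat a (insert c U) \<longleftrightarrow> satisfies a c \<and> sat a U"
  by (simp add: sat_def)

lemma sat_Un [simp]: "sat a (U \<union> V) \<longleftrightarrow> sat a U \<and> sat a V"
  by (auto simp: sat_def)

lemma sat_memD: "sat a U \<Longrightarrow> c \<in> U \<Longrightarrow> satisfies a c"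
  by (simp add: sat_def)

lemma sat_sys_below: "sat a (sys_below U y) \<longleftrightarrow> (\<forall>c\<in>U. ld (pol c) < y \<longrightarrow> satisfies a c)"
  by (auto simp: sat_def sys_below_def)

definition candidate :: "nat \<Rightarrow> 'f::field system \<Rightarrow> bool" where
  "candidate n T \<longleftrightarrow> algebraic_system n T \<and> (\<forall>c\<in>T. ld (pol c) > 0) \<and> inj_on (\<lambda>c. ld (pol c)) T"

lemma candidate_unique:
  "candidate n T \<Longrightarrow> c \<in> T \<Longrightarrow> d \<in> T \<Longrightarrow> ld (pol c) = ld (pol d) \<Longrightarrow> c = d"
  by (auto simp: candidate_def inj_on_def)

lemma elem_at_eq_Some_iff:
  assumes "candidate n T"
  shows "elem_at (T, Q) y = Some c \<longleftrightarrow> c \<in> T \<and> ld (pol c) = y"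
proof
  assume "c \<in> T \<and> ld (pol c) = y"
  then have "\<And>d. d \<in> sys_at T y \<longleftrightarrow> d = c"
    using candidate_unique[OF assms] by (auto simp: sys_at_def)
  then show "elem_at (T, Q) y = Some c" by (simp add: elem_at_def)
qed (use elem_atD in fastforce)

lemma elem_at_eq_None_iff:
  assumes "candidate n T"
  shows "elem_at (T, Q) y = None \<longleftrightarrow> (\<forall>c\<in>T. ld (pol c) \<noteq> y)"
  using elem_at_eq_Some_iff[OF assms] by (metis not_None_eq)

definition drop_at :: "'f::field system \<Rightarrow> nat \<Rightarrow> 'f system" where
  "drop_at T x = {c \<in> T. ld (pol c) \<noteq> x}"

lemma remove_at_eq:
  assumes "candidate n T"
  shows "remove_at (T, Q) x = (drop_at T x, Q)"
proof (cases "elem_at (T, Q) x")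
  case None
  then have "drop_at T x = T"
    using elem_at_eq_None_iff[OF assms, of Q x] by (auto simp: drop_at_def)
  with None show ?thesis by (simp add: remove_at_def)
next
  case (Some c)
  then have "c \<in> T" "ld (pol c) = x" using elem_at_eq_Some_iff[OF assms] by blast+
  then have "drop_at T x = T - {c}"
    using candidate_unique[OF assms] by (auto simp: drop_at_def)
  with Some show ?thesis by (simp add: remove_at_def)
qed

lemma candidate_subset: "candidate n T \<Longrightarrow> T' \<subseteq> T \<Longrightarrow> candidate n T'"
  unfolding candidate_def algebraic_system_def
  by (intro conjI) (auto intro: finite_subset inj_on_subset)

lemma candidate_drop_at: "candidate n T \<Longrightarrow> candidate n (drop_at T x)"
  by (rule candidate_subset) (auto simp: drop_at_def)

lemma candidate_insert_drop_at:
  assumes "candidate n T" "pol c \<in> poly_ring n" "ld (pol c) = x" "x > 0"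
  shows "candidate n (insert c (drop_at T x))"
  using candidate_drop_at[OF assms(1), of x] assms(2-4)
  by (auto simp: candidate_def algebraic_system_def inj_on_def drop_at_def)

definition eqs :: "'f::field system \<Rightarrow> 'f mpoly set" where
  "eqs T = {t. Equation t \<in> T}"

definition eq_deg :: "'f::field psys \<Rightarrow> nat \<Rightarrow> enat" where
  "eq_deg S y = (case elem_at S y of Some (Equation t) \<Rightarrow> enat (mdeg t) | _ \<Rightarrow> \<infinity>)"

lemma eq_deg_Equation:
  "candidate n T \<Longrightarrow> Equation t \<in> T \<Longrightarrow> ld t = y \<Longrightarrow> eq_deg (T, Q) y = enat (mdeg t)"
  using elem_at_eq_Some_iff[of n T Q y "Equation t"] by (simp add: eq_deg_def)

lemma eq_deg_infinity:
  assumes "candidate n T" "\<And>t. Equation t \<in> T \<Longrightarrow> ld t \<noteq> y"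
  shows "eq_deg (T, Q) y = \<infinity>"
  using assms(2) elem_at_eq_Some_iff[OF assms(1), of Q y]
  by (fastforce simp: eq_deg_def split: option.split constr.split)

lemma eq_deg_cong:
  assumes "candidate n T" "candidate n T'"
    and "\<And>t. ld t = y \<Longrightarrow> Equation t \<in> T \<longleftrightarrow> Equation t \<in> T'"
  shows "eq_deg (T, Q) y = eq_deg (T', Q') y"
proof (cases "\<exists>t. Equation t \<in> T \<and> ld t = y")
  case True
  then obtain t where "Equation t \<in> T" "ld t = y" by blast
  with assms show ?thesis by (simp add: eq_deg_Equation)
next
  case False
  with assms show ?thesis by (metis eq_deg_infinity)
qed

definition elem_ok :: "(nat \<Rightarrow> 'f alg_closure) \<Rightarrow> 'f::field mpoly constr \<Rightarrow> bool" where
  "elem_ok a c \<longleftrightarrow> phi a (init (pol c)) \<noteq> 0 \<and>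
     squarefree (phi_below (ld (pol c)) a (pol c))"

definition invariant :: "nat \<Rightarrow> 'f::field psys \<Rightarrow> bool" where
  "invariant n S \<longleftrightarrow> candidate n (fst S) \<and> algebraic_system n (snd S) \<and>
     (\<forall>c\<in>fst S. \<forall>a\<in>Sol n (sys_below (system_of S) (ld (pol c))). elem_ok a c)"

lemma invariant_simple_system:
  assumes "invariant n (T, {})"
  shows "simple_system n (system_of (T, {}))"
proof -
  have T: "candidate n T" and ok: "\<And>c a. c \<in> T \<Longrightarrow> a \<in> Sol n (sys_below T (ld (pol c))) \<Longrightarrow> elem_ok a c"
    using assms by (auto simp: invariant_def system_of_def)
  have "finite (sys_at T i)" for i
    using T by (simp add: candidate_def algebraic_system_def sys_at_def)
  moreover have "\<forall>c\<in>sys_at T i. \<forall>d\<in>sys_at T i. c = d" for i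
    using candidate_unique[OF T] by (simp add: sys_at_def)
  ultimately have "card (sys_at T i) \<le> 1" for i
    by (simp add: card_le_Suc0_iff_eq)
  with T ok show ?thesis
    by (auto simp: simple_system_def system_of_def triangular_def candidate_def sys_at_def
        nonvanishing_initials_def squarefree_system_def elem_ok_def)
qed

context pdiv_ring
begin

lemma reduce_eqs:
  assumes "candidate n T" "candidate n T'" "eqs T = eqs T'" "p \<in> poly_ring n"
  shows "reduce prem (T, Q) p = reduce prem (T', Q') p"
proof (rule reduce_cong)
  fix y t
  have "Equation t \<in> T \<longleftrightarrow> Equation t \<in> T'" using assms(3) by (auto simp: eqs_def)
  then show "elem_at (T, Q) y = Some (Equation t) \<longleftrightarrow> elem_at (T', Q') y = Some (Equation t)"
    by (simp add: elem_at_eq_Some_iff[OF assms(1)] elem_at_eq_Some_iff[OF assms(2)])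
qed (use assms in \<open>auto simp: candidate_def algebraic_system_def\<close>)

end

locale pdiv_case = pdiv_ring n prem pquo
  for n :: nat and prem pquo :: "'f::field_char_0 pdiv" +
  fixes T Q :: "'f system" and c :: "'f mpoly constr" and x :: nat
  assumes invariant: "invariant n (T, insert c Q)"
    and ld_c: "ld (pol c) = x" and x_pos: "x > 0"
    and reduced: "reduced prem (T, Q) (pol c)"
begin

abbreviation q :: "'f mpoly" where "q \<equiv> pol c"
abbreviation U :: "'f system" where "U \<equiv> T \<union> insert c Q"

lemma T: "candidate n T" and Q: "algebraic_system n Q" and q_n: "q \<in> poly_ring n"
  using invariant by (auto simp: invariant_def algebraic_system_def)

lemma T_poly_ring: "pol ` T \<subseteq> poly_ring n"
  using T by (simp add: candidate_def algebraic_system_def)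

lemma q_x: "q \<in> poly_ring x"
  using poly_ring_ld[OF q_n] ld_c by simp

lemma x_le: "x \<le> n"
  using ld_le[OF q_n] ld_c by simp

lemma poly_ring_n: "p \<in> poly_ring x \<Longrightarrow> p \<in> poly_ring n"
  using x_le poly_ring_mono by blast

lemma poly_ring_pred_n: "p \<in> poly_ring (x - 1) \<Longrightarrow> p \<in> poly_ring n"
  using x_le by (meson diff_le_self le_trans poly_ring_mono)

lemma poly_ring_pred_ld: "p \<in> poly_ring (x - 1) \<Longrightarrow> ld p < x"
  using ld_less x_pos by blast

lemma init_q: "init q \<in> poly_ring (x - 1)"
  using init_poly_ring[OF q_n] ld_c by simp

lemma reduce_init_q: "reduce prem (T, Q) (init q) \<noteq> Some 0"
  using reduced x_pos ld_c by (simp add: reduced_def)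

definition base :: "(nat \<Rightarrow> 'f alg_closure) \<Rightarrow> bool" where
  "base a \<longleftrightarrow> a \<in> {1..n} \<rightarrow>\<^sub>E UNIV \<and> sat a (sys_below (T \<union> Q) x)"

lemma base_elem_ok:
  assumes "base a" "d \<in> T" "ld (pol d) \<le> x"
  shows "elem_ok a d"
proof -
  have "a \<in> Sol n (sys_below (T \<union> insert c Q) (ld (pol d)))"
    using assms ld_c by (auto simp: Sol_iff_sat base_def sat_sys_below)
  with invariant assms(2) show ?thesis by (simp add: invariant_def system_of_def)
qed

lemma base_reduce:
  assumes "base a" "candidate n T'" "eqs T' = eqs T"
    and "p \<in> poly_ring (x - 1)" "reduce prem (T', Q') p = Some 0"
  shows "phi a p = 0"
proof -
  have p: "p \<in> poly_ring n" using assms(4) by (rule poly_ring_pred_n)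
  have "reduce prem (T, Q) p = Some 0" 
    using reduce_eqs[OF assms(2) T assms(3) p, of Q' Q] assms(5) by simp
  then have "phi a 0 = 0 \<longleftrightarrow> phi a p = 0"
  proof (rule phi_reduce_eq_0_iff[rotated 2])
    fix y t assume y: "y \<le> ld p" "elem_at (T, Q) y = Some (Equation t)"
    then have t: "Equation t \<in> T" "ld t = y" by (simp_all add: elem_at_eq_Some_iff[OF T])
    have "y < x" using y poly_ring_pred_ld[OF assms(4)] by simp
    then have "satisfies a (Equation t)" using assms(1) t by (force simp: base_def sat_sys_below)
    with base_elem_ok[OF assms(1) t(1)] t \<open>y < x\<close> show "phi a t = 0 \<and> phi a (init t) \<noteq> 0"
      by (simp add: elem_ok_def)
  qed (use T_poly_ring p in simp_all)
  then show ?thesis by simp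
qed

text \<open>
  The three ways in which a pass through the loop brings a system closer to being finished:
  the degree of an equation of the candidate drops (or an equation appears), a nontrivial
  equation of smaller leader enters the queue, or the inequation \<open>c\<close> is replaced by inequations
  of smaller leaders.
\<close>

definition progress :: "'f psys \<Rightarrow> bool" where
  "progress S' \<longleftrightarrow>
     (eq_deg S' x < eq_deg (T, Q) x \<and> (\<forall>y<x. eq_deg S' y = eq_deg (T, Q) y)) \<or>
     (eqs (fst S') = eqs T \<and>
       (\<exists>r. Equation r \<in> snd S' \<and> ld r < x \<and> reduce prem (T, Q) r \<noteq> Some 0)) \<or>
     (c = Inequation q \<and> eqs (fst S') = eqs T \<and>
       Q \<subseteq> snd S' \<and> snd S' \<subseteq> Q \<union> {Inequation p |p. ld p < x})"

lemma progress_eq_deg: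
  assumes "r \<in> poly_ring n" "ld r = x" "\<And>t. Equation t \<in> T \<Longrightarrow> ld t = x \<Longrightarrow> mdeg r < mdeg t"
  shows "progress (insert (Equation r) (drop_at T x), Q')"
proof -
  let ?T = "insert (Equation r) (drop_at T x)"
  have T': "candidate n ?T"
    using assms x_pos by (intro candidate_insert_drop_at T) auto
  have "eq_deg (?T, Q') x = enat (mdeg r)"
    by (rule eq_deg_Equation[OF T' _ assms(2)]) simp
  moreover have "enat (mdeg r) < eq_deg (T, Q) x"
  proof (cases "\<exists>t. Equation t \<in> T \<and> ld t = x")
    case True
    then show ?thesis using eq_deg_Equation[OF T] assms(3) by force
  next
    case False
    then show ?thesis using eq_deg_infinity[OF T] by auto
  qed
  moreover have "eq_deg (?T, Q') y = eq_deg (T, Q) y" if "y < x" for y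
    using that assms(2) by (intro eq_deg_cong[OF T' T]) (auto simp: drop_at_def)
  ultimately show ?thesis by (simp add: progress_def)
qed

definition branch :: "'f psys \<Rightarrow> ((nat \<Rightarrow> 'f alg_closure) \<Rightarrow> bool) \<Rightarrow> bool" where
  "branch S' P \<longleftrightarrow> invariant n S' \<and> progress S' \<and>
     (\<forall>a\<in>{1..n} \<rightarrow>\<^sub>E UNIV. sat a (system_of S') \<longleftrightarrow> sat a U \<and> P a)"

lemma branchI:
  assumes T': "candidate n T'" and Q': "algebraic_system n Q'" and progress: "progress (T', Q')"
    and lost: "\<And>d. d \<in> U \<Longrightarrow> d \<notin> T' \<union> Q' \<Longrightarrow> ld (pol d) = x"
    and sound: "\<And>a d. base a \<Longrightarrow> sat a (sys_below (T' \<union> Q') (Suc x)) \<Longrightarrow>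
      d \<in> U \<Longrightarrow> d \<notin> T' \<union> Q' \<Longrightarrow> satisfies a d"
    and new: "\<And>d. d \<in> T' \<Longrightarrow> d \<notin> T \<Longrightarrow> ld (pol d) = x"
      "\<And>d a. d \<in> T' \<Longrightarrow> d \<notin> T \<Longrightarrow> base a \<Longrightarrow> sat a (sys_below (T' \<union> Q') x) \<Longrightarrow> elem_ok a d"
    and cond: "\<And>a. base a \<Longrightarrow> sat a U \<Longrightarrow> P a \<longleftrightarrow> sat a (T' \<union> Q')"
  shows "branch (T', Q') P"
proof -
  let ?U' = "T' \<union> Q'"
  have base: "base a" if "a \<in> {1..n} \<rightarrow>\<^sub>E UNIV" "sat a (sys_below ?U' y)" "x \<le> y" for a y
    unfolding base_def sat_sys_below
  proof (intro conjI ballI impI)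
    fix d assume "d \<in> T \<union> Q" "ld (pol d) < x"
    with lost[of d] have "d \<in> ?U'" by auto
    with that \<open>ld (pol d) < x\<close> show "satisfies a d" by (simp add: sat_sys_below)
  qed fact
  have refine: "sat a (sys_below U y)" if a: "a \<in> {1..n} \<rightarrow>\<^sub>E UNIV" "sat a (sys_below ?U' y)" for a y
    unfolding sat_sys_below
  proof (intro ballI impI)
    fix d assume d: "d \<in> U" "ld (pol d) < y"
    show "satisfies a d"
    proof (cases "d \<in> ?U'")
      case True
      with a d show ?thesis by (simp add: sat_sys_below)
    next
      case False
      with lost d have "x < y" by blast
      then have "sat a (sys_below ?U' (Suc x))" using a(2) by (auto simp: sat_sys_below)
      with sound base[OF a] \<open>x < y\<close> d False show ?thesis by simp
    qed
  qed
  have "invariant n (T', Q')"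
    unfolding invariant_def fst_conv snd_conv system_of_def
  proof (intro conjI T' Q' ballI)
    fix d a assume d: "d \<in> T'" and "a \<in> Sol n (sys_below ?U' (ld (pol d)))"
    then have a: "a \<in> {1..n} \<rightarrow>\<^sub>E UNIV" "sat a (sys_below ?U' (ld (pol d)))"
      by (simp_all add: Sol_iff_sat)
    show "elem_ok a d"
    proof (cases "d \<in> T")
      case True
      with invariant refine[OF a] a(1) show ?thesis by (simp add: invariant_def system_of_def Sol_iff_sat)
    next
      case False
      with new(1) d have "ld (pol d) = x" by blast
      with new(2)[OF d False] base[OF a] a show ?thesis by simp
    qed
  qed
  moreover have "sat a ?U' \<longleftrightarrow> sat a U \<and> P a" if a: "a \<in> {1..n} \<rightarrow>\<^sub>E UNIV" for a
  proof
    assume sat: "sat a ?U'"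
    have "pol d \<in> poly_ring n" if "d \<in> U" for d
      using that T_poly_ring Q q_n by (auto simp: algebraic_system_def)
    then have "sys_below U (Suc n) = U"
      using ld_le by (auto simp: sys_below_def less_Suc_eq_le)
    moreover have "sat a (sys_below ?U' y)" for y using sat by (auto simp: sat_def sys_below_def)
    ultimately have "sat a U" using refine[OF a] by metis
    moreover have "base a" using base[OF a] sat by (auto simp: sat_def sys_below_def)
    ultimately show "sat a U \<and> P a" using cond sat by blast
  next
    assume sat: "sat a U \<and> P a"
    then have "base a" using a by (auto simp: base_def sat_def sys_below_def)
    with cond sat show "sat a ?U'" by blast
  qed
  ultimately show ?thesis using progress by (simp add: branch_def system_of_def)
qed

definition step :: "'f psys set \<Rightarrow> bool" where
  "step N \<longleftrightarrow> finite N \<and> (\<forall>S'\<in>N. invariant n S' \<and> progress S') \<and>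
     (\<forall>a\<in>{1..n} \<rightarrow>\<^sub>E UNIV. (\<forall>S'\<in>N. sat a (system_of S') \<longrightarrow> sat a U) \<and>
       (sat a U \<longrightarrow> (\<exists>!S'. S' \<in> N \<and> sat a (system_of S'))))"

lemma stepI:
  assumes "finite I" and branch: "\<And>i. i \<in> I \<Longrightarrow> branch (S i) (P i)"
    and ex: "\<And>a. \<exists>i\<in>I. P i a"
    and unique: "\<And>i j a. i \<in> I \<Longrightarrow> j \<in> I \<Longrightarrow> P i a \<Longrightarrow> P j a \<Longrightarrow> i = j"
  shows "step (S ` I)"
proof -
  have sat: "sat a (system_of (S i)) \<longleftrightarrow> sat a U \<and> P i a"
    if "i \<in> I" "a \<in> {1..n} \<rightarrow>\<^sub>E UNIV" for a i
    using branch that by (auto simp: branch_def)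
  moreover have "invariant n (S i) \<and> progress (S i)" if "i \<in> I" for i
    using branch that by (auto simp: branch_def)
  moreover have "\<exists>!S'. S' \<in> S ` I \<and> sat a (system_of S')"
    if a: "a \<in> {1..n} \<rightarrow>\<^sub>E UNIV" "sat a U" for a
  proof -
    obtain i where i: "i \<in> I" "P i a" using ex by blast
    show ?thesis
    proof (intro ex1I[of _ "S i"] conjI)
      show "S' = S i" if "S' \<in> S ` I \<and> sat a (system_of S')" for S'
        using that sat[OF _ a(1)] unique[OF _ i(1) _ i(2)] by blast
    qed (use sat[OF _ a(1)] i a(2) in auto)
  qed
  ultimately show ?thesis
    unfolding step_def using assms(1) by (intro conjI ballI impI) auto
qed

lemma stepI1: "branch A (\<lambda>a. True) \<Longrightarrow> step {A}"
  using stepI[of "{()}" "\<lambda>_. A" "\<lambda>_ _. True"] by simp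

lemma stepI2:
  assumes "branch A P" "branch B (\<lambda>a. \<not> P a)"
  shows "step {A, B}"
proof -
  have "step ((\<lambda>i. if i then A else B) ` UNIV)"
  proof (rule stepI[where P = "\<lambda>i a. P a = i"])
    show "branch (if i then A else B) (\<lambda>a. P a = i)" for i
      using assms by (cases i) simp_all
  qed auto
  then show ?thesis by (simp add: UNIV_bool insert_commute)
qed

lemma stepI4:
  assumes "branch A (\<lambda>a. P a \<and> R a \<and> W a)" "branch B (\<lambda>a. \<not> P a)"
    "branch C (\<lambda>a. P a \<and> \<not> R a)" "branch D (\<lambda>a. P a \<and> R a \<and> \<not> W a)"
  shows "step {A, B, C, D}"
proof -
  let ?S = "\<lambda>i::nat. if i = 0 then A else if i = 1 then B else if i = 2 then C else D"
  let ?P = "\<lambda>(i::nat) a. if i = 0 then P a \<and> R a \<and> W a else if i = 1 then \<not> P a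
    else if i = 2 then P a \<and> \<not> R a else P a \<and> R a \<and> \<not> W a"
  have "step (?S ` {0, 1, 2, 3})"
  proof (rule stepI[where P = ?P])
    show "\<exists>i\<in>{0, 1, 2, 3}. ?P i a" for a by auto
    show "i = j" if "i \<in> {0, 1, 2, 3}" "j \<in> {0, 1, 2, 3}" "?P i a" "?P j a" for i j a
      using that by (auto split: if_splits)
  qed (use assms in auto)
  then show ?thesis by (simp add: insert_commute)
qed

lemma stepI3:
  assumes "branch A (\<lambda>a. P a \<and> R a)" "branch B (\<lambda>a. \<not> P a)"
    "branch C (\<lambda>a. P a \<and> \<not> R a)"
  shows "step {A, B, C}"
proof -
  let ?S = "\<lambda>i::nat. if i = 0 then A else if i = 1 then B else C"
  let ?P = "\<lambda>(i::nat) a. if i = 0 then P a \<and> R a else if i = 1 then \<not> P a else P a \<and> \<not> R a"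
  have "step (?S ` {0, 1, 2})"
  proof (rule stepI[where P = ?P])
    show "\<exists>i\<in>{0, 1, 2}. ?P i a" for a by auto
    show "i = j" if "i \<in> {0, 1, 2}" "j \<in> {0, 1, 2}" "?P i a" "?P j a" for i j a
      using that by (auto split: if_splits)
  qed (use assms in auto)
  then show ?thesis by (simp add: insert_commute)
qed

end

subsection \<open>The four cases\<close>

context pdiv_case
begin

lemma algebraic_insert:
  "algebraic_system n (insert d A) \<longleftrightarrow> algebraic_system n A \<and> pol d \<in> poly_ring n"
  by (auto simp: algebraic_system_def)

lemma mdeg_eq: "ld p = x \<Longrightarrow> mdeg p = deg_in x p"
  by (simp add: mdeg_def)

lemma phi_root: "phi a p = 0 \<longleftrightarrow> poly (phi_below x a p) (a x) = 0"
  by (simp flip: phi_eq_poly)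

lemma unique_at: "d \<in> T \<Longrightarrow> e \<in> T \<Longrightarrow> ld (pol d) = x \<Longrightarrow> ld (pol e) = x \<Longrightarrow> d = e"
  using candidate_unique[OF T] by simp

lemma elem_at_x: "d \<in> T \<Longrightarrow> ld (pol d) = x \<Longrightarrow> elem_at (T, Q') x = Some d"
  using elem_at_eq_Some_iff[OF T] by simp

lemma T_elem:
  assumes "d \<in> T" "ld (pol d) = x"
  shows "pol d \<in> poly_ring n" "pol d \<in> poly_ring x"
  using T_poly_ring assms poly_ring_ld by fastforce+

lemma progress_equation:
  assumes "eqs T' = eqs T" "Equation r \<in> Q'" "r \<in> poly_ring (x - 1)" "reduce prem (T, Q) r \<noteq> Some 0"
  shows "progress (T', Q')"
  using assms poly_ring_pred_ld unfolding progress_def by auto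

lemma sat_drop_at: "sat a T \<Longrightarrow> sat a (drop_at T y)"
  by (auto simp: sat_def drop_at_def)

lemma branch_extend:
  assumes "T' \<subseteq> T" "T' \<union> Q' = U \<union> A" "algebraic_system n Q'" "progress (T', Q')"
    and "\<And>a. base a \<Longrightarrow> sat a U \<Longrightarrow> P a \<longleftrightarrow> sat a A"
  shows "branch (T', Q') P"
proof (rule branchI)
  show "candidate n T'" using T assms(1) by (rule candidate_subset)
  show "P a \<longleftrightarrow> sat a (T' \<union> Q')" if "base a" "sat a U" for a
    unfolding assms(2) assms(5)[OF that] using that(2) by simp
qed (use assms in auto)

lemma deg_less:
  assumes "Equation t \<in> T" "ld t = x"
  shows "deg_in x q < deg_in x t"
proof -
  have "\<not> reducible (T, Q) q" using reduced ld_c x_pos by (simp add: reduced_def)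
  then show ?thesis
    using elem_at_x[of "Equation t" Q] assms ld_c x_pos by (auto simp: reducible_def mdeg_eq not_le)
qed

lemma case1:
  assumes c: "c = Equation q" and t: "Equation t \<in> T" "ld t = x"
  shows "\<exists>N. case1 prem (T, Q) q = Some N \<and> step N"
proof -
  have t_n: "t \<in> poly_ring n" and t_x: "t \<in> poly_ring x" using T_elem[OF t(1)] t(2) by simp_all
  note deg = deg_less[OF t]
  have elem: "elem_at (T, Q) x = Some (Equation t)" using elem_at_x t by simp
  have init_t: "phi a (init t) \<noteq> 0" and sqf_t: "squarefree (phi_below x a t)" if "base a" for a
    using base_elem_ok[OF that t(1)] t(2) by (simp_all add: elem_ok_def)
  let ?r = "\<lambda>i. res t q x i"
  note r = res_poly_ring[OF t_x q_x x_pos deg]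
  have r_n: "?r i \<in> poly_ring n" for i using r by (rule poly_ring_pred_n)
  obtain r' where r': "reduce prem (T, Q) (?r 0) = Some r'"
    using reduce_neq_None[of "(T, Q)"] T_poly_ring r_n by force
  show ?thesis
  proof (cases "r' = 0")
    case False
    then have "case1 prem (T, Q) q = Some {(T, insert (Equation q) (insert (Equation (?r 0)) Q))}"
      using r' by (simp add: case1_def Let_def ld_c elem)
    moreover have "branch (T, insert (Equation q) (insert (Equation (?r 0)) Q)) (\<lambda>a. True)"
    proof (rule branch_extend[where A = "{Equation (?r 0)}"])
      show "T \<union> insert (Equation q) (insert (Equation (?r 0)) Q) = U \<union> {Equation (?r 0)}"
        using c by auto
      show "algebraic_system n (insert (Equation q) (insert (Equation (?r 0)) Q))"
        using Q q_n r_n by (simp add: algebraic_insert)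
      show "progress (T, insert (Equation q) (insert (Equation (?r 0)) Q))"
        using r r' False by (intro progress_equation[where r = "?r 0"]) auto
      show "True \<longleftrightarrow> sat a {Equation (?r 0)}" if "base a" "sat a U" for a
      proof -
        have "phi a (?r 0) = 0"
        proof (rule ccontr)
          assume "phi a (?r 0) \<noteq> 0"
          then have gcd: "is_gcd (phi_below x a (PRS t q x 0)) (phi_below x a t) (phi_below x a q)"
            "degree (phi_below x a (PRS t q x 0)) = 0"
            using phi_below_PRS[OF t_x q_x x_pos deg t(2) init_t[OF that(1)] le0] by simp_all
          have "satisfies a c" "satisfies a (Equation t)" using that(2) t(1) by (simp_all add: sat_def del: satisfies.simps)
          then have "phi a q = 0" "phi a t = 0" using c by (metis satisfies.simps(1))+
          then have "poly (phi_below x a (PRS t q x 0)) (a x) = 0"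
            using is_gcd_root_iff[OF gcd(1), of "a x"] by (simp add: phi_root)
          moreover obtain k where "phi_below x a (PRS t q x 0) = [:k:]"
            using gcd(2) degree_eq_zeroE by blast
          ultimately have "phi_below x a (PRS t q x 0) = 0" by simp
          then have "phi_below x a t = 0" using gcd(1) by (simp add: is_gcd_def)
          with sqf_t[OF that(1)] show False by simp
        qed
        then show ?thesis by (simp add: sat_def)
      qed
    qed simp
    ultimately show ?thesis using stepI1 by blast
  next
    case True
    obtain i where i: "res_split prem (T, Q) t q = Some (i, split (T, Q) (?r i))" "i \<le> deg_in x t"
      "reduce prem (T, Q) (?r i) \<noteq> Some 0" "?r i \<noteq> 0" "?r i \<in> poly_ring (x - 1)"
      "\<And>j. j < i \<Longrightarrow> reduce prem (T, Q) (?r j) = Some 0"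
      "\<And>j. reduce prem (T, Q) (?r j) \<noteq> Some 0 \<Longrightarrow> i \<le> j"
      using res_splitE[of "(T, Q)", OF _ t_n t(2) q_x x_pos deg] T_poly_ring by (metis fst_conv)
    let ?G = "PRS t q x i"
    have "i > 0" using i(3) r' True by (cases "i = 0") auto
    have "i \<le> deg_in x q"
      using i(7)[of "deg_in x q"] res_initial[OF t_x q_x ld_c x_pos deg] reduce_init_q by simp
    note G = PRS_regular[OF t_x q_x x_pos deg i(4) \<open>i > 0\<close>]
    have init_G: "init ?G = ?r i" using G(3) \<open>i \<le> deg_in x q\<close> deg by simp
    have G_n: "?G \<in> poly_ring n" using PRS_upoly(1)[OF t_x q_x x_pos deg] by (rule poly_ring_n)
    have gcd: "is_gcd (phi_below x a ?G) (phi_below x a t) (phi_below x a q)"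
      if "base a" "phi a (?r i) \<noteq> 0" for a
      using base_reduce[OF that(1) T refl r i(6)]
      by (intro phi_below_PRS[OF t_x q_x x_pos deg t(2) init_t[OF that(1)] i(2) that(2)])
    have root: "phi a ?G = 0 \<longleftrightarrow> phi a t = 0 \<and> phi a q = 0"
      if "base a" "phi a (?r i) \<noteq> 0" for a
      unfolding phi_root using is_gcd_root_iff[OF gcd[OF that]] .
    let ?A = "(insert (Equation ?G) (drop_at T x), insert (Inequation (?r i)) Q)"
    let ?B = "(T, insert (Equation q) (insert (Equation (?r i)) Q))"
    have "case1 prem (T, Q) q = Some {?A, ?B}"
      using r' True i(1) G(1) remove_at_eq[OF T, of "insert (Inequation (?r i)) Q" x]
      by (simp add: case1_def Let_def ld_c elem res_split_gcd_def Defs.split_def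
          insert_equation_def insert_elem_def)
    moreover have "branch ?A (\<lambda>a. phi a (?r i) \<noteq> 0)"
    proof (rule branchI)
      show "candidate n (insert (Equation ?G) (drop_at T x))"
        using G(1) G_n x_pos by (intro candidate_insert_drop_at[OF T]) simp_all
      show "algebraic_system n (insert (Inequation (?r i)) Q)"
        using Q r_n by (simp add: algebraic_insert)
      show "progress ?A"
      proof (rule progress_eq_deg[OF G_n G(1)])
        fix t' assume "Equation t' \<in> T" "ld t' = x"
        then have "t' = t" using unique_at[of "Equation t'" "Equation t"] t by simp
        then show "mdeg ?G < mdeg t'"
          using G(1,2) t(2) deg \<open>i \<le> deg_in x q\<close> by (simp add: mdeg_eq)
      qed
    next
      fix d assume d: "d \<in> U" "d \<notin> insert (Equation ?G) (drop_at T x) \<union> insert (Inequation (?r i)) Q"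
      then show ld_d: "ld (pol d) = x" using ld_c by (auto simp: drop_at_def)
      have d': "d = c \<or> d = Equation t"
        using d ld_d unique_at[of d "Equation t"] t by (auto simp: drop_at_def)
      fix a assume a: "base a"
        "sat a (sys_below (insert (Equation ?G) (drop_at T x) \<union> insert (Inequation (?r i)) Q) (Suc x))"
      then have "phi a (?r i) \<noteq> 0" "phi a ?G = 0"
        using G(1) poly_ring_pred_ld[OF i(5)] by (simp_all add: sat_sys_below)
      then have "phi a t = 0" "phi a q = 0" using root a(1) by blast+
      with d' c show "satisfies a d" by (metis satisfies.simps(1))
    next
      fix d assume d: "d \<in> insert (Equation ?G) (drop_at T x)" "d \<notin> T"
      then have d': "d = Equation ?G" by (auto simp: drop_at_def)
      then show "ld (pol d) = x" using G(1) by simp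
      fix a assume a: "base a"
        "sat a (sys_below (insert (Equation ?G) (drop_at T x) \<union> insert (Inequation (?r i)) Q) x)"
      then have "phi a (?r i) \<noteq> 0" using poly_ring_pred_ld[OF i(5)] by (simp add: sat_sys_below)
      then show "elem_ok a d"
        using gcd[OF a(1)] squarefree_mono[OF _ sqf_t[OF a(1)]] G(1)
        by (simp add: d' elem_ok_def init_G is_gcd_def)
    next
      fix a assume a: "base a" "sat a U"
      then have "satisfies a c" "satisfies a (Equation t)"
        using t(1) by (simp_all add: sat_def del: satisfies.simps)
      then have "phi a q = 0" "phi a t = 0" using c by (metis satisfies.simps(1))+
      then have "phi a (?r i) \<noteq> 0 \<Longrightarrow> phi a ?G = 0" using root[OF a(1)] by blast
      then show "phi a (?r i) \<noteq> 0 \<longleftrightarrow>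
          sat a (insert (Equation ?G) (drop_at T x) \<union> insert (Inequation (?r i)) Q)"
        using a(2) sat_drop_at by auto
    qed
    moreover have "branch ?B (\<lambda>a. \<not> phi a (?r i) \<noteq> 0)"
    proof (rule branch_extend[where A = "{Equation (?r i)}"])
      show "T \<union> insert (Equation q) (insert (Equation (?r i)) Q) = U \<union> {Equation (?r i)}"
        using c by auto
      show "algebraic_system n (insert (Equation q) (insert (Equation (?r i)) Q))"
        using Q q_n r_n by (simp add: algebraic_insert)
      show "progress ?B"
        using i(3,5) by (intro progress_equation[where r = "?r i"]) auto
    qed (simp_all add: sat_def)
    ultimately show ?thesis using stepI2 by blast
  qed
qed

lemma squarefree_splitE:
  assumes T': "candidate n T'" "eqs T' = eqs T"
  obtains r s where
    "res_split_squarefree prem pquo (T', Q') c =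
      Some ((T', insert (Inequation s) Q'), (T', insert c (insert (Equation s) Q')), r)"
    "s \<in> poly_ring (x - 1)" "reduce prem (T, Q) s \<noteq> Some 0" "r \<in> poly_ring x" "ld r = x"
    "\<And>a. base a \<Longrightarrow> phi a (init q) \<noteq> 0 \<Longrightarrow> phi a s \<noteq> 0 \<Longrightarrow>
      phi a (init r) \<noteq> 0 \<and> squarefree (phi_below x a r) \<and> (phi a r = 0 \<longleftrightarrow> phi a q = 0)"
proof -
  let ?q' = "partial_deriv x q"
  have d: "deg_in x q > 0" using ld_eq_iff[OF q_x x_pos] ld_c by blast
  note q' = partial_deriv_poly_ring[OF q_x x_pos]
  have deg: "deg_in x ?q' < deg_in x q" using d by (simp add: deg_in_partial_deriv)
  have T'_pr: "pol ` T' \<subseteq> poly_ring n" using T' by (simp add: candidate_def algebraic_system_def)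
  have red: "reduce prem (T', Q') p = reduce prem (T, Q) p" if "p \<in> poly_ring (x - 1)" for p
    using reduce_eqs[OF T'(1) T T'(2) poly_ring_pred_n[OF that]] .
  let ?r = "\<lambda>i. res q ?q' x i"
  obtain i where i: "res_split prem (T', Q') q ?q' = Some (i, split (T', Q') (?r i))"
    "i \<le> deg_in x q" "reduce prem (T', Q') (?r i) \<noteq> Some 0" "?r i \<noteq> 0" "?r i \<in> poly_ring (x - 1)"
    "\<And>j. j < i \<Longrightarrow> reduce prem (T', Q') (?r j) = Some 0"
    "\<And>j. reduce prem (T', Q') (?r j) \<noteq> Some 0 \<Longrightarrow> i \<le> j"
    using res_splitE[of "(T', Q')", OF _ q_n ld_c q' x_pos deg] T'_pr by (metis fst_conv)
  \<comment> \<open>The initial of \<open>q\<close> does not reduce to 0, hence neither does that of the derivative.  So the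
    quotient keeps a positive degree in \<open>x\<close>.\<close>
  have "reduce prem (T', Q') (?r (deg_in x q - 1)) \<noteq> Some 0"
  proof -
    obtain k where k: "k \<noteq> 0" "?r (deg_in x q - 1) = single 0 k * init q"
      using res_partial_deriv[OF q_x ld_c x_pos] by blast
    show ?thesis
      unfolding k(2) using reduce_init_q red[OF init_q]
        reduce_scale_eq_0_iff[of "(T', Q')" "init q" k] k(1) T'_pr poly_ring_pred_n[OF init_q] by simp
  qed
  then have "i \<le> deg_in x q - 1" by (rule i(7))
  then have "i < deg_in x q" using d by simp
  let ?g = "quotient q ?q' x i"
  note g = quotient_poly_ring[OF q_n ld_c q' x_pos deg i(2,4)]
  have ld_g: "ld ?g = x" using ld_eq_iff[OF g(1) x_pos] g(2) \<open>i < deg_in x q\<close> by simp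
  show thesis
  proof (rule that[of "?r i" ?g])
    show "res_split_squarefree prem pquo (T', Q') c =
        Some ((T', insert (Inequation (?r i)) Q'), (T', insert c (insert (Equation (?r i)) Q')), ?g)"
      using i(1) by (simp add: res_split_squarefree_def Let_def ld_c Defs.split_def quotient_def)
    show "reduce prem (T, Q) (?r i) \<noteq> Some 0" using i(3) red[OF i(5)] by simp
    fix a assume a: "base a" "phi a (init q) \<noteq> 0" "phi a (?r i) \<noteq> 0"
    have "phi a (?r j) = 0" if "j < i" for j
      using base_reduce[OF a(1) T' res_poly_ring[OF q_x q' x_pos deg] i(6)[OF that]] .
    from phi_below_quotient[OF q_n ld_c q' x_pos deg i(2) a(2,3) this] obtain e k where
      *: "is_gcd e (phi_below x a q) (phi_below x a ?q')" "k \<noteq> 0"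
      "smult k (phi_below x a q) = phi_below x a ?g * e"
      "phi a (lead_coeff (upoly x ?g)) \<noteq> 0" by metis
    have "degree (phi_below x a q) = deg_in x q"
      using a(2) ld_c by (intro degree_phi_below) (simp add: init_alt)
    then have "squarefree (phi_below x a ?g)"
      "poly (phi_below x a ?g) (a x) = 0 \<longleftrightarrow> poly (phi_below x a q) (a x) = 0"
      using squarefree_part_pderiv[OF _ *(1)[unfolded phi_below_partial_deriv] *(2,3)] d by simp_all
    with *(4) ld_g show "phi a (init ?g) \<noteq> 0 \<and> squarefree (phi_below x a ?g) \<and>
        (phi a ?g = 0 \<longleftrightarrow> phi a q = 0)"
      by (simp add: init_alt phi_root)
  qed (fact i(5) g(1) ld_g)+
qed

lemma quotient_neq_0:
  assumes "t \<in> poly_ring n" "ld t = x" "u \<in> poly_ring x" "deg_in x u < deg_in x t"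
    and "i \<le> deg_in x t" "res t u x i \<noteq> 0"
  shows "quotient t u x i \<noteq> 0"
proof (cases "i > 0")
  case True
  have t_x: "t \<in> poly_ring x" using poly_ring_ld[OF assms(1)] assms(2) by simp
  let ?G = "PRS t u x i"
  note G = PRS_regular[OF t_x assms(3) x_pos assms(4,6) True]
  have G_n: "?G \<in> poly_ring n" using PRS_upoly(1)[OF t_x assms(3) x_pos assms(4)] by (rule poly_ring_n)
  from pquo_degree[OF assms(1) G_n assms(2) G(1) x_pos] G(2) assms(5) obtain m k where
    m: "m dvd init ?G ^ k" "m * init t = lead_coeff (upoly x (pquo t ?G x)) * init ?G" by metis
  have "?G \<noteq> 0" using G(1) x_pos by auto
  then have "m \<noteq> 0" using m(1) by auto
  moreover have "t \<noteq> 0" using assms(2) x_pos by auto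
  ultimately have "pquo t ?G x \<noteq> 0" using m(2) by auto
  then show ?thesis using True by (simp add: quotient_def)
next
  case False
  then show ?thesis using assms(2) x_pos by (auto simp: quotient_def)
qed

lemma divide_splitE:
  assumes T': "candidate n T'" "eqs T' = eqs T"
    and d: "d \<in> T" "ld (pol d) = x" and u: "u \<in> poly_ring x" "ld u = x"
  obtains r s i where
    "res_split_divide prem pquo (T', Q') (pol d) (Inequation u) =
      Some ((T', insert (Inequation s) Q'), (T', insert (Inequation u) (insert (Equation s) Q')), r)"
    "s \<in> poly_ring (x - 1)" "reduce prem (T, Q) s \<noteq> Some 0" "r \<in> poly_ring x"
    "deg_in x r + i = deg_in x (pol d)" "i = 0 \<Longrightarrow> r = pol d" "r \<noteq> 0"
    "deg_in x u < deg_in x (pol d) \<Longrightarrow> reduce prem (T, Q) (init u) \<noteq> Some 0 \<Longrightarrow> i \<le> deg_in x u"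
    "\<And>a. base a \<Longrightarrow> phi a s \<noteq> 0 \<Longrightarrow> \<exists>e k. is_gcd e (phi_below x a (pol d)) (phi_below x a u) \<and>
      k \<noteq> 0 \<and> smult k (phi_below x a (pol d)) = phi_below x a r * e \<and>
      phi a (lead_coeff (upoly x r)) \<noteq> 0"
proof -
  define t where "t = pol d"
  have t_n: "t \<in> poly_ring n" and t_x: "t \<in> poly_ring x" and ld_t: "ld t = x"
    using T_elem[OF d] d(2) by (simp_all add: t_def)
  have u_n: "u \<in> poly_ring n" using u(1) by (rule poly_ring_n)
  define u' where "u' = (if mdeg t > mdeg u then u else prem u t x)"
  note prem_x = prem_poly_ring[OF u_n t_n u(2) ld_t x_pos]
  have u': "u' \<in> poly_ring x" using u(1) prem_x by (simp add: u'_def)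
  have deg: "deg_in x u' < deg_in x t" using prem_x u(2) ld_t by (simp add: u'_def mdeg_eq)
  have T'_pr: "pol ` T' \<subseteq> poly_ring n" using T' by (simp add: candidate_def algebraic_system_def)
  have red: "reduce prem (T', Q') p = reduce prem (T, Q) p" if "p \<in> poly_ring (x - 1)" for p
    using reduce_eqs[OF T'(1) T T'(2) poly_ring_pred_n[OF that]] .
  let ?r = "\<lambda>i. res t u' x i"
  obtain i where i: "res_split prem (T', Q') t u' = Some (i, split (T', Q') (?r i))"
    "i \<le> deg_in x t" "reduce prem (T', Q') (?r i) \<noteq> Some 0" "?r i \<noteq> 0" "?r i \<in> poly_ring (x - 1)"
    "\<And>j. j < i \<Longrightarrow> reduce prem (T', Q') (?r j) = Some 0"
    "\<And>j. reduce prem (T', Q') (?r j) \<noteq> Some 0 \<Longrightarrow> i \<le> j"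
    using res_splitE[of "(T', Q')", OF _ t_n ld_t u' x_pos deg] T'_pr by (metis fst_conv)
  let ?g = "quotient t u' x i"
  note g = quotient_poly_ring[OF t_n ld_t u' x_pos deg i(2,4)]
  show thesis
  proof (rule that[of "?r i" ?g i], unfold t_def[symmetric])
    show "res_split_divide prem pquo (T', Q') t (Inequation u) =
        Some ((T', insert (Inequation (?r i)) Q'), (T', insert (Inequation u) (insert (Equation (?r i)) Q')), ?g)"
      using i(1) unfolding u'_def
      by (simp add: res_split_divide_def Let_def ld_t Defs.split_def quotient_def)
    show "reduce prem (T, Q) (?r i) \<noteq> Some 0" using i(3) red[OF i(5)] by simp
    show "i = 0 \<Longrightarrow> ?g = t" by (simp add: quotient_def)
    show "?g \<noteq> 0" by (rule quotient_neq_0[OF t_n ld_t u' deg i(2,4)])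
    show "i \<le> deg_in x u"
      if less: "deg_in x u < deg_in x t" and init_u: "reduce prem (T, Q) (init u) \<noteq> Some 0"
    proof (rule i(7))
      have "u' = u" using less u(2) ld_t by (simp add: u'_def mdeg_eq)
      then have "?r (deg_in x u) = init u" using res_initial[OF t_x u x_pos less] by simp
      moreover have "init u \<in> poly_ring (x - 1)" using init_poly_ring[OF u_n] u(2) by simp
      ultimately show "reduce prem (T', Q') (?r (deg_in x u)) \<noteq> Some 0" using init_u red by simp
    qed
    fix a assume a: "base a" "phi a (?r i) \<noteq> 0"
    have init_t: "phi a (init t) \<noteq> 0"
      using base_elem_ok[OF a(1) d(1)] d(2) by (simp add: elem_ok_def t_def)
    have "phi a (?r j) = 0" if "j < i" for j
      using base_reduce[OF a(1) T' res_poly_ring[OF t_x u' x_pos deg] i(6)[OF that]] .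
    from phi_below_quotient[OF t_n ld_t u' x_pos deg i(2) init_t a(2) this] obtain e k where
      *: "is_gcd e (phi_below x a t) (phi_below x a u')" "k \<noteq> 0"
      "smult k (phi_below x a t) = phi_below x a ?g * e"
      "phi a (lead_coeff (upoly x ?g)) \<noteq> 0" by metis
    have "is_gcd e (phi_below x a t) (phi_below x a u)"
    proof (cases "mdeg t > mdeg u")
      case True
      with *(1) show ?thesis by (simp add: u'_def)
    next
      case False
      obtain m j where m: "m \<in> poly_ring (x - 1)" "m * u = pquo u t x * t + prem u t x"
        "m dvd init t ^ j"
        using pseudo_divisionE[OF u_n t_n u(2) ld_t x_pos] by metis
      obtain l where "init t ^ j = m * l" using m(3) by (rule dvdE)
      then have "phi a (init t) ^ j = phi a m * phi a l" by (metis phi.hom_power phi_mult)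
      with init_t have "phi a m \<noteq> 0" by auto
      have "phi_below x a (m * u) = phi_below x a (pquo u t x * t + prem u t x)" using m(2) by simp
      then have "smult (phi a m) (phi_below x a u) =
          phi_below x a (pquo u t x) * phi_below x a t + phi_below x a u'"
        using False by (simp add: phi_below_mult phi_below_add phi_below_coeff[OF m(1) x_pos] u'_def)
      then have "f dvd phi_below x a u' \<longleftrightarrow> f dvd phi_below x a u" if "f dvd phi_below x a t" for f
        using that \<open>phi a m \<noteq> 0\<close> by (metis dvd_add_right_iff dvd_mult dvd_smult_iff)
      with *(1) show ?thesis by (auto simp: is_gcd_def)
    qed
    with * show "\<exists>e k. is_gcd e (phi_below x a t) (phi_below x a u) \<and> k \<noteq> 0 \<and>
        smult k (phi_below x a t) = phi_below x a ?g * e \<and> phi a (lead_coeff (upoly x ?g)) \<noteq> 0"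
      by blast
  qed (fact i(5) g)+
qed

lemma drop_at_trivial: "(\<And>d. d \<in> T \<Longrightarrow> ld (pol d) \<noteq> x) \<Longrightarrow> drop_at T x = T"
  by (auto simp: drop_at_def)

lemma case2:
  assumes c: "c = Equation q" and no_eq: "\<And>t. Equation t \<in> T \<Longrightarrow> ld t \<noteq> x"
  shows "\<exists>N. case2 prem pquo (T, Q) q = Some N \<and> step N"
proof -
  define T1 where "T1 = drop_at T x"
  define Q1 where "Q1 = Q \<union> {d \<in> T. ld (pol d) = x}"
  have T1: "candidate n T1" unfolding T1_def using T by (rule candidate_drop_at)
  have eqs: "eqs T1 = eqs T" using no_eq by (auto simp: eqs_def T1_def drop_at_def)
  have Q1: "algebraic_system n Q1"
    using Q T by (auto simp: Q1_def algebraic_system_def candidate_def)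
  have move: "(case elem_at (T, Q) x of
      Some (Inequation t) \<Rightarrow> enqueue (Inequation t) (remove_at (T, Q) x) | _ \<Rightarrow> (T, Q)) = (T1, Q1)"
  proof (cases "elem_at (T, Q) x")
    case None
    then have "ld (pol d) \<noteq> x" if "d \<in> T" for d using elem_at_eq_None_iff[OF T] that by blast
    with None show ?thesis by (auto simp: T1_def Q1_def drop_at_def)
  next
    case (Some d)
    then have d: "d \<in> T" "ld (pol d) = x" using elem_at_eq_Some_iff[OF T] by blast+
    then obtain t where t: "d = Inequation t" using no_eq by (cases d) auto
    have "{d \<in> T. ld (pol d) = x} = {Inequation t}"
      using d t unique_at by auto
    with Some t show ?thesis by (simp add: T1_def Q1_def remove_at_eq[OF T])
  qed
  let ?I = "init q"
  let ?Q2 = "insert (Inequation ?I) Q1"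
  obtain r s where split:
    "res_split_squarefree prem pquo (T1, ?Q2) c =
      Some ((T1, insert (Inequation s) ?Q2), (T1, insert c (insert (Equation s) ?Q2)), r)"
    and s: "s \<in> poly_ring (x - 1)" "reduce prem (T, Q) s \<noteq> Some 0"
    and r: "r \<in> poly_ring x" "ld r = x"
    and sqf: "\<And>a. base a \<Longrightarrow> phi a ?I \<noteq> 0 \<Longrightarrow> phi a s \<noteq> 0 \<Longrightarrow>
      phi a (init r) \<noteq> 0 \<and> squarefree (phi_below x a r) \<and> (phi a r = 0 \<longleftrightarrow> phi a q = 0)"
    using squarefree_splitE[OF T1 eqs] by metis
  let ?A = "(insert (Equation r) T1, insert (Inequation s) ?Q2)"
  let ?B = "(T1, insert c (insert (Equation ?I) Q1))"
  let ?C = "(T1, insert c (insert (Equation s) ?Q2))"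
  have "drop_at T1 x = T1" by (auto simp: T1_def drop_at_def)
  then have insert: "insert_equation (T1, insert (Inequation s) ?Q2) r = ?A"
    using r(2) by (simp add: insert_equation_def insert_elem_def remove_at_eq[OF T1])
  have "case2 prem pquo (T, Q) q = Some {?A, ?B, ?C}"
    unfolding case2_def Let_def ld_c move
    using split insert c by (simp add: init_split_def Defs.split_def)
  moreover have U_eq: "T1 \<union> Q1 = T \<union> Q" by (auto simp: T1_def Q1_def drop_at_def)
  have satQ1: "sat a Q1" if "sat a U" for a
    using that U_eq by (metis sat_Un sat_insert Un_insert_right)
  have ld_s: "ld s < x" "ld ?I < x" using poly_ring_pred_ld s(1) init_q by auto
  have s_n: "s \<in> poly_ring n" "?I \<in> poly_ring n" using poly_ring_pred_n s(1) init_q by auto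
  have r_n: "r \<in> poly_ring n" using r(1) by (rule poly_ring_n)
  have "branch ?A (\<lambda>a. phi a ?I \<noteq> 0 \<and> phi a s \<noteq> 0)"
  proof (rule branchI)
    show "candidate n (insert (Equation r) T1)"
      unfolding T1_def using r r_n x_pos by (intro candidate_insert_drop_at[OF T]) simp_all
    show "algebraic_system n (insert (Inequation s) ?Q2)"
      using Q1 s_n by (simp add: algebraic_insert)
    show "progress ?A"
      unfolding T1_def using r_n r(2) no_eq by (intro progress_eq_deg) auto
  next
    fix d assume d: "d \<in> U" "d \<notin> insert (Equation r) T1 \<union> insert (Inequation s) ?Q2"
    then have d': "d = c" using U_eq by blast
    then show "ld (pol d) = x" using ld_c by simp
    fix a assume a: "base a"
      "sat a (sys_below (insert (Equation r) T1 \<union> insert (Inequation s) ?Q2) (Suc x))"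
    then have "phi a ?I \<noteq> 0" "phi a s \<noteq> 0" "phi a r = 0"
      using ld_s r(2) by (simp_all add: sat_sys_below)
    then have "phi a q = 0" using sqf a(1) by blast
    with d' c show "satisfies a d" by (metis satisfies.simps(1))
  next
    fix d assume d: "d \<in> insert (Equation r) T1" "d \<notin> T"
    then have d': "d = Equation r" by (auto simp: T1_def drop_at_def)
    then show "ld (pol d) = x" using r(2) by simp
    fix a assume a: "base a"
      "sat a (sys_below (insert (Equation r) T1 \<union> insert (Inequation s) ?Q2) x)"
    then have "phi a ?I \<noteq> 0" "phi a s \<noteq> 0" using ld_s by (simp_all add: sat_sys_below)
    then show "elem_ok a d" using sqf[OF a(1)] d' r(2) by (simp add: elem_ok_def)
  next
    fix a assume a: "base a" "sat a U"
    have "satisfies a c" using a(2) by simp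
    then have "phi a q = 0" using c by (metis satisfies.simps(1))
    moreover have "sat a T1" using a(2) sat_drop_at by (simp add: T1_def)
    ultimately show "phi a ?I \<noteq> 0 \<and> phi a s \<noteq> 0 \<longleftrightarrow>
        sat a (insert (Equation r) T1 \<union> insert (Inequation s) ?Q2)"
      using sqf[OF a(1)] satQ1[OF a(2)] by auto
  qed
  moreover have "branch ?B (\<lambda>a. \<not> phi a ?I \<noteq> 0)"
  proof (rule branch_extend[where A = "{Equation ?I}"])
    show "T1 \<union> insert c (insert (Equation ?I) Q1) = U \<union> {Equation ?I}" using U_eq by auto
    show "algebraic_system n (insert c (insert (Equation ?I) Q1))"
      using Q1 q_n s_n by (simp add: algebraic_insert)
    show "progress ?B"
      using eqs init_q reduce_init_q by (intro progress_equation[where r = ?I]) auto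
  qed (auto simp: sat_def T1_def drop_at_def)
  moreover have "branch ?C (\<lambda>a. phi a ?I \<noteq> 0 \<and> \<not> phi a s \<noteq> 0)"
  proof (rule branch_extend[where A = "{Equation s, Inequation ?I}"])
    show "T1 \<union> insert c (insert (Equation s) ?Q2) = U \<union> {Equation s, Inequation ?I}"
      using U_eq by auto
    show "algebraic_system n (insert c (insert (Equation s) ?Q2))"
      using Q1 q_n s_n by (simp add: algebraic_insert)
    show "progress ?C"
      using eqs s by (intro progress_equation[where r = s]) auto
  qed (auto simp: sat_def T1_def drop_at_def)
  ultimately show ?thesis
    using stepI3[of ?A "\<lambda>a. phi a ?I \<noteq> 0" "\<lambda>a. phi a s \<noteq> 0" ?B ?C] by blast
qed

lemma case3:
  assumes c: "c = Inequation q" and t: "Equation t \<in> T" "ld t = x"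
  shows "\<exists>N. case3 prem pquo (T, Q) q = Some N \<and> step N"
proof -
  have elem: "elem_at (T, Q') x = Some (Equation t)" for Q' using elem_at_x t by simp
  have t_x: "t \<in> poly_ring x" using T_elem[OF t(1)] t(2) by simp
  note deg = deg_less[OF t]
  have ok: "elem_ok a (Equation t)" if "base a" for a
    using base_elem_ok[OF that t(1)] t(2) by simp
  obtain r s i where split: "res_split_divide prem pquo (T, Q) t (Inequation q) =
      Some ((T, insert (Inequation s) Q), (T, insert (Inequation q) (insert (Equation s) Q)), r)"
    and s: "s \<in> poly_ring (x - 1)" "reduce prem (T, Q) s \<noteq> Some 0"
    and r: "r \<in> poly_ring x" "deg_in x r + i = deg_in x t" "i = 0 \<Longrightarrow> r = t" "i \<le> deg_in x q"
    and gcd: "\<And>a. base a \<Longrightarrow> phi a s \<noteq> 0 \<Longrightarrow>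
      \<exists>e k. is_gcd e (phi_below x a t) (phi_below x a q) \<and>
      k \<noteq> 0 \<and> smult k (phi_below x a t) = phi_below x a r * e \<and>
      phi a (lead_coeff (upoly x r)) \<noteq> 0"
    using divide_splitE[OF T refl t(1) _ q_x ld_c, of Q thesis] t(2) deg reduce_init_q
    by simp
  have ld_r: "ld r = x" using ld_eq_iff[OF r(1) x_pos] r(2,4) deg by simp
  have ld_s: "ld s < x" and s_n: "s \<in> poly_ring n"
    using poly_ring_pred_ld poly_ring_pred_n s(1) by auto
  have r_n: "r \<in> poly_ring n" using r(1) by (rule poly_ring_n)
  have sqf: "elem_ok a (Equation r)" "phi a r = 0 \<longleftrightarrow> phi a t = 0 \<and> phi a q \<noteq> 0"
    if a: "base a" "phi a s \<noteq> 0" for a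
  proof -
    from gcd[OF a] obtain e k where *: "is_gcd e (phi_below x a t) (phi_below x a q)" "k \<noteq> 0"
      "smult k (phi_below x a t) = phi_below x a r * e" "phi a (lead_coeff (upoly x r)) \<noteq> 0"
      by blast
    have "squarefree (phi_below x a t)" using ok[OF a(1)] t(2) by (simp add: elem_ok_def)
    note q = squarefree_quotient[OF this *(1-3)]
    show "phi a r = 0 \<longleftrightarrow> phi a t = 0 \<and> phi a q \<noteq> 0" unfolding phi_root by (rule q(2))
    show "elem_ok a (Equation r)" using q(1) *(4) ld_r by (simp add: elem_ok_def init_alt)
  qed
  let ?A = "(insert (Equation r) (drop_at T x), insert (Inequation s) Q)"
  let ?B = "(T, insert (Inequation q) (insert (Equation s) Q))"
  have "case3 prem pquo (T, Q) q = Some {?A, ?B}"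
    using split ld_r
    by (simp add: case3_def ld_c elem insert_equation_def insert_elem_def remove_at_eq[OF T])
  moreover have "branch ?A (\<lambda>a. phi a s \<noteq> 0)"
  proof (rule branchI)
    show "candidate n (insert (Equation r) (drop_at T x))"
      using ld_r r_n x_pos by (intro candidate_insert_drop_at[OF T]) simp_all
    show "algebraic_system n (insert (Inequation s) Q)"
      using Q s_n by (simp add: algebraic_insert)
    have t': "t' = t" if "Equation t' \<in> T" "ld t' = x" for t'
      using unique_at[of "Equation t'" "Equation t"] t that by simp
    show "progress ?A"
    proof (cases "i = 0")
      case True
      have "d = Equation t" if "d \<in> T" "ld (pol d) = x" for d
        using unique_at[OF that(1) t(1)] that(2) t(2) by simp
      then have "insert (Equation t) (drop_at T x) = T"
        using t(1) by (auto simp: drop_at_def)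
      then have "insert (Equation r) (drop_at T x) = T" using r(3) True by simp
      then show ?thesis unfolding progress_def using ld_s c by auto
    next
      case False
      then show ?thesis
        using t' r(2) ld_r t(2) by (intro progress_eq_deg[OF r_n ld_r]) (auto simp: mdeg_eq)
    qed
  next
    fix d assume d: "d \<in> U" "d \<notin> insert (Equation r) (drop_at T x) \<union> insert (Inequation s) Q"
    then show ld_d: "ld (pol d) = x" using ld_c by (auto simp: drop_at_def)
    have d': "d = c \<or> d = Equation t"
      using d ld_d unique_at[of d "Equation t"] t by (auto simp: drop_at_def)
    fix a assume a: "base a"
      "sat a (sys_below (insert (Equation r) (drop_at T x) \<union> insert (Inequation s) Q) (Suc x))"
    then have "phi a s \<noteq> 0" "phi a r = 0"
      using ld_r ld_s by (simp_all add: sat_sys_below)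
    then have "phi a t = 0" "phi a q \<noteq> 0" using sqf(2) a(1) by blast+
    with d' c show "satisfies a d" by (metis satisfies.simps)
  next
    fix d assume d: "d \<in> insert (Equation r) (drop_at T x)" "d \<notin> T"
    then have d': "d = Equation r" by (auto simp: drop_at_def)
    then show "ld (pol d) = x" using ld_r by simp
    fix a assume a: "base a"
      "sat a (sys_below (insert (Equation r) (drop_at T x) \<union> insert (Inequation s) Q) x)"
    then have "phi a s \<noteq> 0" using ld_s by (simp add: sat_sys_below)
    then show "elem_ok a d" using sqf(1) a(1) d' by simp
  next
    fix a assume a: "base a" "sat a U"
    then have "satisfies a c" "satisfies a (Equation t)"
      using t(1) sat_memD[OF a(2)] by (simp_all del: satisfies.simps)
    then have "phi a q \<noteq> 0" "phi a t = 0" using c by (metis satisfies.simps)+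
    then show "phi a s \<noteq> 0 \<longleftrightarrow>
        sat a (insert (Equation r) (drop_at T x) \<union> insert (Inequation s) Q)"
      using sqf(2)[OF a(1)] a(2) sat_drop_at by auto
  qed
  moreover have "branch ?B (\<lambda>a. \<not> phi a s \<noteq> 0)"
  proof (rule branch_extend[where A = "{Equation s}"])
    show "T \<union> insert (Inequation q) (insert (Equation s) Q) = U \<union> {Equation s}"
      using c by auto
    show "algebraic_system n (insert (Inequation q) (insert (Equation s) Q))"
      using Q q_n s_n by (simp add: algebraic_insert)
    show "progress ?B"
      using s by (intro progress_equation[where r = s]) auto
  qed (simp_all add: sat_def)
  ultimately show ?thesis using stepI2 by blast
qed

lemma case4:
  assumes c: "c = Inequation q" and no_eq: "\<And>t. Equation t \<in> T \<Longrightarrow> ld t \<noteq> x"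
  shows "\<exists>N. case4 prem pquo (T, Q) q = Some N \<and> step N"
proof -
  let ?I = "init q"
  let ?Q2 = "insert (Inequation ?I) Q"
  obtain p s where split:
    "res_split_squarefree prem pquo (T, ?Q2) c =
      Some ((T, insert (Inequation s) ?Q2), (T, insert c (insert (Equation s) ?Q2)), p)"
    and s: "s \<in> poly_ring (x - 1)" "reduce prem (T, Q) s \<noteq> Some 0"
    and p: "p \<in> poly_ring x" "ld p = x"
    and sqf: "\<And>a. base a \<Longrightarrow> phi a ?I \<noteq> 0 \<Longrightarrow> phi a s \<noteq> 0 \<Longrightarrow>
      phi a (init p) \<noteq> 0 \<and> squarefree (phi_below x a p) \<and> (phi a p = 0 \<longleftrightarrow> phi a q = 0)"
    using squarefree_splitE[OF T refl] by metis
  let ?Q3 = "insert (Inequation s) ?Q2"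
  let ?B = "(T, insert c (insert (Equation ?I) Q))"
  let ?C = "(T, insert c (insert (Equation s) ?Q2))"
  have ld_s: "ld s < x" "ld ?I < x" using poly_ring_pred_ld s(1) init_q by auto
  have s_n: "s \<in> poly_ring n" "?I \<in> poly_ring n" using poly_ring_pred_n s(1) init_q by auto
  have p_n: "p \<in> poly_ring n" using p(1) by (rule poly_ring_n)
  have Q3: "algebraic_system n ?Q3" using Q s_n by (simp add: algebraic_insert)
  have q_sat: "phi a q \<noteq> 0" if "sat a U" for a
  proof -
    have "satisfies a c" using that by simp
    then show ?thesis using c by (metis satisfies.simps(2))
  qed
  have B: "branch ?B (\<lambda>a. \<not> phi a ?I \<noteq> 0)"
  proof (rule branch_extend[where A = "{Equation ?I}"])
    show "algebraic_system n (insert c (insert (Equation ?I) Q))"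
      using Q q_n s_n by (simp add: algebraic_insert)
    show "progress ?B"
      using init_q reduce_init_q by (intro progress_equation[where r = ?I]) auto
  qed (auto simp: sat_def)
  have C: "branch ?C (\<lambda>a. phi a ?I \<noteq> 0 \<and> \<not> phi a s \<noteq> 0)"
  proof (rule branch_extend[where A = "{Equation s, Inequation ?I}"])
    show "algebraic_system n (insert c (insert (Equation s) ?Q2))"
      using Q q_n s_n by (simp add: algebraic_insert)
    show "progress ?C" using s by (intro progress_equation[where r = s]) auto
  qed (auto simp: sat_def)
  have split': "init_split (T, Q) (Inequation q) = ((T, ?Q2), ?B)"
    using c by (simp add: init_split_def Defs.split_def)
  show ?thesis
  proof (cases "elem_at (T, ?Q3) x")
    case None
    then have none: "ld (pol d) \<noteq> x" if "d \<in> T" for d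
      using elem_at_eq_None_iff[OF T] that by blast
    let ?A = "(insert (Inequation p) T, ?Q3)"
    have "case4 prem pquo (T, Q) q = Some {?A, ?B, ?C}"
      unfolding case4_def Let_def ld_c split'
      using split c None by (simp add: insert_elem_def)
    moreover have "branch ?A (\<lambda>a. phi a ?I \<noteq> 0 \<and> phi a s \<noteq> 0)"
    proof (rule branchI[OF _ Q3])
      show "candidate n (insert (Inequation p) T)"
        using candidate_insert_drop_at[OF T, of "Inequation p" x] p p_n x_pos none
        by (simp add: drop_at_trivial)
      show "progress ?A" unfolding progress_def using ld_s c by (auto simp: eqs_def)
    next
      fix d assume d: "d \<in> U" "d \<notin> insert (Inequation p) T \<union> ?Q3"
      then have d': "d = c" by blast
      then show "ld (pol d) = x" using ld_c by simp
      fix a assume a: "base a" "sat a (sys_below (insert (Inequation p) T \<union> ?Q3) (Suc x))"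
      then have "phi a ?I \<noteq> 0" "phi a s \<noteq> 0" "phi a p \<noteq> 0"
        using ld_s p(2) by (simp_all add: sat_sys_below)
      then have "phi a q \<noteq> 0" using sqf a(1) by blast
      with d' c show "satisfies a d" by (metis satisfies.simps(2))
    next
      fix d assume d: "d \<in> insert (Inequation p) T" "d \<notin> T"
      then have d': "d = Inequation p" by auto
      then show "ld (pol d) = x" using p(2) by simp
      fix a assume a: "base a" "sat a (sys_below (insert (Inequation p) T \<union> ?Q3) x)"
      then have "phi a ?I \<noteq> 0" "phi a s \<noteq> 0" using ld_s by (simp_all add: sat_sys_below)
      then show "elem_ok a d" using sqf[OF a(1)] d' p(2) by (simp add: elem_ok_def)
    next
      fix a assume a: "base a" "sat a U"
      then show "phi a ?I \<noteq> 0 \<and> phi a s \<noteq> 0 \<longleftrightarrow> sat a (insert (Inequation p) T \<union> ?Q3)"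
        using sqf[OF a(1)] q_sat[OF a(2)] by auto
    qed
    ultimately show ?thesis
      using stepI3[of ?A "\<lambda>a. phi a ?I \<noteq> 0" "\<lambda>a. phi a s \<noteq> 0", OF _ B C] by blast
  next
    case (Some d)
    then have d: "d \<in> T" "ld (pol d) = x" using elem_at_eq_Some_iff[OF T] by blast+
    then obtain t where t: "d = Inequation t" using no_eq by (cases d) auto
    have ld_t: "ld t = x" using d t by simp
    have t_x: "t \<in> poly_ring x" using T_elem[OF d] t by simp
    obtain r w where div: "res_split_divide prem pquo (T, ?Q3) t (Inequation p) =
        Some ((T, insert (Inequation w) ?Q3), (T, insert (Inequation p) (insert (Equation w) ?Q3)), r)"
      and w: "w \<in> poly_ring (x - 1)" "reduce prem (T, Q) w \<noteq> Some 0"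
      and r: "r \<in> poly_ring x" "r \<noteq> 0"
      and gcd: "\<And>a. base a \<Longrightarrow> phi a w \<noteq> 0 \<Longrightarrow>
        \<exists>e k. is_gcd e (phi_below x a t) (phi_below x a p) \<and>
        k \<noteq> 0 \<and> smult k (phi_below x a t) = phi_below x a r * e \<and>
        phi a (lead_coeff (upoly x r)) \<noteq> 0"
      using divide_splitE[OF T refl d p, of ?Q3 thesis] t by simp
    have ld_w: "ld w < x" and w_n: "w \<in> poly_ring n"
      using poly_ring_pred_ld poly_ring_pred_n w(1) by auto
    have rp: "r * p \<in> poly_ring x" using r(1) p(1) by (rule poly_ring_mult)
    have rp_n: "r * p \<in> poly_ring n" using rp by (rule poly_ring_n)
    have "p \<noteq> 0" using p(2) x_pos by auto
    then have "deg_in x (r * p) > 0"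
      using deg_in_mult[OF r(2), of p x] ld_eq_iff[OF p(1) x_pos] p(2) by simp
    then have ld_rp: "ld (r * p) = x" using ld_eq_iff[OF rp x_pos] by simp
    have ok: "elem_ok a (Inequation (r * p))" "phi a (r * p) = 0 \<longleftrightarrow> phi a t = 0 \<or> phi a q = 0"
      if a: "base a" "phi a ?I \<noteq> 0" "phi a s \<noteq> 0" "phi a w \<noteq> 0" for a
    proof -
      from gcd[OF a(1,4)] obtain e k where
        *: "is_gcd e (phi_below x a t) (phi_below x a p)" "k \<noteq> 0"
        "smult k (phi_below x a t) = phi_below x a r * e" "phi a (lead_coeff (upoly x r)) \<noteq> 0"
        by blast
      have "squarefree (phi_below x a t)"
        using base_elem_ok[OF a(1) d(1)] d(2) t by (simp add: elem_ok_def)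
      note lcm = squarefree_lcm[OF this conjunct1[OF conjunct2[OF sqf[OF a(1-3)]]] *(1-3)]
      show "phi a (r * p) = 0 \<longleftrightarrow> phi a t = 0 \<or> phi a q = 0"
        using lcm(2)[of "a x"] sqf[OF a(1-3)] by (simp add: phi_root phi_below_mult)
      have "init (r * p) = lead_coeff (upoly x r) * init p"
        using ld_rp p(2) by (simp add: init_alt lead_coeff_mult)
      then show "elem_ok a (Inequation (r * p))"
        using lcm(1) *(4) sqf[OF a(1-3)] ld_rp by (simp add: elem_ok_def phi_below_mult)
    qed
    let ?Q4 = "insert (Inequation w) ?Q3"
    let ?A = "(insert (Inequation (r * p)) (drop_at T x), ?Q4)"
    let ?D = "(T, insert (Inequation p) (insert (Equation w) ?Q3))"
    have "case4 prem pquo (T, Q) q = Some {?A, ?B, ?C, ?D}"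
      unfolding case4_def Let_def ld_c split'
      using split c Some t div by (simp add: insert_elem_def remove_at_eq[OF T])
    moreover have "branch ?A (\<lambda>a. phi a ?I \<noteq> 0 \<and> phi a s \<noteq> 0 \<and> phi a w \<noteq> 0)"
    proof (rule branchI)
      show "candidate n (insert (Inequation (r * p)) (drop_at T x))"
        using ld_rp rp_n x_pos by (intro candidate_insert_drop_at[OF T]) simp_all
      show "algebraic_system n ?Q4" using Q3 w_n by (simp add: algebraic_insert)
      have "eqs (insert (Inequation (r * p)) (drop_at T x)) = eqs T"
        using no_eq by (auto simp: eqs_def drop_at_def)
      then show "progress ?A" unfolding progress_def using ld_s ld_w c by auto
    next
      fix d' assume d': "d' \<in> U" "d' \<notin> insert (Inequation (r * p)) (drop_at T x) \<union> ?Q4"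
      then show ld_d: "ld (pol d') = x" using ld_c by (auto simp: drop_at_def)
      have d'': "d' = c \<or> d' = Inequation t"
        using d' ld_d unique_at[of d' d] d t by (auto simp: drop_at_def)
      fix a assume a: "base a"
        "sat a (sys_below (insert (Inequation (r * p)) (drop_at T x) \<union> ?Q4) (Suc x))"
      then have *: "phi a ?I \<noteq> 0" "phi a s \<noteq> 0" "phi a w \<noteq> 0" and "phi a (r * p) \<noteq> 0"
        using ld_s ld_w ld_rp by (simp_all add: sat_sys_below del: phi_mult)
      then have "phi a t \<noteq> 0" "phi a q \<noteq> 0" using ok(2)[OF a(1) *] by blast+
      with d'' c show "satisfies a d'" by (metis satisfies.simps(2))
    next
      fix d' assume d': "d' \<in> insert (Inequation (r * p)) (drop_at T x)" "d' \<notin> T"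
      then have d'': "d' = Inequation (r * p)" by (auto simp: drop_at_def)
      then show "ld (pol d') = x" using ld_rp by simp
      fix a assume a: "base a"
        "sat a (sys_below (insert (Inequation (r * p)) (drop_at T x) \<union> ?Q4) x)"
      then have *: "phi a ?I \<noteq> 0" "phi a s \<noteq> 0" "phi a w \<noteq> 0"
        using ld_s ld_w by (simp_all add: sat_sys_below)
      show "elem_ok a d'" unfolding d'' by (rule ok(1)[OF a(1) *])
    next
      fix a assume a: "base a" "sat a U"
      have "satisfies a (Inequation t)"
        using a(2) d(1) t sat_memD[OF a(2)] by (simp del: satisfies.simps)
      then have "phi a t \<noteq> 0" by simp
      then have "phi a ?I \<noteq> 0 \<Longrightarrow> phi a s \<noteq> 0 \<Longrightarrow> phi a w \<noteq> 0 \<Longrightarrow> phi a (r * p) \<noteq> 0"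
        using ok(2)[OF a(1)] q_sat[OF a(2)] by blast
      moreover have "sat a (drop_at T x)" using a(2) sat_drop_at by simp
      ultimately show "phi a ?I \<noteq> 0 \<and> phi a s \<noteq> 0 \<and> phi a w \<noteq> 0 \<longleftrightarrow>
          sat a (insert (Inequation (r * p)) (drop_at T x) \<union> ?Q4)"
        using a(2) by (auto simp del: phi_mult)
    qed
    moreover have "branch ?D (\<lambda>a. phi a ?I \<noteq> 0 \<and> phi a s \<noteq> 0 \<and> \<not> phi a w \<noteq> 0)"
    proof (rule branchI[OF T])
      show "algebraic_system n (insert (Inequation p) (insert (Equation w) ?Q3))"
        using Q3 w_n p_n by (simp add: algebraic_insert)
      show "progress ?D" using w by (intro progress_equation[where r = w]) auto
    next
      fix d' assume d': "d' \<in> U" "d' \<notin> T \<union> insert (Inequation p) (insert (Equation w) ?Q3)"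
      then have d'': "d' = c" by blast
      then show "ld (pol d') = x" using ld_c by simp
      fix a assume a: "base a"
        "sat a (sys_below (T \<union> insert (Inequation p) (insert (Equation w) ?Q3)) (Suc x))"
      then have "phi a ?I \<noteq> 0" "phi a s \<noteq> 0" "phi a p \<noteq> 0"
        using ld_s p(2) by (simp_all add: sat_sys_below)
      then have "phi a q \<noteq> 0" using sqf a(1) by blast
      with d'' c show "satisfies a d'" by (metis satisfies.simps(2))
    next
      fix a assume a: "base a" "sat a U"
      then show "phi a ?I \<noteq> 0 \<and> phi a s \<noteq> 0 \<and> \<not> phi a w \<noteq> 0 \<longleftrightarrow>
          sat a (T \<union> insert (Inequation p) (insert (Equation w) ?Q3))"
        using sqf[OF a(1)] q_sat[OF a(2)] by auto
    qed simp_all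
    ultimately show ?thesis
      using stepI4[of ?A "\<lambda>a. phi a ?I \<noteq> 0" "\<lambda>a. phi a s \<noteq> 0" "\<lambda>a. phi a w \<noteq> 0", OF _ B C]
      by blast
  qed
qed

end

subsection \<open>The main loop\<close>

context pdiv_ring
begin

context
  fixes T Q :: "'f system" and c c' :: "'f mpoly constr" and q :: "'f mpoly"
  assumes inv: "invariant n (T, insert c Q)"
    and red: "reduce prem (T, Q) (pol c) = Some q"
    and c': "c' = map_constr (\<lambda>_. q) c"
begin

lemma reduce_constr:
  shows "pol c' = q" "q \<in> poly_ring n" "ld q \<le> ld (pol c)" "reduced prem (T, Q) q"
proof -
  have "pol ` T \<subseteq> poly_ring n" "pol c \<in> poly_ring n"
    using inv by (auto simp: invariant_def candidate_def algebraic_system_def)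
  from reduceE[of "(T, Q)", OF _ this(2)] this(1) red
  show "q \<in> poly_ring n" "ld q \<le> ld (pol c)" "reduced prem (T, Q) q" by force+
  show "pol c' = q" using c' by (cases c) simp_all
qed

lemma satisfies_reduce:
  assumes a: "a \<in> {1..n} \<rightarrow>\<^sub>E UNIV" "sat a (sys_below (T \<union> Q) (Suc (ld (pol c))))"
  shows "satisfies a c' \<longleftrightarrow> satisfies a c"
proof -
  have T: "candidate n T" and c_n: "pol c \<in> poly_ring n"
    using inv by (auto simp: invariant_def algebraic_system_def)
  have T_n: "pol ` T \<subseteq> poly_ring n" using T by (simp add: candidate_def algebraic_system_def)
  have "phi a q = 0 \<longleftrightarrow> phi a (pol c) = 0"
  proof (rule phi_reduce_eq_0_iff[of "(T, Q)", OF _ c_n red])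
    fix y t assume y: "y \<le> ld (pol c)" "elem_at (T, Q) y = Some (Equation t)"
    then have t: "Equation t \<in> T" "ld t = y" by (simp_all add: elem_at_eq_Some_iff[OF T])
    then have "satisfies a (Equation t)"
      using a(2) y(1) unfolding sat_sys_below by (metis UnI1 constr.sel(1) less_Suc_eq_le)
    moreover have "a \<in> Sol n (sys_below (T \<union> insert c Q) (ld t))"
      using a y t by (auto simp: Sol_iff_sat sat_sys_below)
    then have "elem_ok a (Equation t)"
      using inv t(1) by (auto simp: invariant_def system_of_def)
    ultimately show "phi a t = 0 \<and> phi a (init t) \<noteq> 0" by (simp add: elem_ok_def)
  qed (use T_n in simp)
  then show ?thesis using c' by (cases c) simp_all
qed

lemma sat_below_reduce:
  assumes "a \<in> {1..n} \<rightarrow>\<^sub>E UNIV" "sat a (sys_below (T \<union> insert c' Q) y)"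
  shows "sat a (sys_below (T \<union> insert c Q) y)"
  unfolding sat_sys_below
proof (intro ballI impI)
  fix d assume d: "d \<in> T \<union> insert c Q" "ld (pol d) < y"
  show "satisfies a d"
  proof (cases "d = c")
    case True
    then have "satisfies a c'" using assms(2) d reduce_constr by (simp add: sat_sys_below)
    moreover have "sat a (sys_below (T \<union> Q) (Suc (ld (pol c))))"
      using assms(2) d True by (auto simp: sat_sys_below)
    ultimately show ?thesis using satisfies_reduce assms(1) True by blast
  next
    case False
    then show ?thesis using assms(2) d by (auto simp: sat_sys_below)
  qed
qed

lemma sat_reduce:
  assumes "a \<in> {1..n} \<rightarrow>\<^sub>E UNIV"
  shows "sat a (T \<union> insert c' Q) \<longleftrightarrow> sat a (T \<union> insert c Q)"
proof -
  have "sat a (sys_below (T \<union> Q) y)" if "sat a (T \<union> Q)" for y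
    using that by (auto simp: sat_def sys_below_def)
  then show ?thesis using satisfies_reduce[OF assms] by auto
qed

lemma invariant_reduce: "invariant n (T, insert c' Q)"
  unfolding invariant_def fst_conv snd_conv system_of_def
proof (intro conjI ballI)
  show "candidate n T" using inv by (simp add: invariant_def)
  show "algebraic_system n (insert c' Q)"
    using inv reduce_constr by (simp add: invariant_def algebraic_system_def)
  fix d a assume "d \<in> T" "a \<in> Sol n (sys_below (T \<union> insert c' Q) (ld (pol d)))"
  then show "elem_ok a d"
    using inv sat_below_reduce by (simp add: invariant_def system_of_def Sol_iff_sat)
qed

end

lemma invariant_remove:
  assumes inv: "invariant n (T, insert c Q)"
    and "\<And>a. a \<in> {1..n} \<rightarrow>\<^sub>E UNIV \<Longrightarrow> satisfies a c"
  shows "invariant n (T, Q)"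
  unfolding invariant_def fst_conv snd_conv system_of_def
proof (intro conjI ballI)
  show "candidate n T" "algebraic_system n Q"
    using inv by (simp_all add: invariant_def algebraic_system_def)
  fix d a assume "d \<in> T" "a \<in> Sol n (sys_below (T \<union> Q) (ld (pol d)))"
  moreover from this assms(2) have "a \<in> Sol n (sys_below (T \<union> insert c Q) (ld (pol d)))"
    by (auto simp: Sol_iff_sat sat_sys_below)
  ultimately show "elem_ok a d" using inv by (simp add: invariant_def system_of_def)
qed

definition eq_degs :: "'f psys \<Rightarrow> enat list" where
  "eq_degs S = map (eq_deg S) [1..<Suc n]"

text \<open>\<open>eq_leader\<close> is infinite if all equations in the queue reduce to 0.\<close>

definition eq_leader :: "'f psys \<Rightarrow> enat" where
  "eq_leader S = Inf {enat (ld r) |r. Equation r \<in> snd S \<and> reduce prem S r \<noteq> Some 0}"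

definition leaders :: "'f psys \<Rightarrow> nat multiset" where
  "leaders S = image_mset (\<lambda>c. ld (pol c)) (mset_set (snd S))"

definition psys_less :: "'f psys rel" where
  "psys_less = inv_image (lexn {(k, l). k < l} n <*lex*> {(k, l). k < l} <*lex*> mult {(k, l). k < l})
     (\<lambda>S. (eq_degs S, eq_leader S, leaders S))"

lemma wf_psys_less: "wf psys_less"
  unfolding psys_less_def by (intro wf_inv_image wf_lex_prod wf_lexn wf_mult wf)

lemma psys_less_eq_deg:
  assumes "1 \<le> x" "x \<le> n" "eq_deg S' x < eq_deg S x" "\<And>y. y < x \<Longrightarrow> eq_deg S' y = eq_deg S y"
  shows "(S', S) \<in> psys_less"
proof -
  have upt: "[1..<Suc n] = [1..<x] @ x # [Suc x..<Suc n]"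
    using assms(1,2) upt_add_eq_append[of 1 x "Suc n - x"] by (simp add: upt_conv_Cons)
  have "map (eq_deg S') [1..<x] = map (eq_deg S) [1..<x]"
    using assms(4) by simp
  then have "eq_degs S' = map (eq_deg S) [1..<x] @ eq_deg S' x # map (eq_deg S') [Suc x..<Suc n]"
    unfolding eq_degs_def upt by simp
  moreover have "eq_degs S = map (eq_deg S) [1..<x] @ eq_deg S x # map (eq_deg S) [Suc x..<Suc n]"
    unfolding eq_degs_def upt by simp
  moreover have "length (eq_degs S') = n" "length (eq_degs S) = n"
    by (simp_all add: eq_degs_def)
  ultimately have "(eq_degs S', eq_degs S) \<in> lexn {(k, l). k < l} n"
    unfolding lexn_conv using assms(3) by blast
  then show ?thesis by (simp add: psys_less_def)
qed

lemma eq_degs_cong: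
  assumes "candidate n T" "candidate n T'" "eqs T' = eqs T"
  shows "eq_degs (T', Q') = eq_degs (T, Q)"
proof -
  have "eq_deg (T', Q') y = eq_deg (T, Q) y" for y
    using assms by (intro eq_deg_cong[where n = n]) (auto simp: eqs_def)
  then show ?thesis by (simp add: eq_degs_def)
qed

lemma psys_less_eq_leader:
  assumes "candidate n T" "candidate n T'" "eqs T' = eqs T"
    and "eq_leader (T', Q') < eq_leader (T, Q)"
  shows "((T', Q'), (T, Q)) \<in> psys_less"
  using eq_degs_cong[OF assms(1-3)] assms(4) by (simp add: psys_less_def)

lemma psys_less_leaders:
  assumes "candidate n T" "candidate n T'" "eqs T' = eqs T"
    and "finite Q'" "c \<notin> Q" "Q \<subseteq> Q'" "\<And>d. d \<in> Q' - Q \<Longrightarrow> ld (pol d) < ld (pol c)"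
    and "eq_leader (T', Q') = eq_leader (T, insert c Q)"
  shows "((T', Q'), (T, insert c Q)) \<in> psys_less"
proof -
  have "finite Q" using assms(4,6) finite_subset by blast
  have Q': "Q' = Q \<union> (Q' - Q)" using assms(6) by blast
  have "mset_set Q' = mset_set Q + mset_set (Q' - Q)"
    using \<open>finite Q\<close> assms(4) by (subst Q', subst mset_set_Union) auto
  then have "leaders (T', Q') = image_mset (\<lambda>c. ld (pol c)) (mset_set Q) +
      image_mset (\<lambda>c. ld (pol c)) (mset_set (Q' - Q))"
    by (simp add: leaders_def)
  moreover have "leaders (T, insert c Q) =
      image_mset (\<lambda>c. ld (pol c)) (mset_set Q) + {#ld (pol c)#}"
    using assms(5) \<open>finite Q\<close> by (simp add: leaders_def)
  moreover have "(image_mset (\<lambda>c. ld (pol c)) (mset_set Q) +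
      image_mset (\<lambda>c. ld (pol c)) (mset_set (Q' - Q)),
      image_mset (\<lambda>c. ld (pol c)) (mset_set Q) + {#ld (pol c)#}) \<in> mult {(k, l). k < l}"
    using assms(4,7) by (intro one_step_implies_mult) auto
  ultimately show ?thesis
    using eq_degs_cong[OF assms(1-3)] assms(8) by (simp add: psys_less_def)
qed

lemma eq_leader_cong:
  assumes "candidate n T" "candidate n T'" "eqs T' = eqs T"
    and "pol ` Q \<subseteq> poly_ring n"
    and "\<And>r. Equation r \<in> Q \<Longrightarrow> reduce prem (T, Q) r \<noteq> Some 0 \<Longrightarrow> Equation r \<in> Q'"
    and "\<And>r. Equation r \<in> Q' \<Longrightarrow> Equation r \<in> Q"
  shows "eq_leader (T', Q') = eq_leader (T, Q)"
proof -
  have "reduce prem (T', Q') r = reduce prem (T, Q) r" if "Equation r \<in> Q" for r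
    using that assms(4) reduce_eqs[OF assms(2,1,3), of r Q' Q] by force
  then have "{enat (ld r) |r. Equation r \<in> snd (T', Q') \<and> reduce prem (T', Q') r \<noteq> Some 0} =
      {enat (ld r) |r. Equation r \<in> snd (T, Q) \<and> reduce prem (T, Q) r \<noteq> Some 0}"
    using assms(5,6) unfolding snd_conv by (metis (no_types, opaque_lifting))
  then show ?thesis by (simp add: eq_leader_def)
qed

end

locale decompose = pdiv_ring n prem pquo
  for n :: nat and prem pquo :: "'f::field_char_0 pdiv" +
  fixes sel :: "'f system \<Rightarrow> 'f mpoly constr"
  assumes selection: "selection_strategy n sel"
begin

definition refines :: "'f psys set \<Rightarrow> 'f system \<Rightarrow> bool" where
  "refines N U \<longleftrightarrow> (\<forall>a\<in>{1..n} \<rightarrow>\<^sub>E UNIV. (\<forall>S'\<in>N. sat a (system_of S') \<longrightarrow> sat a U) \<and>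
     (sat a U \<longrightarrow> (\<exists>!S'. S' \<in> N \<and> sat a (system_of S'))))"

lemma process_step:
  assumes inv: "invariant n S" and S: "snd S \<noteq> {}"
  shows "\<exists>N. process prem pquo sel S = Some N \<and> finite N \<and> refines N (system_of S) \<and>
    (\<forall>S'\<in>N. invariant n S' \<and> (S', S) \<in> psys_less)"
proof -
  obtain T Q' where S_eq: "S = (T, Q')" by (cases S)
  define c where "c = sel Q'"
  define Q where "Q = Q' - {c}"
  have T: "candidate n T" and Q'_alg: "algebraic_system n Q'"
    using inv by (simp_all add: S_eq invariant_def)
  have sel: "c \<in> Q'" "\<And>q r. c = Equation q \<Longrightarrow> Equation r \<in> Q' \<Longrightarrow> ld q \<le> ld r"
    "\<And>q r. c = Inequation q \<Longrightarrow> Equation r \<in> Q' \<Longrightarrow> ld q < ld r"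
    using selection Q'_alg S unfolding selection_strategy_def c_def S_eq by (auto simp: not_less not_le)
  have Q': "Q' = insert c Q" and "c \<notin> Q" using sel(1) by (auto simp: Q_def)
  have inv: "invariant n (T, insert c Q)" using inv by (simp add: S_eq Q')
  have Q_alg: "finite Q" "pol ` insert c Q \<subseteq> poly_ring n"
    using Q'_alg by (auto simp: Q' algebraic_system_def)
  have T_n: "pol ` T \<subseteq> poly_ring n" using T by (simp add: candidate_def algebraic_system_def)
  obtain q where red: "reduce prem (T, Q) (pol c) = Some q"
    using reduce_neq_None[of "(T, Q)" "pol c"] T_n Q_alg by auto
  define c' where "c' = map_constr (\<lambda>_. q) c"
  note q = reduce_constr[OF inv red c'_def]
  note inv' = invariant_reduce[OF inv red c'_def]
  note sat' = sat_reduce[OF inv red c'_def]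
  have red_c: "reduce prem (T, insert c Q) (pol c) = Some q"
    using reduce_eqs[OF T T refl, of "pol c" "insert c Q" Q] red Q_alg by simp
  have leader_ge: "enat (ld (pol c)) \<le> eq_leader (T, insert c Q)"
    unfolding eq_leader_def
  proof (rule Inf_greatest)
    fix y assume "y \<in> {enat (ld r) |r. Equation r \<in> snd (T, insert c Q) \<and> reduce prem (T, insert c Q) r \<noteq> Some 0}"
    then obtain r where "y = enat (ld r)" "Equation r \<in> Q'" using Q' by auto
    then show "enat (ld (pol c)) \<le> y"
      using sel(2)[of "pol c" r] sel(3)[of "pol c" r] by (cases c) auto
  qed
  have less_remove: "((T, Q), (T, insert c Q)) \<in> psys_less" if "c = Inequation (pol c) \<or> q = 0"
  proof (rule psys_less_leaders[OF T T refl \<open>finite Q\<close> \<open>c \<notin> Q\<close> order_refl])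
    show "eq_leader (T, Q) = eq_leader (T, insert c Q)"
    proof (rule eq_leader_cong[OF T T refl Q_alg(2)])
      fix r assume r: "Equation r \<in> insert c Q" "reduce prem (T, insert c Q) r \<noteq> Some 0"
      then show "Equation r \<in> Q" using that red_c by (cases c) auto
    qed simp
  qed simp
  have system: "system_of S = T \<union> insert c Q" by (simp add: system_of_def S_eq Q')
  have process: "process prem pquo sel S = (case c' of
       Equation q \<Rightarrow>
         if ld q = 0 then Some (if q \<noteq> 0 then {} else {(T, Q)})
         else (case elem_at (T, Q) (ld q) of
                 Some (Equation t) \<Rightarrow> case1 prem (T, Q) q
               | _ \<Rightarrow> case2 prem pquo (T, Q) q)
     | Inequation q \<Rightarrow>
         if ld q = 0 then Some (if q = 0 then {} else {(T, Q)})
         else (case elem_at (T, Q) (ld q) of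
                 Some (Equation t) \<Rightarrow> case3 prem pquo (T, Q) q
               | _ \<Rightarrow> case4 prem pquo (T, Q) q))"
    using red unfolding process_def Let_def S_eq fst_conv snd_conv c_def[symmetric] Q_def[symmetric]
    by (cases c) (simp_all add: c'_def)
  show ?thesis
  proof (cases "ld q = 0")
    case True
    then obtain k where k: "q = single 0 k" using ld_0_const q(2) by blast
    have phi_q: "phi a q = 0 \<longleftrightarrow> q = 0" for a by (simp add: k)
    show ?thesis
    proof (cases "(c' = Equation q) = (q = 0)")
      case True
      have sat_c': "satisfies a c'" for a
        using True phi_q[of a] q(1) by (cases c') auto
      have "process prem pquo sel S = Some {(T, Q)}"
        using process \<open>ld q = 0\<close> True q(1) by (cases c') auto
      moreover have "invariant n (T, Q)" using invariant_remove[OF inv'] sat_c' by blast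
      moreover have "refines {(T, Q)} (system_of S)"
      proof -
        have "sat a (T \<union> Q) \<longleftrightarrow> sat a (system_of S)" if "a \<in> {1..n} \<rightarrow>\<^sub>E UNIV" for a
          using sat'[OF that] sat_c' system by simp
        then show ?thesis by (auto simp: refines_def system_of_def)
      qed
      moreover have "c = Inequation (pol c) \<or> q = 0" using True c'_def by (cases c) auto
      ultimately show ?thesis using less_remove S_eq Q' by auto
    next
      case False
      have sat_c': "\<not> satisfies a c'" for a
        using False phi_q[of a] q(1) by (cases c') auto
      have "process prem pquo sel S = Some {}"
        using process \<open>ld q = 0\<close> False q(1) by (cases c') auto
      moreover have "refines {} (system_of S)"
      proof -
        have "\<not> sat a (system_of S)" if "a \<in> {1..n} \<rightarrow>\<^sub>E UNIV" for a
          using sat'[OF that] sat_c' system by simp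
        then show ?thesis by (auto simp: refines_def)
      qed
      ultimately show ?thesis by auto
    qed
  next
    case False
    interpret pdiv_case n prem pquo T Q c' "ld q"
      using inv' q False by unfold_locales auto
    have eq_iff: "(\<exists>t. elem_at (T, Q) (ld q) = Some (Equation t)) \<longleftrightarrow> (\<exists>t. Equation t \<in> T \<and> ld t = ld q)"
      using elem_at_eq_Some_iff[OF T, of Q "ld q" "Equation _"] by simp
    have "\<exists>N. process prem pquo sel S = Some N \<and> step N"
    proof (cases "\<exists>t. elem_at (T, Q) (ld q) = Some (Equation t)")
      case True
      then obtain t where t: "elem_at (T, Q) (ld q) = Some (Equation t)" by blast
      then have t': "Equation t \<in> T" "ld t = ld q" by (simp_all add: elem_at_eq_Some_iff[OF T])
      show ?thesis
      proof (cases c')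
        case (Equation q')
        then have "c' = Equation (pol c')" "q' = q" using q(1) by auto
        with case1[OF this(1) t'] t False show ?thesis unfolding process Equation q(1) by simp
      next
        case (Inequation q')
        then have "c' = Inequation (pol c')" "q' = q" using q(1) by auto
        with case3[OF this(1) t'] t False show ?thesis unfolding process Inequation q(1) by simp
      qed
    next
      case no: False
      then have no': "\<And>t. Equation t \<in> T \<Longrightarrow> ld t \<noteq> ld q" using eq_iff by blast
      have other: "(case elem_at (T, Q) (ld q) of Some (Equation t) \<Rightarrow> A t | _ \<Rightarrow> B) = B" for A and B :: "'f psys set option"
        using no by (auto split: option.split constr.split)
      show ?thesis
      proof (cases c')
        case (Equation q')
        then have "c' = Equation (pol c')" "q' = q" using q(1) by auto
        with case2[OF this(1) no'] False show ?thesis unfolding process Equation q(1) by (simp add: other)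
      next
        case (Inequation q')
        then have "c' = Inequation (pol c')" "q' = q" using q(1) by auto
        with case4[OF this(1) no'] False show ?thesis unfolding process Inequation q(1) by (simp add: other)
      qed
    qed
    then obtain N where N: "process prem pquo sel S = Some N" "step N" by blast
    have "refines N (system_of S)"
      using N(2) sat' unfolding step_def refines_def system by simp
    moreover have "(S', S) \<in> psys_less" if "S' \<in> N" for S'
    proof -
      obtain T1 Q1 where S': "S' = (T1, Q1)" by (cases S')
      have "invariant n S'" and progress: "progress S'" using N(2) that by (simp_all add: step_def)
      then have T1: "candidate n T1" and Q1: "finite Q1" "pol ` Q1 \<subseteq> poly_ring n"
        by (simp_all add: S' invariant_def algebraic_system_def)
      have eq_deg_Q: "eq_deg (T, insert c Q) y = eq_deg (T, Q) y" for y
        by (simp add: eq_deg_def elem_at_def)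
      from progress consider
          "eq_deg S' (ld q) < eq_deg (T, Q) (ld q)" "\<forall>y<ld q. eq_deg S' y = eq_deg (T, Q) y"
        | r where "eqs T1 = eqs T" "Equation r \<in> Q1" "ld r < ld q" "reduce prem (T, Q) r \<noteq> Some 0"
        | "c' = Inequation (pol c')" "eqs T1 = eqs T" "Q \<subseteq> Q1" "Q1 \<subseteq> Q \<union> {Inequation p |p. ld p < ld q}"
        unfolding progress_def S' by auto
      then show ?thesis
      proof cases
        case 1
        then show ?thesis
          using False x_le unfolding S_eq Q' by (intro psys_less_eq_deg[of "ld q"]) (auto simp: eq_deg_Q)
      next
        case 2
        have "reduce prem (T1, Q1) r \<noteq> Some 0"
          using reduce_eqs[OF T1 T 2(1), of r Q1 Q] 2(2,4) Q1 by force
        then have "eq_leader (T1, Q1) \<le> enat (ld r)"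
          unfolding eq_leader_def using 2(2) by (intro Inf_lower) auto
        also have "\<dots> < enat (ld (pol c))" using 2(3) q(3) by simp
        also note leader_ge
        finally show ?thesis
          unfolding S' S_eq Q' using psys_less_eq_leader[OF T T1 2(1)] by blast
      next
        case 3
        then have ineq: "c = Inequation (pol c)" unfolding c'_def by (cases c) auto
        show ?thesis
          unfolding S' S_eq Q'
        proof (rule psys_less_leaders[OF T T1 3(2) Q1(1) \<open>c \<notin> Q\<close> 3(3)])
          show "ld (pol d) < ld (pol c)" if "d \<in> Q1 - Q" for d
            using that 3(4) q(3) by auto
          show "eq_leader (T1, Q1) = eq_leader (T, insert c Q)"
          proof (rule eq_leader_cong[OF T T1 3(2) Q_alg(2)])
            show "Equation r \<in> Q1" if "Equation r \<in> insert c Q" for r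
              using that ineq 3(3) by (cases c) auto
            show "Equation r \<in> insert c Q" if "Equation r \<in> Q1" for r
              using that 3(4) by auto
          qed
        qed
      qed
    qed
    ultimately show ?thesis using N by (auto simp: step_def)
  qed
qed

definition state_ok :: "'f system \<Rightarrow> 'f state \<Rightarrow> bool" where
  "state_ok S' st \<longleftrightarrow> finite (fst st \<union> snd st) \<and> (\<forall>S\<in>fst st \<union> snd st. invariant n S) \<and>
     (\<forall>S\<in>snd st. snd S = {}) \<and> refines (fst st \<union> snd st) S'"

lemma state_ok_start:
  assumes "algebraic_system n S'"
  shows "state_ok S' (decompose_start S')"
proof -
  have "invariant n ({}, S')"
    using assms by (simp add: invariant_def candidate_def algebraic_system_def)
  moreover have "refines {({}, S')} S'" by (auto simp: refines_def system_of_def sat_def)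
  ultimately show ?thesis by (simp add: state_ok_def decompose_start_def)
qed

lemma refines_replace:
  assumes "refines F U" "S \<in> F" "refines N (system_of S)"
  shows "refines (F - {S} \<union> N) U"
  unfolding refines_def
proof (intro ballI conjI impI)
  fix a :: "nat \<Rightarrow> 'f alg_closure" and S'
  assume a: "a \<in> {1..n} \<rightarrow>\<^sub>E UNIV" and "S' \<in> F - {S} \<union> N" "sat a (system_of S')"
  with assms show "sat a U" unfolding refines_def by blast
next
  fix a :: "nat \<Rightarrow> 'f alg_closure"
  assume a: "a \<in> {1..n} \<rightarrow>\<^sub>E UNIV" "sat a U"
  then obtain S0 where S0: "S0 \<in> F" "sat a (system_of S0)"
    "\<And>S'. S' \<in> F \<Longrightarrow> sat a (system_of S') \<Longrightarrow> S' = S0"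
    using assms(1) unfolding refines_def by blast
  show "\<exists>!S'. S' \<in> F - {S} \<union> N \<and> sat a (system_of S')"
  proof (cases "S0 = S")
    case True
    then obtain S1 where "S1 \<in> N" "sat a (system_of S1)"
      "\<And>S'. S' \<in> N \<Longrightarrow> sat a (system_of S') \<Longrightarrow> S' = S1"
      using assms(3) a S0(2) unfolding refines_def by blast
    with True S0 show ?thesis by (intro ex1I[of _ S1]) blast+
  next
    case False
    then have "\<not> sat a (system_of S)" using S0(3) assms(2) by blast
    then have "\<not> sat a (system_of S')" if "S' \<in> N" for S'
      using that assms(3) a unfolding refines_def by blast
    with False S0 show ?thesis by (intro ex1I[of _ S0]) blast+
  qed
qed

lemma decompose_step_ok:
  assumes "decompose_step prem pquo sel st st'" "state_ok S' st"
  shows "state_ok S' st' \<and> (mset_set (fst st'), mset_set (fst st)) \<in> mult psys_less"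
  using assms
proof (cases rule: decompose_step.cases)
  case (finished S P Result)
  have P: "finite P" using assms(2) finished by (simp add: state_ok_def)
  have "P - {S} \<union> insert S Result = P \<union> Result" using finished by blast
  then have "state_ok S' st'" using assms(2) finished by (simp add: state_ok_def)
  moreover have "(mset_set (P - {S}) + {#}, mset_set (P - {S}) + {#S#}) \<in> mult psys_less"
    by (intro one_step_implies_mult) auto
  then have "(mset_set (P - {S}), mset_set P) \<in> mult psys_less"
    using finished P by (simp add: mset_set.remove)
  ultimately show ?thesis using finished by simp
next
  case (processed S P N Result)
  have P: "finite P" and inv: "invariant n S" using assms(2) processed by (simp_all add: state_ok_def)
  from process_step[OF inv] processed have N: "finite N" "refines N (system_of S)"
    "\<And>S'. S' \<in> N \<Longrightarrow> invariant n S' \<and> (S', S) \<in> psys_less" by auto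
  have "S \<notin> Result" using assms(2) processed by (auto simp: state_ok_def)
  then have eq: "P - {S} \<union> N \<union> Result = P \<union> Result - {S} \<union> N" by blast
  have "refines (P \<union> Result - {S} \<union> N) S'"
    using assms(2) processed N(2) by (intro refines_replace) (auto simp: state_ok_def)
  then have "state_ok S' st'"
    using assms(2) processed N(1,3) unfolding state_ok_def by (auto simp: eq)
  moreover have "(mset_set (P - {S}) + mset_set (N - (P - {S})), mset_set (P - {S}) + {#S#}) \<in> mult psys_less"
    using N by (intro one_step_implies_mult) auto
  moreover have "mset_set (P - {S} \<union> N) = mset_set (P - {S}) + mset_set (N - (P - {S}))"
  proof -
    have "P - {S} \<union> N = (P - {S}) \<union> (N - (P - {S}))" by blast
    then show ?thesis using P N(1) by (metis Diff_disjoint finite_Diff mset_set_Union)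
  qed
  ultimately show ?thesis using processed P by (simp add: mset_set.remove)
qed

lemma reachable_ok:
  assumes "(decompose_step prem pquo sel)\<^sup>*\<^sup>* (decompose_start S') st" "algebraic_system n S'"
  shows "state_ok S' st"
  using assms(1)
  by (induction rule: rtranclp_induct) (use state_ok_start[OF assms(2)] decompose_step_ok in blast)+

lemma terminates:
  assumes "algebraic_system n S'"
  shows "decompose_terminates prem pquo sel S'"
  unfolding decompose_terminates_def
proof (intro conjI notI allI impI)
  assume "\<exists>\<sigma>. \<sigma> 0 = decompose_start S' \<and> (\<forall>k. decompose_step prem pquo sel (\<sigma> k) (\<sigma> (Suc k)))"
  then obtain \<sigma> where \<sigma>: "\<sigma> 0 = decompose_start S'"
    "\<And>k. decompose_step prem pquo sel (\<sigma> k) (\<sigma> (Suc k))" by blast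
  have "state_ok S' (\<sigma> k)" for k
    by (induction k) (use \<sigma> state_ok_start[OF assms] decompose_step_ok in \<open>simp, blast\<close>)
  then have "\<forall>k. (mset_set (fst (\<sigma> (Suc k))), mset_set (fst (\<sigma> k))) \<in> mult psys_less"
    using decompose_step_ok \<sigma>(2) by blast
  then have "\<exists>f. \<forall>k. (f (Suc k), f k) \<in> mult psys_less"
    by (rule exI[of _ "\<lambda>k. mset_set (fst (\<sigma> k))"])
  moreover have "wf (mult psys_less)" using wf_psys_less by (rule wf_mult)
  ultimately show False unfolding wf_iff_no_infinite_down_chain by blast
next
  fix P Result S
  assume "(decompose_step prem pquo sel)\<^sup>*\<^sup>* (decompose_start S') (P, Result)" "S \<in> P" "snd S \<noteq> {}"
    "process prem pquo sel S = None"
  with reachable_ok[OF _ assms] process_step[of S] show False by (fastforce simp: state_ok_def)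
qed

lemma correct:
  assumes "algebraic_system n S'"
  shows "decompose_correct n prem pquo sel S'"
  unfolding decompose_correct_def
proof (intro allI impI)
  fix Result assume "(decompose_step prem pquo sel)\<^sup>*\<^sup>* (decompose_start S') ({}, Result)"
  then have "state_ok S' ({}, Result)" using assms by (rule reachable_ok)
  then have fin: "finite Result" and inv: "\<And>S. S \<in> Result \<Longrightarrow> invariant n S \<and> snd S = {}"
    and ref: "refines Result S'" by (simp_all add: state_ok_def)
  have "simple_system n (system_of S)" if "S \<in> Result" for S
    using inv[OF that] invariant_simple_system[of n "fst S"] by (cases S) simp
  moreover have "Sol n S' = (\<Union>S\<in>Result. Sol n (system_of S))"
    using ref unfolding refines_def Sol_iff_sat set_eq_iff UN_iff by blast
  moreover have "disjoint_family_on (\<lambda>S. Sol n (system_of S)) Result"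
    unfolding disjoint_family_on_def
  proof (intro ballI impI)
    fix S1 S2 assume "S1 \<in> Result" "S2 \<in> Result" "S1 \<noteq> S2"
    then have "\<not> (a \<in> Sol n (system_of S1) \<and> a \<in> Sol n (system_of S2))" for a
      using ref unfolding refines_def Sol_iff_sat by blast
    then show "Sol n (system_of S1) \<inter> Sol n (system_of S2) = {}" by blast
  qed
  ultimately show "thomas_decomposition n S' Result system_of"
    using fin by (simp add: thomas_decomposition_def)
qed

end

theorem mainTheorem1:
  fixes n :: nat
    and prem pquo :: "'f::field_char_0 pdiv"
    and sel :: "'f system \<Rightarrow> 'f mpoly constr"
    and S' :: "'f system"
  assumes "pseudo_division n prem pquo"
    and "scaling_compatible n prem"
    and "selection_strategy n sel"
    and "algebraic_system n S'"
  shows "decompose_terminates prem pquo sel S' \<and> decompose_correct n prem pquo sel S'"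
proof -
  interpret decompose n prem pquo sel
    using assms(1-3) by unfold_locales
  show ?thesis using terminates correct assms(4) by blast
qed

end
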